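(* Let $(M,\mathcal{T})$ be a triangulated closed 3-manifold with set of real hyperbolic ball packings $\mathcal{M}_{\mathcal{T}}\subset\mathbb{R}^N_+$, combinatorial scalar curvature $\pmb{K}=(K_1,\dots,K_N):\mathcal{M}_{\mathcal{T}}\to\mathbb{R}^N$, and functional $\mathcal{S}:\mathcal{M}_{\mathcal{T}}\to\mathbb{R}$, $\mathcal{S}(\pmb{r})=\sum_{i\in\mathcal{T}_0}K_i(\pmb{r})\,r_i-2\,\mathrm{vol}_M(\pmb{r})$. The following are equivalent: (1) There exists a real ball packing $\overline{\pmb{r}}\in\mathcal{M}_{\mathcal{T}}$ such that $\pmb{K}(\overline{\pmb{r}})=\pmb{0}$. (2) The functional $\mathcal{S}$ has a critical point in $\mathcal{M}_{\mathcal{T}}$. (3) The infimum $Y_{\mathcal{T}}:=\inf_{\pmb{r}\in\mathcal{M}_{\mathcal{T}}}\mathcal{S}(\pmb{r})$ is attained by a real ball packing, i.e. $\mathcal{S}$ has a global minimizer in $\mathcal{M}_{\mathcal{T}}$.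
   Context: $M$ is a closed 3-manifold with a (finite) triangulation $\mathcal{T}=\{\mathcal{T}_0,\mathcal{T}_1,\mathcal{T}_2,\mathcal{T}_3\}$ (vertices, edges, faces, tetrahedra), $\mathcal{T}_0=\{1,\dots,N\}$; $\{ijkl\}\in\mathcal{T}_3$ denotes the tetrahedron with vertices $i,j,k,l$. $\mathbb{R}_+=(0,\infty)$. A (hyperbolic) ball packing is a vector $\pmb{r}=(r_1,\dots,r_N)\in\mathbb{R}^N_+$. For $(r_i,r_j,r_k,r_l)\in\mathbb{R}_+^4$ put $$Q=(\coth r_i+\coth r_j+\coth r_k+\coth r_l)^2-2(\coth^2 r_i+\coth^2 r_j+\coth^2 r_k+\coth^2 r_l)+4 .$$ A non-degenerate tetrahedron in hyperbolic space $\mathbb{H}^3$ (curvature $-1$) with edge lengths $l_{ab}=r_a+r_b$ ($a\neq b$ in $\{i,j,k,l\}$) exists if and only if $Q>0$, and it is then unique up to isometry. The ball packing $\pmb{r}$ is real if $Q(r_i,r_j,r_k,r_l)>0$ for every $\{ijkl\}\in\mathcal{T}_3$; $\mathcal{M}_{\mathcal{T}}$ is the (open) set of real ball packings. For $\pmb{r}\in\mathcal{M}_{\mathcal{T}}$, $\alpha_{ijkl}$ denotes the solid angle at vertex $i$ of the corresponding hyperbolic tetrahedron (the sum of the three dihedral angles at the edges through $i$, minus $\pi$), $\mathrm{vol}_{ijkl}(\pmb r)$ its hyperbolic volume, $\mathrm{vol}_M(\pmb{r})=\sum_{\{ijkl\}\in\mathcal{T}_3}\mathrm{vol}_{ijkl}(\pmb{r})$,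 and $K_i=4\pi-\sum\alpha_{ijkl}$, where the sum is over all tetrahedra $\{ijkl\}$ incident to $i$. *)

theory Defs
  imports "HOL-Analysis.Analysis"
begin

section \<open>Triangulated closed 3-manifolds\<close>

text \<open>
  Closed means compact without boundary. Connectedness is not assumed.
\<close>

definition closed_3_manifold :: "'a topology \<Rightarrow> bool" where
  "closed_3_manifold M \<longleftrightarrow>
     compact_space M \<and> Hausdorff_space M \<and> second_countable M \<and>
     (\<forall>x \<in> topspace M. \<exists>U. openin M U \<and> x \<in> U \<and>
        subtopology M U homeomorphic_space (euclidean :: (real^3) topology))"

text \<open>
  The vertices of a triangulation are the elements of a finite type \<open>'n\<close>, so that
  \<open>real^'n\<close> is the space of vectors indexed by the vertices. A triangulation is given by its
  set \<open>T\<close> of (nonempty) simplices, each identified with its vertex set.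
\<close>

definition abstract_complex :: "'n::finite set set \<Rightarrow> bool" where
  "abstract_complex T \<longleftrightarrow>
     (\<forall>i. {i} \<in> T) \<and> {} \<notin> T \<and>
     (\<forall>\<sigma> \<in> T. \<forall>\<tau>. \<tau> \<subseteq> \<sigma> \<and> \<tau> \<noteq> {} \<longrightarrow> \<tau> \<in> T)"

definition simplices :: "nat \<Rightarrow> 'n::finite set set \<Rightarrow> 'n set set" where
  "simplices d T = {\<sigma> \<in> T. card \<sigma> = d + 1}"

definition geometric_realization :: "'n::finite set set \<Rightarrow> (real^'n) set" where
  "geometric_realization T = (\<Union>\<sigma> \<in> T. convex hull ((\<lambda>i. axis i 1) ` \<sigma>))"

definition triangulates :: "'n::finite set set \<Rightarrow> 'a topology \<Rightarrow> bool" where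
  "triangulates T M \<longleftrightarrow>
     abstract_complex T \<and> T = (\<Union>d \<le> 3. simplices d T) \<and>
     top_of_set (geometric_realization T) homeomorphic_space M"


section \<open>Hyperbolic 3-space\<close>

text \<open>
  We use the projective (Beltrami--Klein) model: the open unit ball of \<open>real^3\<close> with the
  Riemannian metric \<open>klein_metric\<close>. Its geodesics are the straight chords, hence hyperbolic
  planes are traces of affine planes, and hyperbolic convex hulls are Euclidean ones. The
  determinant of the metric tensor at \<open>x\<close> is \<open>(1 - x \<bullet> x) ^ (-4)\<close>, which gives the
  density of the volume.
\<close>

definition hyp_space :: "(real^3) set" where
  "hyp_space = ball 0 1"

definition klein_metric :: "real^3 \<Rightarrow> real^3 \<Rightarrow> real^3 \<Rightarrow> real" where
  "klein_metric x u v =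
     (u \<bullet> v) / (1 - x \<bullet> x) + (x \<bullet> u) * (x \<bullet> v) / (1 - x \<bullet> x)\<^sup>2"

definition hyp_dist :: "real^3 \<Rightarrow> real^3 \<Rightarrow> real" where
  "hyp_dist x y = arcosh ((1 - x \<bullet> y) / (sqrt (1 - x \<bullet> x) * sqrt (1 - y \<bullet> y)))"

definition hyp_volume :: "(real^3) set \<Rightarrow> real" where
  "hyp_volume A = integral A (\<lambda>x. 1 / (1 - x \<bullet> x)\<^sup>2)"

text \<open>
  The angle at \<open>x\<close> between two tangent vectors, and the component of a tangent vector
  orthogonal to \<open>w\<close>, with respect to the hyperbolic metric.
\<close>

definition hyp_angle :: "real^3 \<Rightarrow> real^3 \<Rightarrow> real^3 \<Rightarrow> real" where
  "hyp_angle x u v =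
     arccos (klein_metric x u v / (sqrt (klein_metric x u u) * sqrt (klein_metric x v v)))"

definition orth_component :: "real^3 \<Rightarrow> real^3 \<Rightarrow> real^3 \<Rightarrow> real^3" where
  "orth_component x w u = u - (klein_metric x u w / klein_metric x w w) *\<^sub>R w"

text \<open>
  The dihedral angle at the geodesic \<open>ab\<close> between the half-planes through \<open>c\<close> and \<open>d\<close>
  bounded by that geodesic, measured at \<open>a\<close>: since geodesics are straight, \<open>y - a\<close>
  is tangent at \<open>a\<close> to the geodesic from \<open>a\<close> to \<open>y\<close>.
\<close>

definition hyp_dihedral :: "real^3 \<Rightarrow> real^3 \<Rightarrow> real^3 \<Rightarrow> real^3 \<Rightarrow> real" where
  "hyp_dihedral a b c d =
     hyp_angle a (orth_component a (b - a) (c - a)) (orth_component a (b - a) (d - a))"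


section \<open>Hyperbolic ball packings\<close>

definition coth :: "real \<Rightarrow> real" where
  "coth x = cosh x / sinh x"

definition Q_form :: "real^'n::finite \<Rightarrow> 'n set \<Rightarrow> real" where
  "Q_form r \<sigma> = (\<Sum>i\<in>\<sigma>. coth (r $ i))\<^sup>2 - 2 * (\<Sum>i\<in>\<sigma>. (coth (r $ i))\<^sup>2) + 4"

definition real_packings :: "'n::finite set set \<Rightarrow> (real^'n) set" where
  "real_packings T = {r. (\<forall>i. r $ i > 0) \<and> (\<forall>\<sigma> \<in> simplices 3 T. Q_form r \<sigma> > 0)}"

text \<open>
  A non-degenerate hyperbolic tetrahedron with vertices \<open>p i\<close>, \<open>i \<in> \<sigma>\<close>, and
  edge lengths \<open>r $ i + r $ j\<close>. It is unique up to isometry and exists iff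
  \<open>Q_form r \<sigma> > 0\<close>, so for real packings the choice below affects neither angles
  nor volume.
\<close>

definition packing_tetrahedron :: "real^'n::finite \<Rightarrow> 'n set \<Rightarrow> ('n \<Rightarrow> real^3) \<Rightarrow> bool" where
  "packing_tetrahedron r \<sigma> p \<longleftrightarrow>
     p ` \<sigma> \<subseteq> hyp_space \<and> inj_on p \<sigma> \<and> \<not> affine_dependent (p ` \<sigma>) \<and>
     (\<forall>i\<in>\<sigma>. \<forall>j\<in>\<sigma>. i \<noteq> j \<longrightarrow> hyp_dist (p i) (p j) = r $ i + r $ j)"

definition tetrahedron :: "real^'n::finite \<Rightarrow> 'n set \<Rightarrow> 'n \<Rightarrow> real^3" where
  "tetrahedron r \<sigma> = (SOME p. packing_tetrahedron r \<sigma> p)"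

definition tet_volume :: "real^'n::finite \<Rightarrow> 'n set \<Rightarrow> real" where
  "tet_volume r \<sigma> = hyp_volume (convex hull (tetrahedron r \<sigma> ` \<sigma>))"

text \<open>
  The dihedral angle at the edge \<open>{i, j}\<close> of \<open>\<sigma>\<close>; \<open>hyp_dihedral\<close> is symmetric in
  its last two arguments, so the labelling of the two remaining vertices is irrelevant.
\<close>

definition dihedral_angle :: "real^'n::finite \<Rightarrow> 'n set \<Rightarrow> 'n \<Rightarrow> 'n \<Rightarrow> real" where
  "dihedral_angle r \<sigma> i j =
     (let p = tetrahedron r \<sigma> in
      THE \<theta>. \<exists>k l. \<sigma> - {i, j} = {k, l} \<and> k \<noteq> l \<and> \<theta> = hyp_dihedral (p i) (p j) (p k) (p l))"

definition solid_angle :: "real^'n::finite \<Rightarrow> 'n set \<Rightarrow> 'n \<Rightarrow> real" where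
  "solid_angle r \<sigma> i = (\<Sum>j \<in> \<sigma> - {i}. dihedral_angle r \<sigma> i j) - pi"

definition curvature :: "'n::finite set set \<Rightarrow> real^'n \<Rightarrow> real^'n" where
  "curvature T r = (\<chi> i. 4 * pi - (\<Sum>\<sigma> \<in> {\<sigma> \<in> simplices 3 T. i \<in> \<sigma>}. solid_angle r \<sigma> i))"

definition packing_volume :: "'n::finite set set \<Rightarrow> real^'n \<Rightarrow> real" where
  "packing_volume T r = (\<Sum>\<sigma> \<in> simplices 3 T. tet_volume r \<sigma>)"

definition S_functional :: "'n::finite set set \<Rightarrow> real^'n \<Rightarrow> real" where
  "S_functional T r = (\<Sum>i\<in>UNIV. curvature T r $ i * r $ i) - 2 * packing_volume T r"

text \<open>
  The infimum is taken in the extended reals, so that no lower bound is presupposed.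
\<close>

definition Y_invariant :: "'n::finite set set \<Rightarrow> ereal" where
  "Y_invariant T = (INF r \<in> real_packings T. ereal (S_functional T r))"

end

(*
For one tetrahedron put k_i = coth r_i. Its vertices in the Klein ball satisfy
1 - p_i . p_j = rho_i rho_j G_ij with G the matrix of the quadratic form
q(u) = (sum k_i u_i)^2 + (sum u_i)^2 - 2 sum u_i^2, and det G = -4Q. Writing the volume density
(1 - |x|^2)^(-2) as a radial integral of a Gaussian turns the volume into 4 sqrt Q times the integral of
exp(-q) over the positive orthant.

The dihedral angle at an edge is the sum of the two angles phi = arctan (2 w / sqrt Q) at the ends of
the opposite edge, where w_i = (sum k)/2 - k_i. In the coordinates phi, a Plackett type identity for
sqrt Q exp(-q) gives Schlaefli's formula d(2 vol) = - sum r_i d(alpha_i), and the Hessian of the volume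
is positive semidefinite: it never degenerates and is positive at the regular tetrahedron. The segment
between two real configurations may leave the domain, but at the first exit point the volume tends to 0.
In both cases the volume lies above its tangent.

Summed over the tetrahedra this says S(u) >= S(v) + K(v) . (u - v) for all real packings u, v, although
their set need not be convex. As K is continuous, S is differentiable with gradient K, so
critical points, zeros of K and global minimizers coincide.
*)
theory Submission
  imports Defs "HOL-Probability.Distributions"
begin

section \<open>Gaussian integrals over orthants\<close>

text \<open>The inequality for \<open>S\<close> is a tangent inequality with exchanged roles: the
  tangent of \<open>S\<close> at \<open>v\<close>, evaluated at \<open>u\<close>, pairs the radii of
  \<open>u\<close> with the angles of \<open>v\<close>. Per tetrahedron it compares twice the volume
  at the angles of \<open>v\<close> with its tangent at the angles of \<open>u\<close>. So the
  volume is studied as a function of angles, where Schlaefli's formula makes the radii its gradient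
  up to sign. The choice of phi: with W = tan phi one has k_i = X_i / sqrt E, where X_i is linear
  and E quadratic in W, and Q = 16 / E. The conditions |phi_i| < pi/2 and X_i^2 > E (three of the
  phi add up to more than pi/2) persist along segments; only E > 0 can fail. There E tends to 0
  while X_i stays positive, so each k_i grows like 1 / sqrt E and the volume is O(E^(3/2)). The use
  of Plackett: mixed second derivatives of exp(-q) integrate to Gaussian integrals over
  two-dimensional faces of the orthant. These are elementary: the discriminant is the square of k_i
  + k_j, and the logarithm is twice the edge length r_i + r_j.\<close>

definition halfline :: "real measure" where
  "halfline = restrict_space lborel {0..}"

lemma space_halfline [simp]: "space halfline = {0..}"
  by (simp add: halfline_def space_restrict_space)

lemma sigma_finite_halfline: "sigma_finite_measure halfline"
  unfolding halfline_def by (rule sigma_finite_measure_restrict_space) (auto simp: sigma_finite_lborel)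

lemma id_halfline: "(\<lambda>x. x) \<in> borel_measurable halfline"
  unfolding halfline_def by (rule measurable_restrict_space1) auto

lemma halfline_coord:
  "i \<in> I \<Longrightarrow> (\<lambda>u. u i) \<in> borel_measurable (PiM I (\<lambda>_. halfline))"
  using measurable_comp[OF measurable_component_singleton[of i I "\<lambda>_. halfline"] id_halfline]
  by (simp add: comp_def)

lemma space_PiM_halflineD: "u \<in> space (PiM I (\<lambda>_. halfline)) \<Longrightarrow> i \<in> I \<Longrightarrow> 0 \<le> u i"
  by (auto simp: space_PiM PiE_iff)

text \<open>Finite products of \<open>halfline\<close> are Lebesgue measure on the closed orthant,
  so orthant integrals carry no indicator functions. The interpretation makes Fubini's theorem
  available one coordinate at a time, which is how the integrations by parts are done.\<close>

interpretation halfline: product_sigma_finite "\<lambda>_. halfline"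
  by (simp add: product_sigma_finite_def sigma_finite_halfline)

lemma integrable_halfline_gauss:
  assumes "m > 0" shows "integrable halfline (\<lambda>x. exp (- m * x\<^sup>2))"
proof -
  have "integrable lborel (\<lambda>x::real. indicator {0..} x *\<^sub>R exp (- x\<^sup>2))"
    using gaussian_moment_0 has_bochner_integral_iff by blast
  then have "integrable lborel (\<lambda>x::real. indicator {0..} (0 + sqrt m * x) *\<^sub>R exp (- (0 + sqrt m * x)\<^sup>2))"
    using lborel_integrable_real_affine[where f = "\<lambda>x::real. indicator {0..} x *\<^sub>R exp (- x\<^sup>2)" and t = 0 and c = "sqrt m"] assms
    by simp
  moreover have "indicator {0..} (0 + sqrt m * x) *\<^sub>R exp (- (0 + sqrt m * x)\<^sup>2) = indicator {0..} x *\<^sub>R exp (- m * x\<^sup>2)" for x :: real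
    using assms by (auto simp: indicator_def power_mult_distrib zero_le_mult_iff)
  ultimately have "integrable lborel (\<lambda>x::real. indicator {0..} x *\<^sub>R exp (- m * x\<^sup>2))" by simp
  then show ?thesis unfolding halfline_def by (subst integrable_restrict_space) auto
qed

lemma integrable_gauss_dominated:
  fixes F :: "('i \<Rightarrow> real) \<Rightarrow> real"
  assumes "finite I" "m > 0" "F \<in> borel_measurable (PiM I (\<lambda>_. halfline))"
    and "\<And>u. u \<in> space (PiM I (\<lambda>_. halfline)) \<Longrightarrow> \<bar>F u\<bar> \<le> C * exp (- m * (\<Sum>i\<in>I. (u i)\<^sup>2))"
  shows "integrable (PiM I (\<lambda>_. halfline)) F"
proof -
  have "integrable (PiM I (\<lambda>_. halfline)) (\<lambda>u. \<Prod>i\<in>I. exp (- m * (u i)\<^sup>2))"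
    using assms(1) integrable_halfline_gauss[OF assms(2)]
    by (rule halfline.product_integrable_prod[where f = "\<lambda>_ x. exp (- m * x\<^sup>2)"])
  then have "integrable (PiM I (\<lambda>_. halfline)) (\<lambda>u. C * exp (- m * (\<Sum>i\<in>I. (u i)\<^sup>2)))"
    using assms(1) by (intro integrable_mult_right) (simp add: exp_sum sum_distrib_left)
  then show ?thesis
  proof (rule Bochner_Integration.integrable_bound)
    show "AE u in PiM I (\<lambda>_. halfline). norm (F u) \<le> norm (C * exp (- m * (\<Sum>i\<in>I. (u i)\<^sup>2)))"
      by (rule AE_I2) (use assms(4) in fastforce)
  qed fact
qed

text \<open>Half of the exponential decay pays for the linear factor, because
  \<open>m / 2 * y \<le> exp (m / 2 * y)\<close>.\<close>

lemma linear_times_exp_le: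
  fixes m y :: real
  assumes "m > 0" "y \<ge> 0"
  shows "(1 + y) * exp (- m * y) \<le> (1 + 2 / m) * exp (- (m / 2) * y)"
proof -
  have "m / 2 * y \<le> exp (m / 2 * y)"
    using exp_ge_add_one_self[of "m / 2 * y"] by linarith
  then have "y \<le> 2 / m * exp (m / 2 * y)" using assms by (simp add: field_simps)
  moreover have "1 \<le> exp (m / 2 * y)" using assms by simp
  ultimately have "1 + y \<le> exp (m / 2 * y) + 2 / m * exp (m / 2 * y)" by linarith
  then have "1 + y \<le> (1 + 2 / m) * exp (m / 2 * y)" by (simp only: distrib_right mult_1)
  then have "(1 + y) * exp (- m * y) \<le> (1 + 2 / m) * exp (m / 2 * y) * exp (- m * y)"
    by (intro mult_right_mono) auto
  also have "\<dots> = (1 + 2 / m) * exp (- (m / 2) * y)"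
    by (simp add: mult.assoc exp_add[symmetric])
  finally show ?thesis .
qed

text \<open>The bound on \<open>D\<close> gives integrability, and the bound on \<open>F\<close>
  removes the boundary term at infinity, so only the one at 0 survives.\<close>

lemma halfline_FTC:
  fixes F D :: "real \<Rightarrow> real"
  assumes "m > 0" and D_meas: "D \<in> borel_measurable halfline"
    and deriv: "\<And>y. y \<ge> 0 \<Longrightarrow> (F has_real_derivative D y) (at y)"
    and D_le: "\<And>y. y \<ge> 0 \<Longrightarrow> \<bar>D y\<bar> \<le> C * exp (- m * y\<^sup>2)"
    and F_le: "\<And>y. y \<ge> 0 \<Longrightarrow> \<bar>F y\<bar> \<le> C * exp (- m * y\<^sup>2)"
  shows "(\<integral>y. D y \<partial>halfline) = - F 0"
proof -
  have "integrable halfline D"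
  proof (rule Bochner_Integration.integrable_bound)
    show "integrable halfline (\<lambda>y. C * exp (- m * y\<^sup>2))"
      using integrable_halfline_gauss[OF \<open>m > 0\<close>] by simp
    show "AE y in halfline. norm (D y) \<le> norm (C * exp (- m * y\<^sup>2))"
      by (rule AE_I2) (use D_le in fastforce)
  qed fact
  then have int: "set_integrable lborel {0..} D"
    unfolding halfline_def set_integrable_def by (subst (asm) integrable_restrict_space) auto
  have eq: "(\<integral>y. D y \<partial>halfline) = (LINT y:{0..}|lborel. D y)"
    unfolding halfline_def set_lebesgue_integral_def by (subst integral_restrict_space) auto
  have "((\<lambda>b. LINT y:{0..b}|lborel. D y) \<longlongrightarrow> (LINT y:{0..}|lborel. D y)) at_top"
    by (rule tendsto_set_lebesgue_integral_at_top) (use int in auto)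
  moreover have "\<forall>\<^sub>F b in at_top. (LINT y:{0..b}|lborel. D y) = F b - F 0"
    using eventually_ge_at_top[of 0]
  proof eventually_elim
    case (elim b)
    have "set_integrable lborel {0..b} D" using int by (rule set_integrable_subset) auto
    then have "(LINT y:{0..b}|lborel. D y) = integral {0..b} D"
      by (rule set_borel_integral_eq_integral)
    also have "(D has_integral (F b - F 0)) {0..b}"
      by (rule fundamental_theorem_of_calculus)
        (use elim deriv in \<open>auto simp: has_real_derivative_iff_has_vector_derivative[symmetric] intro: has_field_derivative_at_within\<close>)
    then have "integral {0..b} D = F b - F 0" by (rule integral_unique)
    finally show ?case .
  qed
  ultimately have lim1: "((\<lambda>b. F b - F 0) \<longlongrightarrow> (LINT y:{0..}|lborel. D y)) at_top"
    by (rule Lim_transform_eventually)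
  have "((\<lambda>y. C * exp (- m * y\<^sup>2)) \<longlongrightarrow> 0) at_top"
  proof -
    have "filterlim (\<lambda>y::real. - m * y\<^sup>2) at_bot at_top"
      using \<open>m > 0\<close> by (intro filterlim_tendsto_neg_mult_at_bot[OF tendsto_const] filterlim_pow_at_top filterlim_ident) auto
    then have "((\<lambda>y. exp (- m * y\<^sup>2)) \<longlongrightarrow> 0) at_top" by (rule filterlim_compose[OF exp_at_bot])
    then show ?thesis by (rule tendsto_mult_right_zero)
  qed
  note gauss_lim = this
  have "\<forall>\<^sub>F y in at_top. norm (F y) \<le> C * exp (- m * y\<^sup>2)"
    using eventually_ge_at_top[of 0] by eventually_elim (use F_le in simp)
  from Lim_null_comparison[OF this gauss_lim] have "(F \<longlongrightarrow> 0) at_top" .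
  then have "((\<lambda>b. F b - F 0) \<longlongrightarrow> 0 - F 0) at_top" by (intro tendsto_intros)
  from tendsto_unique[OF _ lim1 this] show ?thesis by (simp add: eq)
qed

text \<open>Integrating out the coordinate \<open>i\<close> leaves only the face of the orthant on
  which it vanishes. Used twice, this reduces four-dimensional integrals to two-dimensional
  ones.\<close>

lemma PiM_halfline_FTC:
  fixes F D :: "('i \<Rightarrow> real) \<Rightarrow> real"
  assumes "finite I" "i \<notin> I" "m > 0"
    and D_meas: "D \<in> borel_measurable (PiM (insert i I) (\<lambda>_. halfline))"
    and deriv: "\<And>x y. x \<in> space (PiM I (\<lambda>_. halfline)) \<Longrightarrow> y \<ge> 0 \<Longrightarrow>
      ((\<lambda>y. F (x(i := y))) has_real_derivative D (x(i := y))) (at y)"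
    and D_le: "\<And>u. u \<in> space (PiM (insert i I) (\<lambda>_. halfline)) \<Longrightarrow> \<bar>D u\<bar> \<le> C * exp (- m * (\<Sum>i\<in>insert i I. (u i)\<^sup>2))"
    and F_le: "\<And>u. u \<in> space (PiM (insert i I) (\<lambda>_. halfline)) \<Longrightarrow> \<bar>F u\<bar> \<le> C * exp (- m * (\<Sum>i\<in>insert i I. (u i)\<^sup>2))"
  shows "(\<integral>u. D u \<partial>PiM (insert i I) (\<lambda>_. halfline)) = - (\<integral>x. F (x(i := 0)) \<partial>PiM I (\<lambda>_. halfline))"
proof -
  have int: "integrable (PiM (insert i I) (\<lambda>_. halfline)) D"
    using assms(1) by (intro integrable_gauss_dominated[OF _ \<open>m > 0\<close> D_meas D_le]) auto
  have "(\<integral>u. D u \<partial>PiM (insert i I) (\<lambda>_. halfline))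
      = (\<integral>x. (\<integral>y. D (x(i := y)) \<partial>halfline) \<partial>PiM I (\<lambda>_. halfline))"
    by (rule halfline.product_integral_insert[OF assms(1,2) int])
  also have "\<dots> = (\<integral>x. - F (x(i := 0)) \<partial>PiM I (\<lambda>_. halfline))"
  proof (rule Bochner_Integration.integral_cong[OF refl])
    fix x assume x: "x \<in> space (PiM I (\<lambda>_. halfline))"
    have sp: "x(i := y) \<in> space (PiM (insert i I) (\<lambda>_. halfline))" if "y \<ge> 0" for y
      using x that by (auto simp: space_PiM PiE_iff extensional_def)
    \<comment> \<open>The sign of \<open>C\<close> is implicit in the bound on \<open>D\<close>; it
      allows the other coordinates to be dropped from the exponent.\<close>
    have C0: "C \<ge> 0"
    proof -
      have "0 \<le> C * exp (- m * (\<Sum>j\<in>insert i I. ((x(i := 0)) j)\<^sup>2))"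
        using D_le[OF sp[of 0]] by linarith
      then show ?thesis by (simp add: zero_le_mult_iff)
    qed
    have le: "C * exp (- m * (\<Sum>j\<in>insert i I. ((x(i := y)) j)\<^sup>2)) \<le> C * exp (- m * y\<^sup>2)" for y
    proof -
      have "(\<Sum>j\<in>insert i I. ((x(i := y)) j)\<^sup>2) = y\<^sup>2 + (\<Sum>j\<in>I. ((x(i := y)) j)\<^sup>2)"
        using sum.insert[OF assms(1,2), of "\<lambda>j. ((x(i := y)) j)\<^sup>2"] by (simp only: fun_upd_same)
      then show ?thesis
        using \<open>m > 0\<close> C0 by (intro mult_left_mono) (simp_all add: sum_nonneg)
    qed
    show "(\<integral>y. D (x(i := y)) \<partial>halfline) = - F (x(i := 0))"
    proof (rule halfline_FTC[where m = m and C = C and F = "\<lambda>y. F (x(i := y))"])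
      show "(\<lambda>y. D (x(i := y))) \<in> borel_measurable halfline"
        by (rule measurable_compose[OF measurable_component_update[OF x assms(2)] D_meas])
      show "\<bar>D (x(i := y))\<bar> \<le> C * exp (- m * y\<^sup>2)" if "y \<ge> 0" for y
        by (rule order_trans[OF D_le[OF sp[OF that]] le])
      show "\<bar>F (x(i := y))\<bar> \<le> C * exp (- m * y\<^sup>2)" if "y \<ge> 0" for y
        by (rule order_trans[OF F_le[OF sp[OF that]] le])
    qed (use deriv[OF x] \<open>m > 0\<close> in auto)
  qed
  finally show ?thesis by simp
qed

text \<open>The mean value inequality on the convex set \<open>S\<close> bounds the difference
  quotients by \<open>h\<close>, so dominated convergence applies along every sequence tending to
  \<open>t0\<close>.\<close>

lemma has_derivative_integral_dominated:
  fixes f f' :: "real \<Rightarrow> 'a \<Rightarrow> real"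
  assumes "open S" "convex S" "t0 \<in> S"
    and int: "\<And>t. t \<in> S \<Longrightarrow> integrable M (f t)"
    and meas: "f' t0 \<in> borel_measurable M"
    and deriv: "\<And>t x. t \<in> S \<Longrightarrow> x \<in> space M \<Longrightarrow> ((\<lambda>t. f t x) has_real_derivative f' t x) (at t)"
    and le: "\<And>t x. t \<in> S \<Longrightarrow> x \<in> space M \<Longrightarrow> \<bar>f' t x\<bar> \<le> h x"
    and h: "integrable M h"
  shows "((\<lambda>t. \<integral>x. f t x \<partial>M) has_real_derivative (\<integral>x. f' t0 x \<partial>M)) (at t0)"
  unfolding has_field_derivative_iff tendsto_at_iff_sequentially
proof (intro allI impI)
  fix X :: "nat \<Rightarrow> real" assume X0: "\<forall>i. X i \<in> UNIV - {t0}" and X: "X \<longlonglongrightarrow> t0"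
  have ev: "\<forall>\<^sub>F n in sequentially. X n \<in> S"
    using X assms(1,3) by (rule topological_tendstoD)
  then obtain N where N: "\<And>n. n \<ge> N \<Longrightarrow> X n \<in> S" by (auto simp: eventually_sequentially)
  define Y where "Y n = X (n + N)" for n
  have YS: "Y n \<in> S" and Y0: "Y n \<noteq> t0" for n using N X0 by (auto simp: Y_def)
  have Y: "Y \<longlonglongrightarrow> t0" unfolding Y_def using X by (rule LIMSEQ_ignore_initial_segment)
  have "(\<lambda>n. \<integral>x. (f (Y n) x - f t0 x) / (Y n - t0) \<partial>M) \<longlonglongrightarrow> (\<integral>x. f' t0 x \<partial>M)"
  proof (rule integral_dominated_convergence[where w = h])
    show "(\<lambda>x. (f (Y n) x - f t0 x) / (Y n - t0)) \<in> borel_measurable M" for n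
      using int[OF YS[of n]] int[OF assms(3)] by (intro borel_measurable_divide borel_measurable_diff) auto
    show "AE x in M. (\<lambda>n. (f (Y n) x - f t0 x) / (Y n - t0)) \<longlonglongrightarrow> f' t0 x"
    proof (rule AE_I2)
      fix x assume "x \<in> space M"
      from deriv[OF assms(3) this]
      have "((\<lambda>t. (f t x - f t0 x) / (t - t0)) \<longlongrightarrow> f' t0 x) (at t0)"
        by (simp add: has_field_derivative_iff)
      then show "(\<lambda>n. (f (Y n) x - f t0 x) / (Y n - t0)) \<longlonglongrightarrow> f' t0 x"
        by (rule filterlim_compose) (use Y Y0 in \<open>auto simp: filterlim_at\<close>)
    qed
    show "AE x in M. norm ((f (Y n) x - f t0 x) / (Y n - t0)) \<le> h x" for n
    proof (rule AE_I2)
      fix x assume x: "x \<in> space M"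
      have "norm (f (Y n) x - f t0 x) \<le> h x * norm (Y n - t0)"
        by (rule field_differentiable_bound[OF assms(2), where f' = "\<lambda>t. f' t x"])
          (use deriv le x YS assms(3) in \<open>auto intro: has_field_derivative_at_within\<close>)
      then show "norm ((f (Y n) x - f t0 x) / (Y n - t0)) \<le> h x"
        using Y0[of n] by (simp add: field_simps)
    qed
  qed fact+
  moreover have "(\<integral>x. (f (Y n) x - f t0 x) / (Y n - t0) \<partial>M) = ((\<integral>x. f (Y n) x \<partial>M) - (\<integral>x. f t0 x \<partial>M)) / (Y n - t0)" for n
    by (subst integral_divide_zero, subst Bochner_Integration.integral_diff[OF int[OF YS[of n]] int[OF assms(3)]]) (rule refl)
  ultimately have "(\<lambda>n. ((\<integral>x. f (Y n) x \<partial>M) - (\<integral>x. f t0 x \<partial>M)) / (Y n - t0)) \<longlonglongrightarrow> (\<integral>x. f' t0 x \<partial>M)"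
    by (simp only:)
  then show "((\<lambda>t. ((\<integral>x. f t x \<partial>M) - (\<integral>x. f t0 x \<partial>M)) / (t - t0)) \<circ> X) \<longlonglongrightarrow> (\<integral>x. f' t0 x \<partial>M)"
    using LIMSEQ_offset[of "\<lambda>n. ((\<integral>x. f (X n) x \<partial>M) - (\<integral>x. f t0 x \<partial>M)) / (X n - t0)" N] by (simp only: comp_def Y_def)
qed

section \<open>The quadratic form of a packing and its Gaussian integral\<close>

definition pack_form :: "'i set \<Rightarrow> ('i \<Rightarrow> real) \<Rightarrow> ('i \<Rightarrow> real) \<Rightarrow> real" where
  "pack_form I \<kappa> u = (\<Sum>i\<in>I. \<kappa> i * u i)\<^sup>2 + (\<Sum>i\<in>I. u i)\<^sup>2 - 2 * (\<Sum>i\<in>I. (u i)\<^sup>2)"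

text \<open>The symmetric matrix of \<open>pack_form\<close> applied to \<open>u\<close>, that is,
  half the gradient of the form; see \<open>pack_form_upd_deriv\<close>.\<close>

definition pack_grad :: "'i set \<Rightarrow> ('i \<Rightarrow> real) \<Rightarrow> ('i \<Rightarrow> real) \<Rightarrow> 'i \<Rightarrow> real" where
  "pack_grad I \<kappa> u i = \<kappa> i * (\<Sum>j\<in>I. \<kappa> j * u j) + (\<Sum>j\<in>I. u j) - 2 * u i"

definition pack_integral :: "'i set \<Rightarrow> ('i \<Rightarrow> real) \<Rightarrow> real" where
  "pack_integral I \<kappa> = (\<integral>u. exp (- pack_form I \<kappa> u) \<partial>PiM I (\<lambda>_. halfline))"

lemma pack_form_measurable:
  "pack_form I \<kappa> \<in> borel_measurable (PiM I (\<lambda>_. halfline))"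
  unfolding pack_form_def[abs_def]
  by (intro borel_measurable_add borel_measurable_diff borel_measurable_power borel_measurable_times
      borel_measurable_const borel_measurable_sum halfline_coord)

lemma exp_pack_form_measurable:
  "(\<lambda>u. exp (- pack_form I \<kappa> u)) \<in> borel_measurable (PiM I (\<lambda>_. halfline))"
  by (rule measurable_compose[OF borel_measurable_uminus[OF pack_form_measurable] borel_measurable_exp])

lemma pack_grad_measurable:
  "i \<in> I \<Longrightarrow> (\<lambda>u. pack_grad I \<kappa> u i) \<in> borel_measurable (PiM I (\<lambda>_. halfline))"
  unfolding pack_grad_def[abs_def]
  by (intro borel_measurable_add borel_measurable_diff borel_measurable_times
      borel_measurable_const borel_measurable_sum halfline_coord)

lemma sum_squares_le_square_sum:
  fixes f :: "'i \<Rightarrow> real"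
  assumes "finite I" "\<And>i. i \<in> I \<Longrightarrow> 0 \<le> f i"
  shows "(\<Sum>i\<in>I. (f i)\<^sup>2) \<le> (\<Sum>i\<in>I. f i)\<^sup>2"
  using assms
proof (induction I)
  case (insert i I)
  have "0 \<le> f i * (\<Sum>i\<in>I. f i)" using insert by (intro mult_nonneg_nonneg sum_nonneg) auto
  with insert show ?case by (simp add: power2_sum)
qed simp

text \<open>For nonnegative terms the square of a sum dominates the sum of squares. Applied to
  \<open>\<kappa> i * u i\<close> and to \<open>u i\<close>, this gives the coefficients
  \<open>1 + m\<close> and 1, of which 2 is subtracted. For a tetrahedron with positive
  \<open>pack_Q\<close> the form is indefinite, having determinant -4Q; the restriction to the
  orthant is what makes the Gaussian integrable.\<close>

lemma pack_form_ge:
  assumes "finite I" "\<And>i. i \<in> I \<Longrightarrow> 0 \<le> \<kappa> i" "\<And>i. i \<in> I \<Longrightarrow> 1 + m \<le> (\<kappa> i)\<^sup>2" "\<And>i. i \<in> I \<Longrightarrow> 0 \<le> u i"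
  shows "m * (\<Sum>i\<in>I. (u i)\<^sup>2) \<le> pack_form I \<kappa> u"
proof -
  have "(\<Sum>i\<in>I. (\<kappa> i * u i)\<^sup>2) \<le> (\<Sum>i\<in>I. \<kappa> i * u i)\<^sup>2"
    by (rule sum_squares_le_square_sum) (use assms in auto)
  moreover have "(\<Sum>i\<in>I. (u i)\<^sup>2) \<le> (\<Sum>i\<in>I. u i)\<^sup>2"
    by (rule sum_squares_le_square_sum) (use assms in auto)
  moreover have "(1 + m) * (\<Sum>i\<in>I. (u i)\<^sup>2) \<le> (\<Sum>i\<in>I. (\<kappa> i * u i)\<^sup>2)"
    unfolding sum_distrib_left power_mult_distrib by (intro sum_mono mult_right_mono assms(3)) auto
  ultimately show ?thesis by (simp add: pack_form_def algebra_simps)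
qed

text \<open>All polynomial factors below have degree at most two, hence grow no faster than one plus
  the sum of squares, and cost only half of the decay rate.\<close>

lemma poly_gauss_bound:
  assumes "finite I" "m > 0" "\<And>i. i \<in> I \<Longrightarrow> 0 \<le> \<kappa> i" "\<And>i. i \<in> I \<Longrightarrow> 1 + m \<le> (\<kappa> i)\<^sup>2" "\<And>i. i \<in> I \<Longrightarrow> 0 \<le> u i"
    and p: "\<bar>p\<bar> \<le> A * (1 + (\<Sum>i\<in>I. (u i)\<^sup>2))"
  shows "\<bar>p * exp (- pack_form I \<kappa> u)\<bar> \<le> A * (1 + 2 / m) * exp (- (m / 2) * (\<Sum>i\<in>I. (u i)\<^sup>2))"
proof -
  let ?y = "\<Sum>i\<in>I. (u i)\<^sup>2"
  have y: "?y \<ge> 0" by (intro sum_nonneg) auto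
  have "0 \<le> A * (1 + ?y)" using p by linarith
  then have A: "A \<ge> 0" using y by (simp add: zero_le_mult_iff)
  have "\<bar>p * exp (- pack_form I \<kappa> u)\<bar> \<le> A * (1 + ?y) * exp (- m * ?y)"
    unfolding abs_mult using pack_form_ge[of I \<kappa> m u] assms y A by (intro mult_mono) auto
  also have "\<dots> \<le> A * ((1 + 2 / m) * exp (- (m / 2) * ?y))"
    unfolding mult.assoc using linear_times_exp_le[OF assms(2) y] A by (intro mult_left_mono) auto
  finally show ?thesis by (simp add: mult.assoc)
qed

lemma pack_grad_bound:
  assumes "finite I" "i \<in> I" "\<And>j. j \<in> I \<Longrightarrow> 0 \<le> \<kappa> j" "\<And>j. j \<in> I \<Longrightarrow> \<kappa> j \<le> K" "\<And>j. j \<in> I \<Longrightarrow> 0 \<le> u j"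
  shows "\<bar>pack_grad I \<kappa> u i\<bar> \<le> (K\<^sup>2 + 3) * (\<Sum>j\<in>I. u j)"
proof -
  have K: "0 \<le> K" using assms(2-4) order_trans by blast
  have s: "0 \<le> (\<Sum>j\<in>I. \<kappa> j * u j)" using assms by (intro sum_nonneg) auto
  have "(\<Sum>j\<in>I. \<kappa> j * u j) \<le> K * (\<Sum>j\<in>I. u j)"
    unfolding sum_distrib_left using assms by (intro sum_mono mult_right_mono) auto
  then have "\<kappa> i * (\<Sum>j\<in>I. \<kappa> j * u j) \<le> K * (K * (\<Sum>j\<in>I. u j))"
    using assms s K by (intro mult_mono) auto
  moreover have "0 \<le> \<kappa> i * (\<Sum>j\<in>I. \<kappa> j * u j)" using assms s by auto
  moreover have "u i \<le> (\<Sum>j\<in>I. u j)" using assms by (intro member_le_sum) auto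
  moreover have "0 \<le> u i" using assms by auto
  ultimately show ?thesis by (simp add: pack_grad_def power2_eq_square algebra_simps)
qed

lemma square_sum_le_card:
  fixes u :: "'i \<Rightarrow> real"
  shows "(\<Sum>j\<in>I. u j)\<^sup>2 \<le> card I * (\<Sum>j\<in>I. (u j)\<^sup>2)"
  using Cauchy_Schwarz_ineq_sum[of "\<lambda>_. 1" u I] by simp

lemma abs_mult_le_square_sum:
  fixes a b s A y :: real
  assumes "\<bar>a\<bar> \<le> A * s" "\<bar>b\<bar> \<le> A * s" "s\<^sup>2 \<le> y"
  shows "\<bar>a * b\<bar> \<le> A\<^sup>2 * y"
proof -
  have "\<bar>a * b\<bar> \<le> (A * s) * (A * s)"
    unfolding abs_mult using assms by (intro mult_mono) auto
  also have "\<dots> = A\<^sup>2 * s\<^sup>2" by (simp add: power2_eq_square)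
  also have "\<dots> \<le> A\<^sup>2 * y" using assms by (intro mult_left_mono) auto
  finally show ?thesis .
qed

lemma sum_insert_upd:
  assumes "finite I" "i \<notin> I"
  shows "(\<Sum>j\<in>insert i I. f j ((x(i := y)) j)) = f i y + (\<Sum>j\<in>I. f j (x j))"
proof -
  have "(\<Sum>j\<in>I. f j ((x(i := y)) j)) = (\<Sum>j\<in>I. f j (x j))"
    using assms by (intro sum.cong) auto
  then show ?thesis using sum.insert[OF assms, of "\<lambda>j. f j ((x(i := y)) j)"] by simp
qed

lemmas pack_upd = sum_insert_upd[where f = "\<lambda>j y. \<kappa> j * y" for \<kappa>]
  sum_insert_upd[where f = "\<lambda>j y. y"] sum_insert_upd[where f = "\<lambda>j y. y\<^sup>2"]

lemma pack_form_upd: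
  assumes "finite I" "i \<notin> I"
  shows "pack_form (insert i I) \<kappa> (x(i := y)) =
    (\<kappa> i * y + (\<Sum>j\<in>I. \<kappa> j * x j))\<^sup>2 + (y + (\<Sum>j\<in>I. x j))\<^sup>2 - 2 * (y\<^sup>2 + (\<Sum>j\<in>I. (x j)\<^sup>2))"
  unfolding pack_form_def pack_upd[OF assms] ..

lemma pack_grad_upd:
  assumes "finite I" "i \<notin> I"
  shows "pack_grad (insert i I) \<kappa> (x(i := y)) j =
    \<kappa> j * (\<kappa> i * y + (\<Sum>j\<in>I. \<kappa> j * x j)) + (y + (\<Sum>j\<in>I. x j)) - 2 * (x(i := y)) j"
  unfolding pack_grad_def pack_upd[OF assms] ..

lemma pack_form_upd_0: "finite I \<Longrightarrow> i \<notin> I \<Longrightarrow> pack_form (insert i I) \<kappa> (x(i := 0)) = pack_form I \<kappa> x"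
  by (subst pack_form_upd) (simp_all add: pack_form_def)

lemma pack_grad_upd_0: "finite I \<Longrightarrow> i \<notin> I \<Longrightarrow> j \<in> I \<Longrightarrow> pack_grad (insert i I) \<kappa> (x(i := 0)) j = pack_grad I \<kappa> x j"
  by (subst pack_grad_upd) (auto simp add: pack_grad_def)

lemma pack_form_upd_deriv:
  assumes "finite I" "i \<notin> I"
  shows "((\<lambda>y. pack_form (insert i I) \<kappa> (x(i := y))) has_real_derivative
      2 * pack_grad (insert i I) \<kappa> (x(i := y)) i) (at y)"
  unfolding pack_form_upd[OF assms] pack_grad_upd[OF assms]
  by (auto intro!: derivative_eq_intros simp: algebra_simps)

lemma pack_grad_upd_deriv:
  assumes "finite I" "i \<notin> I" "j \<noteq> i"
  shows "((\<lambda>y. pack_grad (insert i I) \<kappa> (x(i := y)) j) has_real_derivative \<kappa> i * \<kappa> j + 1) (at y)"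
  unfolding pack_grad_upd[OF assms(1,2)] using assms(3)
  by (auto intro!: derivative_eq_intros simp: algebra_simps)

lemma abs_hess_le:
  fixes a b c k X :: real
  assumes "\<bar>a * b\<bar> \<le> X" "0 \<le> c" "c \<le> k"
  shows "\<bar>4 * a * b - 2 * (c + 1)\<bar> \<le> 4 * X + 2 * (k + 1)"
proof -
  define p where "p = a * b"
  have "\<bar>p\<bar> \<le> X" using assms by (simp add: p_def)
  then have "\<bar>4 * p - 2 * (c + 1)\<bar> \<le> 4 * X + 2 * (k + 1)"
    using assms by (auto simp: abs_le_iff)
  then show ?thesis by (simp add: p_def mult.assoc)
qed

lemma affine_le_mult:
  fixes c y :: real
  assumes "0 \<le> c" "0 \<le> y"
  shows "1 + 2 * (c * y) \<le> (1 + 2 * c) * (1 + y)"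
  using assms by (simp add: algebra_simps)

lemma hess_bound_le:
  fixes c k d y :: real
  assumes "0 \<le> c" "0 \<le> k" "0 \<le> d" "0 \<le> y"
  shows "4 * (c * y) + 2 * k \<le> (4 * c + 2 * k + 2 * d) * (1 + y)"
  using assms mult_nonneg_nonneg[of k y] mult_nonneg_nonneg[of d y] by (simp add: algebra_simps)

lemma grad_bound_le:
  fixes c e n y :: real
  assumes "0 \<le> c" "0 \<le> e" "0 \<le> n" "0 \<le> y"
  shows "2 * (e * (1 + n * y)) \<le> (c + 2 * (e * (1 + n))) * (1 + y)"
  using assms mult_nonneg_nonneg[of c y] mult_nonneg_nonneg[of e y] mult_nonneg_nonneg[of e n] by (simp add: algebra_simps)

text \<open>The constants \<open>m\<close> and \<open>K\<close> are parameters instead of being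
  computed from \<open>\<kappa>\<close>, so that one pair serves a whole neighbourhood of values of
  \<open>\<kappa>\<close>, as differentiation under the integral requires, and also all faces of the
  orthant.\<close>

locale pack_bounds =
  fixes I :: "'i set" and \<kappa> :: "'i \<Rightarrow> real" and m K :: real
  assumes finite_I: "finite I" and m_pos: "m > 0"
    and kappa_nonneg: "\<And>i. i \<in> I \<Longrightarrow> 0 \<le> \<kappa> i"
    and kappa_ge: "\<And>i. i \<in> I \<Longrightarrow> 1 + m \<le> (\<kappa> i)\<^sup>2"
    and kappa_le: "\<And>i. i \<in> I \<Longrightarrow> \<kappa> i \<le> K"
begin

lemma sub_bounds: "J \<subseteq> I \<Longrightarrow> pack_bounds J \<kappa> m K"
  by unfold_locales (use finite_I m_pos kappa_nonneg kappa_ge kappa_le in \<open>auto intro: finite_subset\<close>)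

lemma poly_gauss_le:
  fixes u :: "'i \<Rightarrow> real"
  assumes "\<And>i. i \<in> I \<Longrightarrow> 0 \<le> u i" "\<bar>p\<bar> \<le> A * (1 + (\<Sum>i\<in>I. (u i)\<^sup>2))"
  shows "\<bar>p * exp (- pack_form I \<kappa> u)\<bar> \<le> A * (1 + 2 / m) * exp (- (m / 2) * (\<Sum>i\<in>I. (u i)\<^sup>2))"
  by (rule poly_gauss_bound[OF finite_I m_pos _ _ assms]) (auto intro: kappa_nonneg kappa_ge)

lemma grad_prod_le:
  fixes u :: "'i \<Rightarrow> real"
  assumes "\<And>i. i \<in> I \<Longrightarrow> 0 \<le> u i" "i \<in> I" "j \<in> I"
  shows "\<bar>pack_grad I \<kappa> u i * pack_grad I \<kappa> u j\<bar> \<le> (K\<^sup>2 + 3)\<^sup>2 * (card I * (\<Sum>j\<in>I. (u j)\<^sup>2))"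
  by (intro abs_mult_le_square_sum[where s = "\<Sum>j\<in>I. u j"] pack_grad_bound square_sum_le_card)
    (use finite_I kappa_nonneg kappa_le assms in auto)

lemma coord_grad_prod_le:
  fixes u :: "'i \<Rightarrow> real"
  assumes "\<And>i. i \<in> I \<Longrightarrow> 0 \<le> u i" "i \<in> I" "j \<in> I"
  shows "\<bar>u i * pack_grad I \<kappa> u j\<bar> \<le> (K\<^sup>2 + 3)\<^sup>2 * (card I * (\<Sum>j\<in>I. (u j)\<^sup>2))"
proof (intro abs_mult_le_square_sum[where s = "\<Sum>j\<in>I. u j"] pack_grad_bound square_sum_le_card)
  have "u i \<le> (\<Sum>j\<in>I. u j)" using finite_I assms by (intro member_le_sum) auto
  moreover have "0 \<le> u i" using assms by auto
  moreover have "1 * (\<Sum>j\<in>I. u j) \<le> (K\<^sup>2 + 3) * (\<Sum>j\<in>I. u j)"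
    using assms by (intro mult_right_mono sum_nonneg) auto
  ultimately show "\<bar>u i\<bar> \<le> (K\<^sup>2 + 3) * (\<Sum>j\<in>I. u j)" by linarith
qed (use finite_I kappa_nonneg kappa_le assms in auto)

lemma abs_le_sum_squares:
  assumes "\<bar>p\<bar> \<le> A * s" "s\<^sup>2 \<le> y" "0 \<le> A" "(0::real) \<le> s"
  shows "\<bar>p\<bar> \<le> A * (1 + y)"
proof -
  have "0 \<le> (s - 1)\<^sup>2 + s\<^sup>2 + 1" by simp
  then have "s \<le> 1 + s\<^sup>2" by (simp add: power2_diff)
  with assms(2) have "s \<le> 1 + y" by linarith
  with assms show ?thesis by (meson mult_left_mono order_trans)
qed

lemma grad_le:
  fixes u :: "'i \<Rightarrow> real"
  assumes "\<And>i. i \<in> I \<Longrightarrow> 0 \<le> u i" "i \<in> I"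
  shows "\<bar>pack_grad I \<kappa> u i\<bar> \<le> (K\<^sup>2 + 3) * (1 + card I * (\<Sum>j\<in>I. (u j)\<^sup>2))"
  by (intro abs_le_sum_squares[where s = "\<Sum>j\<in>I. u j"] pack_grad_bound square_sum_le_card sum_nonneg)
    (use finite_I kappa_nonneg kappa_le assms in auto)

lemma integrable_poly_gauss:
  assumes p: "p \<in> borel_measurable (PiM I (\<lambda>_. halfline))"
    and le: "\<And>u. (\<And>i. i \<in> I \<Longrightarrow> 0 \<le> u i) \<Longrightarrow> \<bar>p u\<bar> \<le> A * (1 + (\<Sum>i\<in>I. (u i)\<^sup>2))"
  shows "integrable (PiM I (\<lambda>_. halfline)) (\<lambda>u. p u * exp (- pack_form I \<kappa> u))"
proof (rule integrable_gauss_dominated[OF finite_I])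
  show "m / 2 > 0" using m_pos by simp
  show "(\<lambda>u. p u * exp (- pack_form I \<kappa> u)) \<in> borel_measurable (PiM I (\<lambda>_. halfline))"
    by (intro borel_measurable_times p exp_pack_form_measurable)
  show "\<bar>p u * exp (- pack_form I \<kappa> u)\<bar> \<le> A * (1 + 2 / m) * exp (- (m / 2) * (\<Sum>i\<in>I. (u i)\<^sup>2))"
    if "u \<in> space (PiM I (\<lambda>_. halfline))" for u
    by (intro poly_gauss_le le space_PiM_halflineD[OF that])
qed

text \<open>The hypothesis \<open>deriv\<close> says that
  \<open>p * exp (- pack_form I \<kappa> u)\<close> is the partial derivative of
  \<open>P * exp (- pack_form I \<kappa> u)\<close> in the coordinate \<open>i\<close>: the product
  rule subtracts \<open>2 * P\<close> times the gradient entry, which is moved to the other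
  side.\<close>

lemma FTC_poly_gauss:
  assumes I: "I = insert i J" "i \<notin> J"
    and p: "p \<in> borel_measurable (PiM I (\<lambda>_. halfline))"
    and le: "\<And>u. (\<And>i. i \<in> I \<Longrightarrow> 0 \<le> u i) \<Longrightarrow> \<bar>p u\<bar> \<le> A * (1 + (\<Sum>i\<in>I. (u i)\<^sup>2))"
    and le': "\<And>u. (\<And>i. i \<in> I \<Longrightarrow> 0 \<le> u i) \<Longrightarrow> \<bar>P u\<bar> \<le> A * (1 + (\<Sum>i\<in>I. (u i)\<^sup>2))"
    and deriv: "\<And>x y. ((\<lambda>y. P (x(i := y))) has_real_derivative
      p (x(i := y)) + 2 * P (x(i := y)) * pack_grad I \<kappa> (x(i := y)) i) (at y)"
  shows "(\<integral>u. p u * exp (- pack_form I \<kappa> u) \<partial>PiM I (\<lambda>_. halfline)) =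
    - (\<integral>x. P (x(i := 0)) * exp (- pack_form J \<kappa> x) \<partial>PiM J (\<lambda>_. halfline))"
proof -
  have fin: "finite J" using finite_I I by simp
  have "(\<integral>u. p u * exp (- pack_form I \<kappa> u) \<partial>PiM (insert i J) (\<lambda>_. halfline)) =
    - (\<integral>x. P (x(i := 0)) * exp (- pack_form I \<kappa> (x(i := 0))) \<partial>PiM J (\<lambda>_. halfline))"
  proof (rule PiM_halfline_FTC[OF fin I(2), where m = "m / 2" and C = "A * (1 + 2 / m)"
      and F = "\<lambda>u. P u * exp (- pack_form I \<kappa> u)" and D = "\<lambda>u. p u * exp (- pack_form I \<kappa> u)"])
    show "m / 2 > 0" using m_pos by simp
    show "(\<lambda>u. p u * exp (- pack_form I \<kappa> u)) \<in> borel_measurable (PiM (insert i J) (\<lambda>_. halfline))"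
      unfolding I(1)[symmetric] by (intro borel_measurable_times p exp_pack_form_measurable)
    show "\<bar>p u * exp (- pack_form I \<kappa> u)\<bar> \<le> A * (1 + 2 / m) * exp (- (m / 2) * (\<Sum>i\<in>insert i J. (u i)\<^sup>2))"
      if "u \<in> space (PiM (insert i J) (\<lambda>_. halfline))" for u
      using space_PiM_halflineD[OF that] unfolding I(1)[symmetric] by (intro poly_gauss_le le)
    show "\<bar>P u * exp (- pack_form I \<kappa> u)\<bar> \<le> A * (1 + 2 / m) * exp (- (m / 2) * (\<Sum>i\<in>insert i J. (u i)\<^sup>2))"
      if "u \<in> space (PiM (insert i J) (\<lambda>_. halfline))" for u
      using space_PiM_halflineD[OF that] unfolding I(1)[symmetric] by (intro poly_gauss_le le')
    fix x :: "'i \<Rightarrow> real" and y :: real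
    show "((\<lambda>y. P (x(i := y)) * exp (- pack_form I \<kappa> (x(i := y)))) has_real_derivative
      p (x(i := y)) * exp (- pack_form I \<kappa> (x(i := y)))) (at y)"
      using deriv[of x y] pack_form_upd_deriv[OF fin I(2), of \<kappa> x y] unfolding I(1)[symmetric]
      by (auto intro!: derivative_eq_intros simp: algebra_simps)
  qed
  then show ?thesis unfolding I by (simp only: pack_form_upd_0[OF fin I(2)])
qed

text \<open>The slack \<open>d\<close> lets one constant bound both an integrand and its primitive,
  since \<open>FTC_poly_gauss\<close> uses the same \<open>A\<close> for the two.\<close>

lemma hess_poly_le:
  fixes u :: "'i \<Rightarrow> real"
  assumes u: "\<And>i. i \<in> I \<Longrightarrow> 0 \<le> u i" and ij: "i \<in> I" "j \<in> I" and d: "0 \<le> d"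
  shows "\<bar>4 * pack_grad I \<kappa> u i * pack_grad I \<kappa> u j - 2 * (\<kappa> i * \<kappa> j + 1)\<bar>
  \<le> (4 * ((K\<^sup>2 + 3)\<^sup>2 * card I) + 2 * (K\<^sup>2 + 1) + 2 * d) * (1 + (\<Sum>i\<in>I. (u i)\<^sup>2))"
proof -
  let ?y = "\<Sum>j\<in>I. (u j)\<^sup>2"
  have y: "?y \<ge> 0" by (intro sum_nonneg) auto
  have "\<kappa> i * \<kappa> j \<le> K * K" "0 \<le> \<kappa> i * \<kappa> j"
    using kappa_le kappa_nonneg ij order_trans[OF kappa_nonneg kappa_le] by (auto intro!: mult_mono)
  moreover have "\<bar>pack_grad I \<kappa> u i * pack_grad I \<kappa> u j\<bar> \<le> (K\<^sup>2 + 3)\<^sup>2 * (card I * ?y)"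
    by (rule grad_prod_le) (use u ij in auto)
  ultimately have "\<bar>4 * pack_grad I \<kappa> u i * pack_grad I \<kappa> u j - 2 * (\<kappa> i * \<kappa> j + 1)\<bar>
      \<le> 4 * (((K\<^sup>2 + 3)\<^sup>2 * card I) * ?y) + 2 * (K\<^sup>2 + 1)"
    unfolding power2_eq_square[of K] mult.assoc[of _ "real (card I)"] by (intro abs_hess_le)
  also have "\<dots> \<le> (4 * ((K\<^sup>2 + 3)\<^sup>2 * card I) + 2 * (K\<^sup>2 + 1) + 2 * d) * (1 + ?y)"
    by (rule hess_bound_le) (use y d in auto)
  finally show ?thesis .
qed

lemma scaling_poly_le:
  fixes u :: "'i \<Rightarrow> real"
  assumes u: "\<And>i. i \<in> I \<Longrightarrow> 0 \<le> u i" and i: "i \<in> I"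
  shows "\<bar>1 - 2 * u i * pack_grad I \<kappa> u i\<bar> \<le> (1 + 2 * ((K\<^sup>2 + 3)\<^sup>2 * card I)) * (1 + (\<Sum>i\<in>I. (u i)\<^sup>2))"
proof -
  let ?y = "\<Sum>j\<in>I. (u j)\<^sup>2"
  have y: "?y \<ge> 0" by (intro sum_nonneg) auto
  have "\<bar>u i * pack_grad I \<kappa> u i\<bar> \<le> (K\<^sup>2 + 3)\<^sup>2 * (card I * ?y)"
    by (rule coord_grad_prod_le) (use u i in auto)
  then have "\<bar>1 - 2 * u i * pack_grad I \<kappa> u i\<bar> \<le> 1 + 2 * (((K\<^sup>2 + 3)\<^sup>2 * card I) * ?y)"
    unfolding mult.assoc by linarith
  also have "\<dots> \<le> (1 + 2 * ((K\<^sup>2 + 3)\<^sup>2 * card I)) * (1 + ?y)"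
    using y by (intro affine_le_mult) auto
  finally show ?thesis .
qed

lemma integrable_second_derivative:
  assumes "i \<in> I" "j \<in> I"
  shows "integrable (PiM I (\<lambda>_. halfline))
    (\<lambda>u. (4 * pack_grad I \<kappa> u i * pack_grad I \<kappa> u j - 2 * (\<kappa> i * \<kappa> j + 1)) * exp (- pack_form I \<kappa> u))"
  using hess_poly_le[OF _ assms order_refl]
  by (intro integrable_poly_gauss borel_measurable_times borel_measurable_diff borel_measurable_const pack_grad_measurable assms) blast

lemma integrable_scaling_derivative:
  assumes "i \<in> I"
  shows "integrable (PiM I (\<lambda>_. halfline)) (\<lambda>u. (1 - 2 * u i * pack_grad I \<kappa> u i) * exp (- pack_form I \<kappa> u))"
  using scaling_poly_le[OF _ assms]
  by (intro integrable_poly_gauss borel_measurable_times borel_measurable_diff borel_measurable_const pack_grad_measurable halfline_coord assms) blast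

text \<open>The integrand is the mixed second derivative of
  \<open>exp (- pack_form I \<kappa> u)\<close>. Integrating out \<open>u i\<close> and then
  \<open>u j\<close> leaves the value on the face where both vanish, and the two minus signs
  cancel.\<close>

lemma integral_second_derivative:
  assumes ij: "i \<in> I" "j \<in> I" "i \<noteq> j"
  shows "(\<integral>u. (4 * pack_grad I \<kappa> u i * pack_grad I \<kappa> u j - 2 * (\<kappa> i * \<kappa> j + 1)) * exp (- pack_form I \<kappa> u)
      \<partial>PiM I (\<lambda>_. halfline)) = pack_integral (I - {i, j}) \<kappa>"
proof -
  define J where "J = I - {i}"
  define J' where "J' = I - {i, j}"
  have I: "I = insert i J" "i \<notin> J" and J: "J = insert j J'" "j \<notin> J'" "j \<in> J" "J' \<subseteq> I" "J \<subseteq> I"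
    using ij by (auto simp: J_def J'_def)
  interpret J: pack_bounds J \<kappa> m K by (rule sub_bounds) fact
  define B where "B = 4 * ((K\<^sup>2 + 3)\<^sup>2 * card I) + 2 * (K\<^sup>2 + 1) + 2 * ((K\<^sup>2 + 3) * (1 + real (card I)))"
  have "(\<integral>u. (4 * pack_grad I \<kappa> u i * pack_grad I \<kappa> u j - 2 * (\<kappa> i * \<kappa> j + 1)) * exp (- pack_form I \<kappa> u)
      \<partial>PiM I (\<lambda>_. halfline)) = - (\<integral>x. (- 2 * pack_grad I \<kappa> (x(i := 0)) j) * exp (- pack_form J \<kappa> x) \<partial>PiM J (\<lambda>_. halfline))"
  proof (rule FTC_poly_gauss[OF I, where P = "\<lambda>u. - 2 * pack_grad I \<kappa> u j" and A = B])
    fix u :: "'i \<Rightarrow> real" assume u: "\<And>i. i \<in> I \<Longrightarrow> 0 \<le> u i"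
    let ?y = "\<Sum>j\<in>I. (u j)\<^sup>2"
    have y: "?y \<ge> 0" by (intro sum_nonneg) auto
    show "\<bar>4 * pack_grad I \<kappa> u i * pack_grad I \<kappa> u j - 2 * (\<kappa> i * \<kappa> j + 1)\<bar> \<le> B * (1 + ?y)"
      unfolding B_def by (rule hess_poly_le) (use u ij in auto)
    have "\<bar>- 2 * pack_grad I \<kappa> u j\<bar> \<le> 2 * ((K\<^sup>2 + 3) * (1 + card I * ?y))"
      using grad_le[where u = u, OF u ij(2)] by simp
    also have "\<dots> \<le> B * (1 + ?y)"
      unfolding B_def by (rule grad_bound_le) (use y in auto)
    finally show "\<bar>- 2 * pack_grad I \<kappa> u j\<bar> \<le> B * (1 + ?y)" .
  next
    fix x :: "'i \<Rightarrow> real" and y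
    show "((\<lambda>y. - 2 * pack_grad I \<kappa> (x(i := y)) j) has_real_derivative
      4 * pack_grad I \<kappa> (x(i := y)) i * pack_grad I \<kappa> (x(i := y)) j - 2 * (\<kappa> i * \<kappa> j + 1)
      + 2 * (- 2 * pack_grad I \<kappa> (x(i := y)) j) * pack_grad I \<kappa> (x(i := y)) i) (at y)"
      using DERIV_cmult[OF pack_grad_upd_deriv[OF J.finite_I I(2) ij(3)[symmetric], folded I(1), of \<kappa> x y], of "- 2"]
      by (simp add: algebra_simps)
  qed (intro borel_measurable_times borel_measurable_diff borel_measurable_const pack_grad_measurable ij)
  also have "\<dots> = - (\<integral>x. (- 2 * pack_grad J \<kappa> x j) * exp (- pack_form J \<kappa> x) \<partial>PiM J (\<lambda>_. halfline))"
    unfolding I(1) by (simp only: pack_grad_upd_0[OF J.finite_I I(2) J(3)])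
  also have "\<dots> = (\<integral>x. 1 * exp (- pack_form J' \<kappa> x) \<partial>PiM J' (\<lambda>_. halfline))"
  proof (subst J.FTC_poly_gauss[OF J(1,2), where P = "\<lambda>u. 1" and A = "1 + 2 * ((K\<^sup>2 + 3) * (1 + real (card J)))"])
    fix u :: "'i \<Rightarrow> real" assume u: "\<And>i. i \<in> J \<Longrightarrow> 0 \<le> u i"
    let ?y = "\<Sum>j\<in>J. (u j)\<^sup>2"
    have y: "?y \<ge> 0" by (intro sum_nonneg) auto
    have "\<bar>- 2 * pack_grad J \<kappa> u j\<bar> \<le> 2 * ((K\<^sup>2 + 3) * (1 + card J * ?y))"
      using J.grad_le[where u = u, OF u J(3)] by simp
    also have "\<dots> \<le> (1 + 2 * ((K\<^sup>2 + 3) * (1 + real (card J)))) * (1 + ?y)"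
      by (rule grad_bound_le) (use y in auto)
    finally show "\<bar>- 2 * pack_grad J \<kappa> u j\<bar> \<le> (1 + 2 * ((K\<^sup>2 + 3) * (1 + real (card J)))) * (1 + ?y)" .
    show "\<bar>1::real\<bar> \<le> (1 + 2 * ((K\<^sup>2 + 3) * (1 + real (card J)))) * (1 + ?y)"
      using y mult_mono[of 1 "1 + 2 * ((K\<^sup>2 + 3) * (1 + real (card J)))" 1 "1 + ?y"] by auto
  qed (use J(3) in \<open>auto intro!: derivative_eq_intros borel_measurable_times borel_measurable_const pack_grad_measurable\<close>)
  finally show ?thesis by (simp add: pack_integral_def J'_def)
qed

text \<open>The integrand is the derivative of \<open>u i * exp (- pack_form I \<kappa> u)\<close>
  in \<open>u i\<close>, and the boundary term carries the factor \<open>u i\<close>, which is 0 on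
  the face.\<close>

lemma integral_scaling_derivative:
  assumes i: "i \<in> I"
  shows "(\<integral>u. (1 - 2 * u i * pack_grad I \<kappa> u i) * exp (- pack_form I \<kappa> u) \<partial>PiM I (\<lambda>_. halfline)) = 0"
proof -
  define J where "J = I - {i}"
  have I: "I = insert i J" "i \<notin> J" using i by (auto simp: J_def)
  let ?B = "1 + 2 * ((K\<^sup>2 + 3)\<^sup>2 * card I)"
  have "(\<integral>u. (1 - 2 * u i * pack_grad I \<kappa> u i) * exp (- pack_form I \<kappa> u) \<partial>PiM I (\<lambda>_. halfline))
    = - (\<integral>x. (x(i := 0)) i * exp (- pack_form J \<kappa> x) \<partial>PiM J (\<lambda>_. halfline))"
  proof (rule FTC_poly_gauss[OF I, where P = "\<lambda>u. u i" and A = ?B])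
    fix u :: "'i \<Rightarrow> real" assume u: "\<And>i. i \<in> I \<Longrightarrow> 0 \<le> u i"
    let ?y = "\<Sum>j\<in>I. (u j)\<^sup>2"
    have y: "?y \<ge> 0" by (intro sum_nonneg) auto
    show "\<bar>1 - 2 * u i * pack_grad I \<kappa> u i\<bar> \<le> ?B * (1 + ?y)"
      by (rule scaling_poly_le) (use u i in auto)
    have "(u i)\<^sup>2 \<le> ?y" using finite_I i by (intro member_le_sum) auto
    then have "\<bar>u i\<bar> \<le> 1 * (1 + ?y)"
      using u[OF i] by (intro abs_le_sum_squares[where s = "u i"]) auto
    also have "\<dots> \<le> ?B * (1 + ?y)" using y by (intro mult_right_mono) auto
    finally show "\<bar>u i\<bar> \<le> ?B * (1 + ?y)" .
  next
    fix x :: "'i \<Rightarrow> real" and y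
    show "((\<lambda>y. (x(i := y)) i) has_real_derivative 1 - 2 * (x(i := y)) i * pack_grad I \<kappa> (x(i := y)) i
        + 2 * (x(i := y)) i * pack_grad I \<kappa> (x(i := y)) i) (at y)"
      by (simp only: fun_upd_same diff_add_cancel) (rule DERIV_ident)
  qed (intro borel_measurable_times borel_measurable_diff borel_measurable_const pack_grad_measurable halfline_coord i)
  then show ?thesis by simp
qed

lemma pack_integral_integrable: "integrable (PiM I (\<lambda>_. halfline)) (\<lambda>u. exp (- pack_form I \<kappa> u))"
proof -
  have "\<bar>1::real\<bar> \<le> 1 * (1 + (\<Sum>i\<in>I. (u i)\<^sup>2))" for u :: "'i \<Rightarrow> real"
    by (simp add: sum_nonneg)
  from integrable_poly_gauss[OF borel_measurable_const this] show ?thesis by simp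
qed

end

section \<open>Dependence of the Gaussian integral on its parameters\<close>

lemma pack_integral_has_derivative_bounded:
  fixes \<kappa> k :: "real \<Rightarrow> 'i \<Rightarrow> real"
  assumes fin: "finite I" and S: "open S" "convex S" "t0 \<in> S" and m: "m > 0"
    and deriv: "\<And>t i. t \<in> S \<Longrightarrow> i \<in> I \<Longrightarrow> ((\<lambda>t. \<kappa> t i) has_real_derivative k t i) (at t)"
    and ge0: "\<And>t i. t \<in> S \<Longrightarrow> i \<in> I \<Longrightarrow> 0 \<le> \<kappa> t i"
    and ge: "\<And>t i. t \<in> S \<Longrightarrow> i \<in> I \<Longrightarrow> 1 + m \<le> (\<kappa> t i)\<^sup>2"
    and le: "\<And>t i. t \<in> S \<Longrightarrow> i \<in> I \<Longrightarrow> \<kappa> t i \<le> K"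
    and k_le: "\<And>t i. t \<in> S \<Longrightarrow> i \<in> I \<Longrightarrow> \<bar>k t i\<bar> \<le> K"
  shows "((\<lambda>t. pack_integral I (\<kappa> t)) has_real_derivative
    (\<integral>u. (- 2 * (\<Sum>i\<in>I. \<kappa> t0 i * u i) * (\<Sum>i\<in>I. k t0 i * u i)) * exp (- pack_form I (\<kappa> t0) u) \<partial>PiM I (\<lambda>_. halfline))) (at t0)"
  unfolding pack_integral_def
proof (rule has_derivative_integral_dominated[OF S, where
      f' = "\<lambda>t u. (- 2 * (\<Sum>i\<in>I. \<kappa> t i * u i) * (\<Sum>i\<in>I. k t i * u i)) * exp (- pack_form I (\<kappa> t) u)" and
      h = "\<lambda>u. 2 * (K\<^sup>2 * card I) * (1 + 2 / m) * exp (- (m / 2) * (\<Sum>i\<in>I. (u i)\<^sup>2))"])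
  have bounds: "pack_bounds I (\<kappa> t) m K" if "t \<in> S" for t
    by unfold_locales (use that fin m ge0 ge le in auto)
  fix t assume t: "t \<in> S"
  show "integrable (PiM I (\<lambda>_. halfline)) (\<lambda>u. exp (- pack_form I (\<kappa> t) u))"
    by (rule pack_bounds.pack_integral_integrable[OF bounds[OF t]])
  fix u assume "u \<in> space (PiM I (\<lambda>_. halfline))"
  then have u: "0 \<le> u i" if "i \<in> I" for i using that by (rule space_PiM_halflineD)
  show "((\<lambda>t. exp (- pack_form I (\<kappa> t) u)) has_real_derivative
      - 2 * (\<Sum>i\<in>I. \<kappa> t i * u i) * (\<Sum>i\<in>I. k t i * u i) * exp (- pack_form I (\<kappa> t) u)) (at t)"
  proof -
    have "((\<lambda>t. \<Sum>i\<in>I. \<kappa> t i * u i) has_real_derivative (\<Sum>i\<in>I. k t i * u i)) (at t)"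
      by (intro DERIV_sum DERIV_cmult_right deriv t)
    from DERIV_power[OF this, of 2]
    have "((\<lambda>t. (\<Sum>i\<in>I. \<kappa> t i * u i)\<^sup>2) has_real_derivative 2 * (\<Sum>i\<in>I. \<kappa> t i * u i) * (\<Sum>i\<in>I. k t i * u i)) (at t)"
      by (simp add: mult_ac)
    from DERIV_diff[OF DERIV_add[OF this DERIV_const] DERIV_const]
    have "((\<lambda>t. pack_form I (\<kappa> t) u) has_real_derivative 2 * (\<Sum>i\<in>I. \<kappa> t i * u i) * (\<Sum>i\<in>I. k t i * u i)) (at t)"
      unfolding pack_form_def by simp
    from DERIV_fun_exp[OF DERIV_minus[OF this]] show ?thesis
      by (simp add: algebra_simps)
  qed
  have "\<bar>(\<Sum>i\<in>I. \<kappa> t i * u i) * (\<Sum>i\<in>I. k t i * u i)\<bar> \<le> K\<^sup>2 * (card I * (\<Sum>i\<in>I. (u i)\<^sup>2))"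
  proof (rule abs_mult_le_square_sum[where s = "\<Sum>i\<in>I. u i"])
    show "\<bar>\<Sum>i\<in>I. \<kappa> t i * u i\<bar> \<le> K * (\<Sum>i\<in>I. u i)"
      unfolding sum_distrib_left using ge0[OF t] le[OF t] u
      by (intro order_trans[OF sum_abs] sum_mono) (auto simp: abs_mult intro!: mult_right_mono)
    show "\<bar>\<Sum>i\<in>I. k t i * u i\<bar> \<le> K * (\<Sum>i\<in>I. u i)"
      unfolding sum_distrib_left using k_le[OF t] u
      by (intro order_trans[OF sum_abs] sum_mono) (auto simp: abs_mult intro!: mult_right_mono)
  qed (rule square_sum_le_card)
  then have "2 * \<bar>(\<Sum>i\<in>I. \<kappa> t i * u i) * (\<Sum>i\<in>I. k t i * u i)\<bar> \<le> 2 * (K\<^sup>2 * card I) * (1 + (\<Sum>i\<in>I. (u i)\<^sup>2))"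
    by (simp add: distrib_left mult.assoc add_increasing)
  then have "\<bar>- 2 * (\<Sum>i\<in>I. \<kappa> t i * u i) * (\<Sum>i\<in>I. k t i * u i)\<bar> \<le> 2 * (K\<^sup>2 * card I) * (1 + (\<Sum>i\<in>I. (u i)\<^sup>2))"
    by (simp add: abs_mult mult.assoc)
  then show "\<bar>(- 2 * (\<Sum>i\<in>I. \<kappa> t i * u i) * (\<Sum>i\<in>I. k t i * u i)) * exp (- pack_form I (\<kappa> t) u)\<bar>
      \<le> 2 * (K\<^sup>2 * card I) * (1 + 2 / m) * exp (- (m / 2) * (\<Sum>i\<in>I. (u i)\<^sup>2))"
    by (intro pack_bounds.poly_gauss_le[OF bounds[OF t]] u)
next
  show "(\<lambda>u. (- 2 * (\<Sum>i\<in>I. \<kappa> t0 i * u i) * (\<Sum>i\<in>I. k t0 i * u i)) * exp (- pack_form I (\<kappa> t0) u))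
      \<in> borel_measurable (PiM I (\<lambda>_. halfline))"
    by (intro borel_measurable_times borel_measurable_const borel_measurable_sum halfline_coord exp_pack_form_measurable)
  show "integrable (PiM I (\<lambda>_. halfline)) (\<lambda>u. 2 * (K\<^sup>2 * card I) * (1 + 2 / m) * exp (- (m / 2) * (\<Sum>i\<in>I. (u i)\<^sup>2)))"
  proof (rule integrable_gauss_dominated[OF fin, where C = "2 * (K\<^sup>2 * card I) * (1 + 2 / m)"])
    show "m / 2 > 0" using m by simp
    show "(\<lambda>u. 2 * (K\<^sup>2 * card I) * (1 + 2 / m) * exp (- (m / 2) * (\<Sum>i\<in>I. (u i)\<^sup>2))) \<in> borel_measurable (PiM I (\<lambda>_. halfline))"
      by (intro borel_measurable_times borel_measurable_const borel_measurable_sum borel_measurable_power halfline_coord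
          measurable_compose[OF _ borel_measurable_exp])
  qed (use m in \<open>simp add: abs_mult\<close>)
qed

text \<open>Continuity at \<open>t0\<close> turns the strict inequality
  \<open>1 < \<kappa> t0 i\<close> and the finite values there into bounds that are uniform on a
  small ball, as the preceding lemma needs.\<close>

lemma pack_integral_has_derivative:
  fixes \<kappa> k :: "real \<Rightarrow> 'i \<Rightarrow> real"
  assumes fin: "finite I"
    and deriv: "\<forall>\<^sub>F t in nhds t0. \<forall>i\<in>I. ((\<lambda>t. \<kappa> t i) has_real_derivative k t i) (at t)"
    and cont: "\<And>i. i \<in> I \<Longrightarrow> isCont (\<lambda>t. k t i) t0"
    and gt: "\<And>i. i \<in> I \<Longrightarrow> 1 < \<kappa> t0 i"
  shows "((\<lambda>t. pack_integral I (\<kappa> t)) has_real_derivative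
    (\<integral>u. (- 2 * (\<Sum>i\<in>I. \<kappa> t0 i * u i) * (\<Sum>i\<in>I. k t0 i * u i)) * exp (- pack_form I (\<kappa> t0) u) \<partial>PiM I (\<lambda>_. halfline))) (at t0)"
proof -
  \<comment> \<open>Half of the gap at \<open>t0\<close>, so that the strict inequality
    \<open>1 + m < (\<kappa> t i)\<^sup>2\<close> survives nearby. The inserted 1 keeps the minimum
    defined for empty \<open>I\<close>.\<close>
  define m where "m = Min (insert 1 ((\<lambda>i. ((\<kappa> t0 i)\<^sup>2 - 1) / 2) ` I))"
  define K where "K = Max (insert 1 ((\<lambda>i. max (\<kappa> t0 i) \<bar>k t0 i\<bar> + 1) ` I))"
  have sq: "1 < (\<kappa> t0 i)\<^sup>2" if "i \<in> I" for i
    using gt[OF that] by (rule one_less_power) simp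
  have m: "m > 0" unfolding m_def using fin sq by (subst Min_gr_iff) auto
  have ml: "1 + m < (\<kappa> t0 i)\<^sup>2" if "i \<in> I" for i
  proof -
    have "m \<le> ((\<kappa> t0 i)\<^sup>2 - 1) / 2" unfolding m_def using fin that by (intro Min_le) auto
    then show ?thesis using sq[OF that] by (simp add: field_simps)
  qed
  have Kl: "\<kappa> t0 i < K" "\<bar>k t0 i\<bar> < K" if "i \<in> I" for i
  proof -
    have "max (\<kappa> t0 i) \<bar>k t0 i\<bar> + 1 \<le> K" unfolding K_def using fin that by (intro Max_ge) auto
    then show "\<kappa> t0 i < K" "\<bar>k t0 i\<bar> < K" by linarith+
  qed
  have cont_kappa: "((\<lambda>t. \<kappa> t i) \<longlongrightarrow> \<kappa> t0 i) (nhds t0)" if "i \<in> I" for i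
  proof -
    have "((\<lambda>t. \<kappa> t i) has_real_derivative k t0 i) (at t0)"
      using eventually_nhds_x_imp_x[OF deriv] that by blast
    from DERIV_isCont[OF this] show ?thesis by (simp add: continuous_at tendsto_nhds_iff)
  qed
  have cont_k: "((\<lambda>t. k t i) \<longlongrightarrow> k t0 i) (nhds t0)" if "i \<in> I" for i
    using cont[OF that] by (simp add: continuous_at tendsto_nhds_iff)
  have "\<forall>\<^sub>F t in nhds t0. \<forall>i\<in>I. 1 < \<kappa> t i \<and> 1 + m < (\<kappa> t i)\<^sup>2 \<and> \<kappa> t i < K \<and> \<bar>k t i\<bar> < K"
  proof (rule eventually_ball_finite[OF fin], rule ballI)
    fix i assume i: "i \<in> I"
    show "\<forall>\<^sub>F t in nhds t0. 1 < \<kappa> t i \<and> 1 + m < (\<kappa> t i)\<^sup>2 \<and> \<kappa> t i < K \<and> \<bar>k t i\<bar> < K"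
      by (intro eventually_conj order_tendstoD(1)[OF cont_kappa[OF i] gt[OF i]]
          order_tendstoD(1)[OF tendsto_power[OF cont_kappa[OF i]] ml[OF i]]
          order_tendstoD(2)[OF cont_kappa[OF i] Kl(1)[OF i]]
          order_tendstoD(2)[OF tendsto_rabs[OF cont_k[OF i]] Kl(2)[OF i]])
  qed
  from eventually_conj[OF deriv this] obtain e where e: "e > 0"
    and S: "\<And>t. dist t t0 < e \<Longrightarrow> (\<forall>i\<in>I. ((\<lambda>t. \<kappa> t i) has_real_derivative k t i) (at t)) \<and>
      (\<forall>i\<in>I. 1 < \<kappa> t i \<and> 1 + m < (\<kappa> t i)\<^sup>2 \<and> \<kappa> t i < K \<and> \<bar>k t i\<bar> < K)"
    unfolding eventually_nhds_metric by blast
  show ?thesis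
    by (rule pack_integral_has_derivative_bounded[where S = "ball t0 e" and m = m and K = K, OF fin open_ball convex_ball _ m])
      (use e S in \<open>force simp: dist_commute\<close>)+
qed

lemma halfline_gauss_scale:
  assumes "m > 0"
  shows "(\<integral>x. exp (- m * x\<^sup>2) \<partial>halfline) = (\<integral>x. exp (- x\<^sup>2) \<partial>halfline) / sqrt m"
proof -
  have "(\<integral>x. exp (- x\<^sup>2) \<partial>halfline) = (\<integral>x. indicator {0..} x *\<^sub>R exp (- x\<^sup>2) \<partial>lborel)"
    unfolding halfline_def by (subst integral_restrict_space) auto
  also have "\<dots> = \<bar>sqrt m\<bar> *\<^sub>R (\<integral>x. indicator {0..} (0 + sqrt m * x) *\<^sub>R exp (- (0 + sqrt m * x)\<^sup>2) \<partial>lborel)"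
    using lborel_integral_real_affine[of "sqrt m" "\<lambda>x::real. indicator {0..} x *\<^sub>R exp (- x\<^sup>2)" 0] assms by simp
  also have "(\<lambda>x. indicator {0..} (0 + sqrt m * x) *\<^sub>R exp (- (0 + sqrt m * x)\<^sup>2)) = (\<lambda>x. indicator {0..} x *\<^sub>R exp (- m * x\<^sup>2))"
    using assms by (auto simp: indicator_def power_mult_distrib zero_le_mult_iff fun_eq_iff)
  also have "(\<integral>x. indicator {0..} x *\<^sub>R exp (- m * x\<^sup>2) \<partial>lborel) = (\<integral>x. exp (- m * x\<^sup>2) \<partial>halfline)"
    unfolding halfline_def by (subst integral_restrict_space) auto
  finally show ?thesis using assms by simp
qed

text \<open>The lower bound \<open>pack_form_ge\<close> compares the integrand with a product of
  one-dimensional Gaussians. What matters later is large \<open>m\<close>: in four variables the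
  integral is of order \<open>1 / m\<^sup>2\<close>.\<close>

lemma (in pack_bounds) pack_integral_le:
  "pack_integral I \<kappa> \<le> ((\<integral>x. exp (- x\<^sup>2) \<partial>halfline) / sqrt m) ^ card I"
proof -
  have int: "integrable (PiM I (\<lambda>_. halfline)) (\<lambda>u. \<Prod>i\<in>I. exp (- m * (u i)\<^sup>2))"
    using finite_I integrable_halfline_gauss[OF m_pos]
    by (rule halfline.product_integrable_prod[where f = "\<lambda>_ x. exp (- m * x\<^sup>2)"])
  have "pack_integral I \<kappa> \<le> (\<integral>u. (\<Prod>i\<in>I. exp (- m * (u i)\<^sup>2)) \<partial>PiM I (\<lambda>_. halfline))"
    unfolding pack_integral_def
  proof (rule integral_mono[OF pack_integral_integrable int])
    fix u assume u: "u \<in> space (PiM I (\<lambda>_. halfline))"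
    have "m * (\<Sum>i\<in>I. (u i)\<^sup>2) \<le> pack_form I \<kappa> u"
      by (rule pack_form_ge) (use finite_I kappa_nonneg kappa_ge space_PiM_halflineD[OF u] in auto)
    then show "exp (- pack_form I \<kappa> u) \<le> (\<Prod>i\<in>I. exp (- m * (u i)\<^sup>2))"
      using finite_I by (simp flip: exp_sum add: sum_negf sum_distrib_left)
  qed
  also have "\<dots> = (\<Prod>i\<in>I. \<integral>x. exp (- m * x\<^sup>2) \<partial>halfline)"
    using finite_I integrable_halfline_gauss[OF m_pos]
    by (rule halfline.product_integral_prod[where f = "\<lambda>_ x. exp (- m * x\<^sup>2)"])
  also have "\<dots> = ((\<integral>x. exp (- x\<^sup>2) \<partial>halfline) / sqrt m) ^ card I"
    by (simp only: halfline_gauss_scale[OF m_pos] prod_constant)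
  finally show ?thesis .
qed

lemma pack_integral_nonneg: "0 \<le> pack_integral I \<kappa>"
  unfolding pack_integral_def by (rule Bochner_Integration.integral_nonneg) simp

section \<open>Gaussian integrals over two-dimensional faces\<close>

lemma nn_integral_halfline:
  "f \<in> borel_measurable borel \<Longrightarrow> (\<integral>\<^sup>+x. f x \<partial>halfline) = (\<integral>\<^sup>+x. f x * indicator {0..} x \<partial>lborel)"
  unfolding halfline_def by (rule nn_integral_restrict_space) auto

lemma nn_integral_x_gauss:
  assumes "A > (0::real)"
  shows "(\<integral>\<^sup>+x. ennreal (x * exp (- A * x\<^sup>2)) * indicator {0..} x \<partial>lborel) = ennreal (1 / (2 * A))"
proof -
  have "filterlim (\<lambda>x::real. - A * x\<^sup>2) at_bot at_top"
    using assms by (intro filterlim_tendsto_neg_mult_at_bot[OF tendsto_const] filterlim_pow_at_top filterlim_ident) auto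
  from filterlim_compose[OF exp_at_bot this]
  have "((\<lambda>x. - exp (- A * x\<^sup>2) / (2 * A)) \<longlongrightarrow> - 0 / (2 * A)) at_top"
    by (intro tendsto_intros) (use assms in auto)
  then have lim: "((\<lambda>x. - exp (- A * x\<^sup>2) / (2 * A)) \<longlongrightarrow> 0) at_top" by simp
  have "(\<integral>\<^sup>+x. ennreal (x * exp (- A * x\<^sup>2)) * indicator {0..} x \<partial>lborel) = ennreal (0 - (- exp (- A * 0\<^sup>2) / (2 * A)))"
  proof (rule nn_integral_FTC_atLeast[OF _ _ _ lim])
    show "((\<lambda>x. - exp (- A * x\<^sup>2) / (2 * A)) has_real_derivative x * exp (- A * x\<^sup>2)) (at x)" for x
      using assms by (auto intro!: derivative_eq_intros)
  qed auto
  then show ?thesis by simp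
qed

text \<open>Partial fractions: \<open>a\<close> times the quadratic factors as
  \<open>(a * m + c - d) * (a * m + c + d)\<close>, and \<open>d < c\<close> keeps both factors
  positive for nonnegative \<open>m\<close>. The primitive \<open>F\<close> is normalised to vanish
  at infinity.\<close>

lemma nn_integral_inverse_quadratic:
  fixes a b c d :: real
  assumes "a > 0" "b > 0" "d > 0" "d < c" "d\<^sup>2 = c\<^sup>2 - a * b"
  shows "(\<integral>\<^sup>+m. ennreal (1 / (2 * (a * m\<^sup>2 + 2 * c * m + b))) * indicator {0..} m \<partial>lborel)
    = ennreal (ln ((c + d) / (c - d)) / (4 * d))"
proof -
  define F where "F m = (ln (a * m + c - d) - ln (a * m + c + d)) / (4 * d)" for m
  have pos: "a * m + c - d > 0" "a * m + c + d > 0" if "m \<ge> 0" for m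
  proof -
    have "0 \<le> a * m" using that assms by simp
    then show "a * m + c - d > 0" "a * m + c + d > 0" using assms by linarith+
  qed
  have fact: "(a * m + c - d) * (a * m + c + d) = a * (a * m\<^sup>2 + 2 * c * m + b)" for m
    using assms(5) by (simp add: power2_eq_square algebra_simps)
  have "((\<lambda>m. ln ((a * m + c - d) / (a * m + c + d)) / (4 * d)) \<longlongrightarrow> ln 1 / (4 * d)) at_top"
  proof (intro tendsto_intros)
    have "filterlim (\<lambda>m. (c + d) + a * m) at_top at_top"
      by (intro filterlim_tendsto_add_at_top[OF tendsto_const] filterlim_tendsto_pos_mult_at_top[OF tendsto_const assms(1)] filterlim_ident)
    then have "((\<lambda>m. 1 - 2 * d * inverse ((c + d) + a * m)) \<longlongrightarrow> 1 - 2 * d * 0) at_top"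
      by (intro tendsto_intros tendsto_inverse_0_at_top)
    moreover have "\<forall>\<^sub>F m in at_top. 1 - 2 * d * inverse ((c + d) + a * m) = (a * m + c - d) / (a * m + c + d)"
      using eventually_ge_at_top[of 0]
    proof eventually_elim
      case (elim m)
      show ?case using pos[OF elim] by (simp add: field_simps)
    qed
    ultimately show "((\<lambda>m. (a * m + c - d) / (a * m + c + d)) \<longlongrightarrow> 1) at_top"
      by (simp add: tendsto_cong)
  qed (use assms in auto)
  moreover have "\<forall>\<^sub>F m in at_top. ln ((a * m + c - d) / (a * m + c + d)) / (4 * d) = F m"
    using eventually_ge_at_top[of 0]
  proof eventually_elim
    case (elim m)
    show ?case using pos[OF elim] by (simp add: F_def ln_div)
  qed
  ultimately have lim: "(F \<longlongrightarrow> 0) at_top"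
    using Lim_transform_eventually by fastforce
  have "(\<integral>\<^sup>+m. ennreal (1 / (2 * (a * m\<^sup>2 + 2 * c * m + b))) * indicator {0..} m \<partial>lborel) = ennreal (0 - F 0)"
  proof (rule nn_integral_FTC_atLeast[OF _ _ _ lim])
    fix m :: real assume m: "0 \<le> m"
    note p = pos[OF m]
    have "(F has_real_derivative (a / (a * m + c - d) - a / (a * m + c + d)) / (4 * d)) (at m)"
      unfolding F_def
    proof (intro DERIV_cdivide DERIV_diff)
      show "((\<lambda>m. ln (a * m + c - d)) has_real_derivative a / (a * m + c - d)) (at m)"
        "((\<lambda>m. ln (a * m + c + d)) has_real_derivative a / (a * m + c + d)) (at m)"
        using p by (auto intro!: derivative_eq_intros)
    qed
    also have "(a / (a * m + c - d) - a / (a * m + c + d)) / (4 * d) = a / (2 * ((a * m + c - d) * (a * m + c + d)))"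
    proof -
      have aux: "(a / P - a / Q) / (4 * d) = a / (2 * (P * Q))" if "P > 0" "Q > 0" "Q - P = 2 * d" for P Q
      proof -
        have "a / P - a / Q = a * (Q - P) / (P * Q)"
          unfolding right_diff_distrib using that(1,2) by (simp add: diff_frac_eq)
        then show ?thesis using assms(3) that(3) by simp
      qed
      show ?thesis by (rule aux) (use p in simp_all)
    qed
    also have "\<dots> = 1 / (2 * (a * m\<^sup>2 + 2 * c * m + b))"
      unfolding fact using assms(1) by simp
    finally show "(F has_real_derivative 1 / (2 * (a * m\<^sup>2 + 2 * c * m + b))) (at m)" .
    show "0 \<le> 1 / (2 * (a * m\<^sup>2 + 2 * c * m + b))"
      using assms m by (auto intro!: divide_nonneg_nonneg add_nonneg_nonneg)
  qed auto
  also have "0 - F 0 = ln ((c + d) / (c - d)) / (4 * d)"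
    using assms by (simp add: F_def ln_div diff_divide_distrib)
  finally show ?thesis .
qed

text \<open>Replacing \<open>y\<close> by the slope \<open>m\<close> with \<open>y = x * m\<close>
  separates the variables: after Fubini the integral over \<open>x\<close> is elementary and leaves
  the inverse of a quadratic in \<open>m\<close>.\<close>

lemma nn_integral_quadrant_gauss:
  fixes a b c d :: real
  assumes "a > 0" "b > 0" "d > 0" "d < c" "d\<^sup>2 = c\<^sup>2 - a * b"
  shows "(\<integral>\<^sup>+x. (\<integral>\<^sup>+y. ennreal (exp (- (a * y\<^sup>2 + 2 * c * x * y + b * x\<^sup>2))) \<partial>halfline) \<partial>halfline)
    = ennreal (ln ((c + d) / (c - d)) / (4 * d))"
proof -
  have q: "a * m\<^sup>2 + 2 * c * m + b > 0" if "m \<ge> 0" for m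
    using assms that by (auto intro!: add_nonneg_pos add_nonneg_nonneg)
  have "(\<integral>\<^sup>+x. (\<integral>\<^sup>+y. ennreal (exp (- (a * y\<^sup>2 + 2 * c * x * y + b * x\<^sup>2))) \<partial>halfline) \<partial>halfline)
    = (\<integral>\<^sup>+x. (\<integral>\<^sup>+y. ennreal (exp (- (a * y\<^sup>2 + 2 * c * x * y + b * x\<^sup>2))) * indicator {0..} y \<partial>lborel) * indicator {0..} x \<partial>lborel)"
    by (subst nn_integral_halfline) (simp_all add: nn_integral_halfline)
  also have "\<dots> = (\<integral>\<^sup>+x. (\<integral>\<^sup>+m. ennreal (x * exp (- (a * m\<^sup>2 + 2 * c * m + b) * x\<^sup>2)) * indicator {0..} m * indicator {0..} x \<partial>lborel) \<partial>lborel)"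
  \<comment> \<open>The substitution \<open>y = x * m\<close> degenerates at \<open>x = 0\<close>, a
    null set.\<close>
  proof (rule nn_integral_cong_AE, rule AE_mp[OF AE_lborel_singleton[of 0]], rule AE_I2, rule impI)
    fix x :: real assume x0: "x \<noteq> 0"
    show "(\<integral>\<^sup>+y. ennreal (exp (- (a * y\<^sup>2 + 2 * c * x * y + b * x\<^sup>2))) * indicator {0..} y \<partial>lborel) * indicator {0..} x
      = (\<integral>\<^sup>+m. ennreal (x * exp (- (a * m\<^sup>2 + 2 * c * m + b) * x\<^sup>2)) * indicator {0..} m * indicator {0..} x \<partial>lborel)"
    proof (cases "x > 0")
      case True
      have "(\<integral>\<^sup>+y. ennreal (exp (- (a * y\<^sup>2 + 2 * c * x * y + b * x\<^sup>2))) * indicator {0..} y \<partial>lborel)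
        = ennreal \<bar>x\<bar> * (\<integral>\<^sup>+m. ennreal (exp (- (a * (0 + x * m)\<^sup>2 + 2 * c * x * (0 + x * m) + b * x\<^sup>2))) * indicator {0..} (0 + x * m) \<partial>lborel)"
        using x0 by (intro nn_integral_real_affine) auto
      also have "\<dots> = (\<integral>\<^sup>+m. ennreal x * (ennreal (exp (- (a * (0 + x * m)\<^sup>2 + 2 * c * x * (0 + x * m) + b * x\<^sup>2))) * indicator {0..} (0 + x * m)) \<partial>lborel)"
        using True by (subst nn_integral_cmult) auto
      also have "\<dots> = (\<integral>\<^sup>+m. ennreal (x * exp (- (a * m\<^sup>2 + 2 * c * m + b) * x\<^sup>2)) * indicator {0..} m * indicator {0..} x \<partial>lborel)"
        using True by (intro nn_integral_cong)
          (auto simp: indicator_def zero_le_mult_iff ennreal_mult[symmetric] power2_eq_square algebra_simps)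
      finally show ?thesis using True by simp
    qed (use x0 in simp)
  qed
  also have "\<dots> = (\<integral>\<^sup>+m. (\<integral>\<^sup>+x. ennreal (x * exp (- (a * m\<^sup>2 + 2 * c * m + b) * x\<^sup>2)) * indicator {0..} m * indicator {0..} x \<partial>lborel) \<partial>lborel)"
    by (rule lborel_pair.Fubini') simp
  also have "\<dots> = (\<integral>\<^sup>+m. ennreal (1 / (2 * (a * m\<^sup>2 + 2 * c * m + b))) * indicator {0..} m \<partial>lborel)"
  proof (rule nn_integral_cong)
    fix m :: real
    show "(\<integral>\<^sup>+x. ennreal (x * exp (- (a * m\<^sup>2 + 2 * c * m + b) * x\<^sup>2)) * indicator {0..} m * indicator {0..} x \<partial>lborel)
      = ennreal (1 / (2 * (a * m\<^sup>2 + 2 * c * m + b))) * indicator {0..} m"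
      by (cases "m \<ge> 0") (simp_all add: nn_integral_x_gauss[OF q, simplified])
  qed
  also have "\<dots> = ennreal (ln ((c + d) / (c - d)) / (4 * d))"
    by (rule nn_integral_inverse_quadratic) fact+
  finally show ?thesis .
qed

text \<open>For two variables the discriminant is the perfect square
  \<open>(\<kappa> k + \<kappa> l)\<^sup>2\<close>, and sum and difference factor. With
  \<open>\<kappa>\<close> the hyperbolic cotangent of the radius, the logarithm is twice the length
  of the edge from \<open>k\<close> to \<open>l\<close>.\<close>

lemma pack_integral_pair:
  assumes "k \<noteq> l" "\<kappa> k > 1" "\<kappa> l > 1"
  shows "pack_integral {k, l} \<kappa> =
    ln (((\<kappa> k + 1) * (\<kappa> l + 1)) / ((\<kappa> k - 1) * (\<kappa> l - 1))) / (4 * (\<kappa> k + \<kappa> l))"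
proof -
  define m where "m = min ((\<kappa> k)\<^sup>2 - 1) ((\<kappa> l)\<^sup>2 - 1)"
  have sq: "1 < (\<kappa> k)\<^sup>2" "1 < (\<kappa> l)\<^sup>2"
    using assms by (simp_all add: one_less_power)
  interpret pack_bounds "{k, l}" \<kappa> m "max (\<kappa> k) (\<kappa> l)"
    by unfold_locales (use assms sq in \<open>auto simp: m_def\<close>)
  let ?a = "(\<kappa> k)\<^sup>2 - 1" and ?b = "(\<kappa> l)\<^sup>2 - 1" and ?c = "\<kappa> k * \<kappa> l + 1" and ?d = "\<kappa> k + \<kappa> l"
  let ?R = "ln ((?c + ?d) / (?c - ?d)) / (4 * ?d)"
  have fact: "?c + ?d = (\<kappa> k + 1) * (\<kappa> l + 1)" "?c - ?d = (\<kappa> k - 1) * (\<kappa> l - 1)"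
    by (simp_all add: algebra_simps)
  have form: "pack_form {k, l} \<kappa> (x(k := y)) = ?a * y\<^sup>2 + 2 * ?c * x l * y + ?b * (x l)\<^sup>2" for x y
    using pack_form_upd[of "{l}" k \<kappa> x y] assms(1) by (simp add: power2_eq_square algebra_simps)
  have "ennreal (pack_integral {k, l} \<kappa>) = (\<integral>\<^sup>+u. ennreal (exp (- pack_form {k, l} \<kappa> u)) \<partial>PiM {k, l} (\<lambda>_. halfline))"
    unfolding pack_integral_def by (rule nn_integral_eq_integral[symmetric, OF pack_integral_integrable]) simp
  also have "\<dots> = (\<integral>\<^sup>+x. (\<integral>\<^sup>+y. ennreal (exp (- pack_form {k, l} \<kappa> (x(k := y)))) \<partial>halfline) \<partial>PiM {l} (\<lambda>_. halfline))"
    using assms(1) measurable_compose[OF exp_pack_form_measurable measurable_ennreal]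
    by (intro halfline.product_nn_integral_insert) auto
  also have "\<dots> = (\<integral>\<^sup>+x. (\<integral>\<^sup>+y. ennreal (exp (- (?a * y\<^sup>2 + 2 * ?c * x l * y + ?b * (x l)\<^sup>2))) \<partial>halfline) \<partial>PiM {l} (\<lambda>_. halfline))"
    by (simp only: form)
  also have "\<dots> = (\<integral>\<^sup>+x. (\<integral>\<^sup>+y. ennreal (exp (- (?a * y\<^sup>2 + 2 * ?c * x * y + ?b * x\<^sup>2))) \<partial>halfline) \<partial>halfline)"
  proof (rule halfline.product_nn_integral_singleton[where f = "\<lambda>z. \<integral>\<^sup>+y. ennreal (exp (- (?a * y\<^sup>2 + 2 * ?c * z * y + ?b * z\<^sup>2))) \<partial>halfline"])
    have "(\<lambda>z. \<integral>\<^sup>+y. ennreal (exp (- (?a * y\<^sup>2 + 2 * ?c * z * y + ?b * z\<^sup>2))) * indicator {0..} y \<partial>lborel) \<in> borel_measurable borel"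
      by measurable
    then show "(\<lambda>z. \<integral>\<^sup>+y. ennreal (exp (- (?a * y\<^sup>2 + 2 * ?c * z * y + ?b * z\<^sup>2))) \<partial>halfline) \<in> borel_measurable halfline"
      unfolding halfline_def by (subst nn_integral_restrict_space) (auto intro: measurable_restrict_space1)
  qed
  also have "\<dots> = ennreal ?R"
  proof (rule nn_integral_quadrant_gauss)
    have "0 < (\<kappa> k - 1) * (\<kappa> l - 1)" using assms by simp
    then show "?d < ?c" unfolding fact(2)[symmetric] by linarith
  qed (use assms sq in \<open>auto simp: power2_eq_square algebra_simps\<close>)
  finally have "ennreal (pack_integral {k, l} \<kappa>) = ennreal ?R" .
  moreover have "0 \<le> ?R"
  proof -
    have "0 < ?c - ?d" unfolding fact(2) using assms by simp
    then have "1 \<le> (?c + ?d) / (?c - ?d)" using assms by (simp add: le_divide_eq)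
    then show ?thesis using assms by simp
  qed
  ultimately have "pack_integral {k, l} \<kappa> = ?R"
    using pack_integral_nonneg[of "{k, l}" \<kappa>] by (metis ennreal_inj)
  then show ?thesis unfolding fact .
qed

section \<open>Derivative of the Gaussian volume\<close>

definition pack_Q :: "'i set \<Rightarrow> ('i \<Rightarrow> real) \<Rightarrow> real" where
  "pack_Q \<sigma> \<kappa> = (\<Sum>i\<in>\<sigma>. \<kappa> i)\<^sup>2 - 2 * (\<Sum>i\<in>\<sigma>. (\<kappa> i)\<^sup>2) + 4"

definition pack_w :: "'i set \<Rightarrow> ('i \<Rightarrow> real) \<Rightarrow> 'i \<Rightarrow> real" where
  "pack_w \<sigma> \<kappa> i = (\<Sum>j\<in>\<sigma>. \<kappa> j) / 2 - \<kappa> i"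

text \<open>Equal to Q/4 times the squared secant of \<open>pack_angle\<close>, so that it converts
  angle velocities into velocities of the tangents, up to a common factor. By
  \<open>pack_P_eq\<close> it is one plus the sum of the products of pairs among the three other
  parameters.\<close>

definition pack_P :: "'i set \<Rightarrow> ('i \<Rightarrow> real) \<Rightarrow> 'i \<Rightarrow> real" where
  "pack_P \<sigma> \<kappa> i = pack_Q \<sigma> \<kappa> / 4 + (pack_w \<sigma> \<kappa> i)\<^sup>2"

definition arcoth :: "real \<Rightarrow> real" where
  "arcoth x = ln ((x + 1) / (x - 1)) / 2"

definition pack_vol :: "'i set \<Rightarrow> ('i \<Rightarrow> real) \<Rightarrow> real" where
  "pack_vol \<sigma> \<kappa> = 4 * sqrt (pack_Q \<sigma> \<kappa>) * pack_integral \<sigma> \<kappa>"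

lemma card_4_obtain:
  assumes "card \<sigma> = 4"
  obtains a b c d where "\<sigma> = {a, b, c, d}" "distinct [a, b, c, d]"
proof -
  have "finite \<sigma>" using assms by (metis card.infinite zero_neq_numeral)
  then obtain xs where xs: "set xs = \<sigma>" "distinct xs" using finite_distinct_list by blast
  then have "length xs = 4" using assms distinct_card by fastforce
  then obtain a b c d where "xs = [a, b, c, d]"
    by (auto simp: numeral_eq_Suc length_Suc_conv)
  with xs that[of a b c d] show ?thesis by auto
qed

lemma sum_distinct4: "distinct [a, b, c, d] \<Longrightarrow> sum f {a, b, c, d} = f a + f b + f c + (f d :: real)"
  by (simp add: add.assoc)

lemma Diff_distinct4:
  assumes "distinct [a, b, c, d]"
  shows "{a, b, c, d} - {a, b} = {c, d}" "{a, b, c, d} - {a, c} = {b, d}" "{a, b, c, d} - {a, d} = {b, c}"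
    "{a, b, c, d} - {b, c} = {a, d}" "{a, b, c, d} - {b, d} = {a, c}" "{a, b, c, d} - {c, d} = {a, b}"
    "{a, b, c, d} - {a} = {b, c, d}" "{a, b, c, d} - {b} = {a, c, d}" "{a, b, c, d} - {c} = {a, b, d}" "{a, b, c, d} - {d} = {a, b, c}"
  using assms by auto

text \<open>The part of Plackett's identity that is quadratic in the gradient. Splitting
  \<open>Q / 4 + w\<^sup>2\<close>, the first summand is handled by \<open>Qt\<close> and the second
  is absorbed by the term \<open>w * t\<close> in \<open>u\<close>. The pure squares of the
  \<open>g\<close> come exactly from the products \<open>u * g\<close>, so the remaining terms are
  mixed.\<close>

lemma pair_sum_quadratic_identity:
  fixes w1 w2 w3 w4 g1 g2 g3 g4 p1 p2 p3 p4 Q t :: real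
  assumes Qt: "Q * t = w1 * g1 + w2 * g2 + w3 * g3 + w4 * g4"
    and u: "u1 = (g1 + g2 + g3 + g4) / 4 - g1 / 2 - w1 * t" "u2 = (g1 + g2 + g3 + g4) / 4 - g2 / 2 - w2 * t"
      "u3 = (g1 + g2 + g3 + g4) / 4 - g3 / 2 - w3 * t" "u4 = (g1 + g2 + g3 + g4) / 4 - g4 / 2 - w4 * t"
  shows "- (4 * t * ((Q / 4 + w1\<^sup>2) * p1 * g1 + (Q / 4 + w2\<^sup>2) * p2 * g2 + (Q / 4 + w3\<^sup>2) * p3 * g3 + (Q / 4 + w4\<^sup>2) * p4 * g4)) =
    - ((w1 + w2) * (p1 + p2) * (g1 * g2) + (w1 + w3) * (p1 + p3) * (g1 * g3) + (w1 + w4) * (p1 + p4) * (g1 * g4)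
      + (w2 + w3) * (p2 + p3) * (g2 * g3) + (w2 + w4) * (p2 + p4) * (g2 * g4) + (w3 + w4) * (p3 + p4) * (g3 * g4))
    + 4 * (w1 * p1 * (u1 * g1) + w2 * p2 * (u2 * g2) + w3 * p3 * (u3 * g3) + w4 * p4 * (u4 * g4))"
proof -
  have "4 * t * ((Q / 4 + w1\<^sup>2) * p1 * g1 + (Q / 4 + w2\<^sup>2) * p2 * g2 + (Q / 4 + w3\<^sup>2) * p3 * g3 + (Q / 4 + w4\<^sup>2) * p4 * g4)
    = (Q * t) * (p1 * g1 + p2 * g2 + p3 * g3 + p4 * g4)
      + 4 * t * (w1\<^sup>2 * p1 * g1 + w2\<^sup>2 * p2 * g2 + w3\<^sup>2 * p3 * g3 + w4\<^sup>2 * p4 * g4)"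
    by (simp add: field_simps)
  then show ?thesis unfolding Qt u by (simp add: power2_eq_square field_simps)
qed

text \<open>The part of Plackett's identity without the gradient; \<open>s - k\<close> plays the
  role of \<open>pack_w\<close> and \<open>q\<close> that of Q/4.\<close>

lemma pair_sum_constant_identity:
  fixes k1 k2 k3 k4 p1 p2 p3 p4 :: real
  defines "s \<equiv> (k1 + k2 + k3 + k4) / 2"
  defines "q \<equiv> ((k1 + k2 + k3 + k4)\<^sup>2 - 2 * (k1\<^sup>2 + k2\<^sup>2 + k3\<^sup>2 + k4\<^sup>2) + 4) / 4"
  shows "k1 * ((q + (s - k1)\<^sup>2) * p1) + k2 * ((q + (s - k2)\<^sup>2) * p2) + k3 * ((q + (s - k3)\<^sup>2) * p3) + k4 * ((q + (s - k4)\<^sup>2) * p4) =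
    (((s - k1) + (s - k2)) * (p1 + p2) * (k1 * k2 + 1) + ((s - k1) + (s - k3)) * (p1 + p3) * (k1 * k3 + 1)
     + ((s - k1) + (s - k4)) * (p1 + p4) * (k1 * k4 + 1) + ((s - k2) + (s - k3)) * (p2 + p3) * (k2 * k3 + 1)
     + ((s - k2) + (s - k4)) * (p2 + p4) * (k2 * k4 + 1) + ((s - k3) + (s - k4)) * (p3 + p4) * (k3 * k4 + 1)) / 2
    - 2 * ((s - k1) * p1 + (s - k2) * p2 + (s - k3) * p3 + (s - k4) * p4)"
  unfolding s_def q_def by (simp add: power2_eq_square field_simps)

text \<open>With G the symmetric matrix of the form, this is the relation G w = (Q/2) k. It shows
  why \<open>pack_w\<close> is the natural vector: it solves the linear system with right-hand side
  proportional to \<open>\<kappa>\<close>.\<close>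

lemma pack_w_grad:
  assumes "card \<sigma> = 4"
  shows "(\<Sum>i\<in>\<sigma>. pack_w \<sigma> \<kappa> i * pack_grad \<sigma> \<kappa> u i) = pack_Q \<sigma> \<kappa> * (\<Sum>i\<in>\<sigma>. \<kappa> i * u i) / 2"
proof -
  obtain a b c d where [simp]: "\<sigma> = {a, b, c, d}" and d: "distinct [a, b, c, d]" using card_4_obtain[OF assms] .
  show ?thesis
    by (simp only: pack_w_def pack_grad_def pack_Q_def \<open>\<sigma> = _\<close> sum_distinct4[OF d])
      (simp add: power2_eq_square field_simps)
qed

text \<open>The inverse of the matrix of the form, apart from the scalar product of
  \<open>\<kappa>\<close> and \<open>u\<close>, which \<open>pack_w_grad\<close> supplies. That
  there are four entries matters: the sum of the gradient then contains twice the sum of the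
  \<open>u\<close>, and a quarter of it cancels the summand in half of one entry.\<close>

lemma pack_grad_inverse:
  assumes "card \<sigma> = 4"
  shows "u i = (\<Sum>j\<in>\<sigma>. pack_grad \<sigma> \<kappa> u j) / 4 - pack_grad \<sigma> \<kappa> u i / 2 - pack_w \<sigma> \<kappa> i * ((\<Sum>j\<in>\<sigma>. \<kappa> j * u j) / 2)"
proof -
  have "(\<Sum>j\<in>\<sigma>. pack_grad \<sigma> \<kappa> u j) = (\<Sum>j\<in>\<sigma>. \<kappa> j) * (\<Sum>j\<in>\<sigma>. \<kappa> j * u j) + 2 * (\<Sum>j\<in>\<sigma>. u j)"
  proof -
    have "(\<Sum>j\<in>\<sigma>. \<kappa> j * L + s - 2 * u j) = (\<Sum>j\<in>\<sigma>. \<kappa> j) * L + 4 * s - 2 * (\<Sum>j\<in>\<sigma>. u j)" for L s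
      using assms by (simp add: sum.distrib sum_subtractf sum_distrib_right sum_distrib_left)
    then show ?thesis by (simp add: pack_grad_def)
  qed
  then show ?thesis by (simp add: pack_grad_def pack_w_def field_simps)
qed

lemma pack_grad_symmetric:
  "(\<Sum>i\<in>\<sigma>. pack_grad \<sigma> \<kappa> z i * u i) = (\<Sum>i\<in>\<sigma>. z i * pack_grad \<sigma> \<kappa> u i)"
proof -
  have "(\<Sum>i\<in>\<sigma>. pack_grad \<sigma> \<kappa> z i * u i) = (\<Sum>i\<in>\<sigma>. \<kappa> i * u i) * (\<Sum>i\<in>\<sigma>. \<kappa> i * z i) + (\<Sum>i\<in>\<sigma>. u i) * (\<Sum>i\<in>\<sigma>. z i) - 2 * (\<Sum>i\<in>\<sigma>. z i * u i)"
    for z u :: "'a \<Rightarrow> real"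
  proof -
    have "(\<Sum>i\<in>\<sigma>. (\<kappa> i * L + s - 2 * z i) * u i) = (\<Sum>i\<in>\<sigma>. \<kappa> i * u i) * L + (\<Sum>i\<in>\<sigma>. u i) * s - 2 * (\<Sum>i\<in>\<sigma>. z i * u i)" for L s
      by (simp add: sum.distrib sum_subtractf sum_distrib_right sum_distrib_left algebra_simps)
    then show ?thesis by (simp add: pack_grad_def)
  qed
  from this[of z u] this[of u z] show ?thesis by (simp add: mult_ac)
qed

text \<open>
  Plackett's identity for the density \<open>sqrt Q * exp (- q)\<close>: with \<open>Q * t = w \<bullet> g\<close> and
  \<open>z = P \<psi>\<close>, its derivative in the direction \<open>G z / sqrt Q\<close>, where \<open>G\<close> is the matrix of \<open>q\<close>, is a combination of mixed second
  derivatives and of the divergences \<open>\<partial>\<^sub>i (u\<^sub>i exp (- q))\<close>; no pure second derivatives remain.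
\<close>

lemma plackett_identity:
  fixes \<kappa> u \<psi> :: "'i \<Rightarrow> real"
  assumes \<sigma>: "\<sigma> = {a, b, c, d}" and dist: "distinct [a, b, c, d]"
  defines "w \<equiv> pack_w \<sigma> \<kappa>" and "g \<equiv> pack_grad \<sigma> \<kappa> u"
    and "z \<equiv> \<lambda>i. pack_P \<sigma> \<kappa> i * \<psi> i"
  defines "D \<equiv> \<lambda>i j. (w i + w j) * (\<psi> i + \<psi> j) * (4 * g i * g j - 2 * (\<kappa> i * \<kappa> j + 1))"
  shows "(\<Sum>i\<in>\<sigma>. \<kappa> i * z i) - 2 * (\<Sum>i\<in>\<sigma>. \<kappa> i * u i) * (\<Sum>i\<in>\<sigma>. z i * g i)
    = - (D a b + D a c + D a d + D b c + D b d + D c d) / 4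
      - 2 * (w a * \<psi> a * (1 - 2 * u a * g a) + w b * \<psi> b * (1 - 2 * u b * g b)
        + w c * \<psi> c * (1 - 2 * u c * g c) + w d * \<psi> d * (1 - 2 * u d * g d))"
proof -
  have card: "card \<sigma> = 4" using dist by (simp add: \<sigma>)
  define t where "t = (\<Sum>i\<in>\<sigma>. \<kappa> i * u i) / 2"
  have Qt: "pack_Q \<sigma> \<kappa> * t = w a * g a + w b * g b + w c * g c + w d * g d"
    using pack_w_grad[OF card, of \<kappa> u] unfolding t_def w_def g_def \<sigma> sum_distinct4[OF dist] by simp
  have u: "u i = (g a + g b + g c + g d) / 4 - g i / 2 - w i * t" for i
    using pack_grad_inverse[OF card, of u i \<kappa>] unfolding t_def w_def g_def \<sigma> sum_distinct4[OF dist] by simp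
  have z: "z i = (pack_Q \<sigma> \<kappa> / 4 + (w i)\<^sup>2) * \<psi> i" for i by (simp add: z_def pack_P_def w_def)
  have quad: "- (4 * t * (\<Sum>i\<in>\<sigma>. z i * g i)) =
    - ((w a + w b) * (\<psi> a + \<psi> b) * (g a * g b) + (w a + w c) * (\<psi> a + \<psi> c) * (g a * g c) + (w a + w d) * (\<psi> a + \<psi> d) * (g a * g d)
      + (w b + w c) * (\<psi> b + \<psi> c) * (g b * g c) + (w b + w d) * (\<psi> b + \<psi> d) * (g b * g d) + (w c + w d) * (\<psi> c + \<psi> d) * (g c * g d))
    + 4 * (w a * \<psi> a * (u a * g a) + w b * \<psi> b * (u b * g b) + w c * \<psi> c * (u c * g c) + w d * \<psi> d * (u d * g d))"
    using pair_sum_quadratic_identity[OF Qt u[of a] u[of b] u[of c] u[of d], of "\<psi> a" "\<psi> b" "\<psi> c" "\<psi> d"]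
    unfolding z \<sigma> sum_distinct4[OF dist] by simp
  have const: "(\<Sum>i\<in>\<sigma>. \<kappa> i * z i) =
    ((w a + w b) * (\<psi> a + \<psi> b) * (\<kappa> a * \<kappa> b + 1) + (w a + w c) * (\<psi> a + \<psi> c) * (\<kappa> a * \<kappa> c + 1)
     + (w a + w d) * (\<psi> a + \<psi> d) * (\<kappa> a * \<kappa> d + 1) + (w b + w c) * (\<psi> b + \<psi> c) * (\<kappa> b * \<kappa> c + 1)
     + (w b + w d) * (\<psi> b + \<psi> d) * (\<kappa> b * \<kappa> d + 1) + (w c + w d) * (\<psi> c + \<psi> d) * (\<kappa> c * \<kappa> d + 1)) / 2
    - 2 * (w a * \<psi> a + w b * \<psi> b + w c * \<psi> c + w d * \<psi> d)"
    unfolding z w_def pack_w_def pack_Q_def \<sigma> sum_distinct4[OF dist]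
    by (rule pair_sum_constant_identity)
  define A B where "A = (\<Sum>i\<in>\<sigma>. \<kappa> i * z i)" and "B = - (4 * t * (\<Sum>i\<in>\<sigma>. z i * g i))"
  have "A + B = - (D a b + D a c + D a d + D b c + D b d + D c d) / 4
      - 2 * (w a * \<psi> a * (1 - 2 * u a * g a) + w b * \<psi> b * (1 - 2 * u b * g b)
        + w c * \<psi> c * (1 - 2 * u c * g c) + w d * \<psi> d * (1 - 2 * u d * g d))"
    unfolding A_def const B_def quad D_def by (simp add: field_simps)
  then show ?thesis unfolding A_def B_def t_def by simp
qed

lemma pack_w_k:
  assumes "card \<sigma> = 4"
  shows "(\<Sum>i\<in>\<sigma>. pack_w \<sigma> \<kappa> i * (pack_grad \<sigma> \<kappa> z i / s)) = pack_Q \<sigma> \<kappa> * (\<Sum>i\<in>\<sigma>. \<kappa> i * z i) / 2 / s"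
  unfolding times_divide_eq_right sum_divide_distrib[symmetric] pack_w_grad[OF assms] ..

lemma ln_arcoth:
  assumes "x > 1" "y > 1"
  shows "ln (((x + 1) * (y + 1)) / ((x - 1) * (y - 1))) = 2 * arcoth x + 2 * arcoth y"
  using assms by (simp add: arcoth_def ln_div ln_mult) (simp only: diff_divide_distrib nonzero_mult_div_cancel_left[of 2] zero_neq_numeral not_False_eq_True; simp)

text \<open>Schlaefli's formula: \<open>\<psi>\<close> is the velocity of the angles,
  \<open>2 * (\<Sum>j\<in>\<sigma> - {i}. \<psi> j)\<close> that of the solid angle at
  \<open>i\<close>, and \<open>arcoth\<close> recovers the radius. Plackett's identity turns the
  derivative into face integrals and vanishing divergences, and the face integrals are edge lengths
  up to factors that cancel.\<close>

lemma pack_vol_has_derivative: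
  fixes \<kappa> k :: "real \<Rightarrow> 'i \<Rightarrow> real" and \<psi> :: "'i \<Rightarrow> real"
  assumes card: "card \<sigma> = 4"
    and deriv: "\<forall>\<^sub>F t in nhds t0. \<forall>i\<in>\<sigma>. ((\<lambda>t. \<kappa> t i) has_real_derivative k t i) (at t)"
    and cont: "\<And>i. i \<in> \<sigma> \<Longrightarrow> isCont (\<lambda>t. k t i) t0"
    and gt: "\<And>i. i \<in> \<sigma> \<Longrightarrow> 1 < \<kappa> t0 i"
    and Q: "pack_Q \<sigma> (\<kappa> t0) > 0"
    and k: "\<And>i. i \<in> \<sigma> \<Longrightarrow> k t0 i = pack_grad \<sigma> (\<kappa> t0) (\<lambda>i. pack_P \<sigma> (\<kappa> t0) i * \<psi> i) i / sqrt (pack_Q \<sigma> (\<kappa> t0))"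
  shows "((\<lambda>t. 2 * pack_vol \<sigma> (\<kappa> t)) has_real_derivative - (\<Sum>i\<in>\<sigma>. arcoth (\<kappa> t0 i) * (2 * (\<Sum>j\<in>\<sigma> - {i}. \<psi> j)))) (at t0)"
proof -
  obtain a b c d where \<sigma>: "\<sigma> = {a, b, c, d}" and dist: "distinct [a, b, c, d]" using card_4_obtain[OF card] .
  have fin: "finite \<sigma>" by (simp add: \<sigma>)
  let ?M = "PiM \<sigma> (\<lambda>_. halfline)"
  define K where "K = \<kappa> t0"
  define q where "q = pack_Q \<sigma> K"
  define w where "w = pack_w \<sigma> K"
  define z where "z i = pack_P \<sigma> K i * \<psi> i" for i
  define G where "G u = exp (- pack_form \<sigma> K u)" for u
  define J where "J = pack_integral \<sigma> K"
  define L where "L u = (\<Sum>i\<in>\<sigma>. K i * u i)" for u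
  define N where "N u = (\<Sum>i\<in>\<sigma>. k t0 i * u i)" for u
  have q: "q > 0" using Q by (simp add: q_def K_def)
  define J' where "J' = (\<integral>u. (- 2 * L u * N u) * G u \<partial>?M)"
  have dJ: "((\<lambda>t. pack_integral \<sigma> (\<kappa> t)) has_real_derivative J') (at t0)"
    unfolding J'_def L_def N_def G_def K_def by (rule pack_integral_has_derivative[OF fin deriv cont gt])
  have d\<kappa>: "((\<lambda>t. \<kappa> t i) has_real_derivative k t0 i) (at t0)" if "i \<in> \<sigma>" for i
    using eventually_nhds_x_imp_x[OF deriv] that by blast
  have dQ: "((\<lambda>t. pack_Q \<sigma> (\<kappa> t)) has_real_derivative 4 * (\<Sum>i\<in>\<sigma>. w i * k t0 i)) (at t0)"
  proof -
    have "((\<lambda>t. (\<Sum>i\<in>\<sigma>. \<kappa> t i)\<^sup>2) has_real_derivative 2 * (\<Sum>i\<in>\<sigma>. K i) * (\<Sum>i\<in>\<sigma>. k t0 i)) (at t0)"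
      using DERIV_power[OF DERIV_sum[OF d\<kappa>], where n = 2] by (simp add: K_def mult_ac)
    moreover have "((\<lambda>t. \<Sum>i\<in>\<sigma>. (\<kappa> t i)\<^sup>2) has_real_derivative (\<Sum>i\<in>\<sigma>. 2 * K i * k t0 i)) (at t0)"
      by (rule DERIV_sum) (use DERIV_power[OF d\<kappa>, where n = 2] in \<open>simp add: K_def mult_ac\<close>)
    ultimately have "((\<lambda>t. pack_Q \<sigma> (\<kappa> t)) has_real_derivative
      2 * (\<Sum>i\<in>\<sigma>. K i) * (\<Sum>i\<in>\<sigma>. k t0 i) - 2 * (\<Sum>i\<in>\<sigma>. 2 * K i * k t0 i) + 0) (at t0)"
      unfolding pack_Q_def by (intro DERIV_add DERIV_diff DERIV_cmult DERIV_const)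
    moreover have "4 * (\<Sum>i\<in>\<sigma>. (s / 2 - K i) * k t0 i) = 2 * s * (\<Sum>i\<in>\<sigma>. k t0 i) - 2 * (\<Sum>i\<in>\<sigma>. 2 * K i * k t0 i)" for s
      by (simp add: algebra_simps sum_subtractf sum_distrib_left)
    ultimately show ?thesis by (simp add: w_def pack_w_def)
  qed
  \<comment> \<open>The relation G w = (Q/2) k of \<open>pack_w_grad\<close>, applied to the
    velocity G z / sqrt Q.\<close>
  have wk: "(\<Sum>i\<in>\<sigma>. w i * k t0 i) = sqrt q * (\<Sum>i\<in>\<sigma>. K i * z i) / 2"
  proof -
    have "(\<Sum>i\<in>\<sigma>. w i * k t0 i) = (\<Sum>i\<in>\<sigma>. pack_w \<sigma> K i * (pack_grad \<sigma> K z i / sqrt q))"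
      by (intro sum.cong) (simp_all add: k w_def K_def q_def z_def[abs_def])
    also have "\<dots> = q * (\<Sum>i\<in>\<sigma>. K i * z i) / 2 / sqrt q"
      unfolding q_def by (rule pack_w_k[OF card])
    also have "\<dots> = (q / sqrt q) * (\<Sum>i\<in>\<sigma>. K i * z i) / 2" by simp
    also have "q / sqrt q = sqrt q" using q by (simp add: real_div_sqrt)
    finally show ?thesis .
  qed
  have Nu: "N u = (\<Sum>i\<in>\<sigma>. z i * pack_grad \<sigma> K u i) / sqrt q" for u
  proof -
    have "N u = (\<Sum>i\<in>\<sigma>. pack_grad \<sigma> K z i * u i / sqrt q)"
      unfolding N_def by (intro sum.cong) (simp_all add: k K_def q_def z_def[abs_def])
    then show ?thesis by (simp only: sum_divide_distrib[symmetric] pack_grad_symmetric)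
  qed
  have dsqrt: "((\<lambda>t. sqrt (pack_Q \<sigma> (\<kappa> t))) has_real_derivative (\<Sum>i\<in>\<sigma>. K i * z i)) (at t0)"
  proof -
    have "((\<lambda>t. sqrt (pack_Q \<sigma> (\<kappa> t))) has_real_derivative (4 * (\<Sum>i\<in>\<sigma>. w i * k t0 i)) * (inverse (sqrt q) / 2)) (at t0)"
      using DERIV_chain'[OF dQ DERIV_real_sqrt[OF Q]] by (simp add: q_def K_def mult_ac)
    then show ?thesis using q by (simp add: wk field_simps)
  qed
  have "((\<lambda>t. sqrt (pack_Q \<sigma> (\<kappa> t)) * pack_integral \<sigma> (\<kappa> t)) has_real_derivative (\<Sum>i\<in>\<sigma>. K i * z i) * J + J' * sqrt q) (at t0)"
    using DERIV_mult[OF dsqrt dJ] by (simp add: J_def q_def K_def)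
  moreover
  define m where "m = Min ((\<lambda>i. (K i)\<^sup>2 - 1) ` \<sigma>)"
  have sq: "1 < (K i)\<^sup>2" if "i \<in> \<sigma>" for i
    using gt[OF that] unfolding K_def by (rule one_less_power) simp
  have "m > 0" unfolding m_def using fin sq \<sigma> by (subst Min_gr_iff) auto
  have mle: "1 + m \<le> (K i)\<^sup>2" if "i \<in> \<sigma>" for i
  proof -
    have "m \<le> (K i)\<^sup>2 - 1" unfolding m_def using fin that by (intro Min_le) auto
    then show ?thesis by simp
  qed
  interpret pack_bounds \<sigma> K m "Max (K ` \<sigma>)"
    by unfold_locales (use fin \<open>m > 0\<close> mle gt K_def in \<open>auto simp: less_imp_le dest: gt\<close>)
  define D where "D i j u = (4 * pack_grad \<sigma> K u i * pack_grad \<sigma> K u j - 2 * (K i * K j + 1)) * G u" for i j u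
  define E where "E i u = (1 - 2 * u i * pack_grad \<sigma> K u i) * G u" for i u
  define C where "C i j = (w i + w j) * (\<psi> i + \<psi> j)" for i j
  have iD: "integrable ?M (D i j)" if "i \<in> \<sigma>" "j \<in> \<sigma>" for i j
    using integrable_second_derivative[OF that] unfolding D_def[abs_def] G_def .
  have iE: "integrable ?M (E i)" if "i \<in> \<sigma>" for i
    using integrable_scaling_derivative[OF that] unfolding E_def[abs_def] G_def .
  have E0: "(\<integral>u. E i u \<partial>?M) = 0" if "i \<in> \<sigma>" for i
    using integral_scaling_derivative[OF that] unfolding E_def G_def .
  have D1: "(\<integral>u. D i j u \<partial>?M) = pack_integral (\<sigma> - {i, j}) K" if "i \<in> \<sigma>" "j \<in> \<sigma>" "i \<noteq> j" for i j
    using integral_second_derivative[OF that] unfolding D_def G_def .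
  have iG: "integrable ?M G" unfolding G_def[abs_def] by (rule pack_integral_integrable)
  have pw: "(\<Sum>i\<in>\<sigma>. K i * z i) * G u + (- 2 * L u * N u) * G u * sqrt q =
     - (C a b * D a b u + C a c * D a c u + C a d * D a d u + C b c * D b c u + C b d * D b d u + C c d * D c d u) / 4
     - 2 * (w a * \<psi> a * E a u + w b * \<psi> b * E b u + w c * \<psi> c * E c u + w d * \<psi> d * E d u)" for u
  proof -
    have "(\<Sum>i\<in>\<sigma>. K i * z i) * G u + (- 2 * L u * N u) * G u * sqrt q
      = ((\<Sum>i\<in>\<sigma>. K i * z i) - 2 * L u * (\<Sum>i\<in>\<sigma>. z i * pack_grad \<sigma> K u i)) * G u"
      using q by (simp add: Nu algebra_simps)
    also have "\<dots> = (- (C a b * (4 * pack_grad \<sigma> K u a * pack_grad \<sigma> K u b - 2 * (K a * K b + 1)) + C a c * (4 * pack_grad \<sigma> K u a * pack_grad \<sigma> K u c - 2 * (K a * K c + 1)) + C a d * (4 * pack_grad \<sigma> K u a * pack_grad \<sigma> K u d - 2 * (K a * K d + 1)) + C b c * (4 * pack_grad \<sigma> K u b * pack_grad \<sigma> K u c - 2 * (K b * K c + 1)) + C b d * (4 * pack_grad \<sigma> K u b * pack_grad \<sigma> K u d - 2 * (K b * K d + 1)) + C c d * (4 * pack_grad \<sigma> K u c * pack_grad \<sigma> K u d - 2 * (K c * K d + 1))) / 4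
       - 2 * (w a * \<psi> a * (1 - 2 * u a * pack_grad \<sigma> K u a) + w b * \<psi> b * (1 - 2 * u b * pack_grad \<sigma> K u b) + w c * \<psi> c * (1 - 2 * u c * pack_grad \<sigma> K u c) + w d * \<psi> d * (1 - 2 * u d * pack_grad \<sigma> K u d))) * G u"
      unfolding C_def w_def L_def z_def using plackett_identity[OF \<sigma> dist, of K \<psi> u] by (simp only:)
    also have "\<dots> = - (C a b * D a b u + C a c * D a c u + C a d * D a d u + C b c * D b c u + C b d * D b d u + C c d * D c d u) / 4
     - 2 * (w a * \<psi> a * E a u + w b * \<psi> b * E b u + w c * \<psi> c * E c u + w d * \<psi> d * E d u)"
      unfolding D_def E_def by (simp only: left_diff_distrib distrib_right minus_divide_left[symmetric] times_divide_eq_left mult_minus_left mult.assoc)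
    finally show ?thesis .
  qed
  have mem: "a \<in> \<sigma>" "b \<in> \<sigma>" "c \<in> \<sigma>" "d \<in> \<sigma>" by (simp_all add: \<sigma>)
  have ne: "a \<noteq> b" "a \<noteq> c" "a \<noteq> d" "b \<noteq> c" "b \<noteq> d" "c \<noteq> d" using dist by auto
  \<comment> \<open>Integrability is read off from the identity \<open>pw\<close>, since all its
    other terms are known to be integrable.\<close>
  have "integrable ?M (\<lambda>u. (- 2 * L u * N u) * G u * sqrt q)"
  proof -
    have "integrable ?M (\<lambda>u. (- (C a b * D a b u + C a c * D a c u + C a d * D a d u + C b c * D b c u + C b d * D b d u + C c d * D c d u) / 4
     - 2 * (w a * \<psi> a * E a u + w b * \<psi> b * E b u + w c * \<psi> c * E c u + w d * \<psi> d * E d u)) - (\<Sum>i\<in>\<sigma>. K i * z i) * G u)"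
      using mem by (intro Bochner_Integration.integrable_diff Bochner_Integration.integrable_add integrable_mult_right integrable_divide integrable_minus iD iE iG)
    then show ?thesis by (simp only: pw[symmetric] add_diff_cancel_left')
  qed
  note iLN = this
  have "(\<Sum>i\<in>\<sigma>. K i * z i) * J + J' * sqrt q = (\<integral>u. (\<Sum>i\<in>\<sigma>. K i * z i) * G u + (- 2 * L u * N u) * G u * sqrt q \<partial>?M)"
  proof -
    have "J = (\<integral>u. G u \<partial>?M)" by (simp add: J_def pack_integral_def G_def)
    then show ?thesis
      using iG by (subst Bochner_Integration.integral_add[OF _ iLN]) (simp_all add: J'_def)
  qed
  also have "\<dots> = - (C a b * pack_integral {c, d} K + C a c * pack_integral {b, d} K + C a d * pack_integral {b, c} K
      + C b c * pack_integral {a, d} K + C b d * pack_integral {a, c} K + C c d * pack_integral {a, b} K) / 4"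
  proof -
    have hD: "has_bochner_integral ?M (D i j) (pack_integral (\<sigma> - {i, j}) K)" if "i \<in> \<sigma>" "j \<in> \<sigma>" "i \<noteq> j" for i j
      using iD D1 that by (simp add: has_bochner_integral_iff)
    have hE: "has_bochner_integral ?M (E i) 0" if "i \<in> \<sigma>" for i
      using iE E0 that by (simp add: has_bochner_integral_iff)
    have "has_bochner_integral ?M (\<lambda>u. (- (C a b * D a b u + C a c * D a c u + C a d * D a d u + C b c * D b c u + C b d * D b d u + C c d * D c d u)) / 4
     - 2 * (w a * \<psi> a * E a u + w b * \<psi> b * E b u + w c * \<psi> c * E c u + w d * \<psi> d * E d u))
     ((- (C a b * pack_integral (\<sigma> - {a, b}) K + C a c * pack_integral (\<sigma> - {a, c}) K + C a d * pack_integral (\<sigma> - {a, d}) K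
       + C b c * pack_integral (\<sigma> - {b, c}) K + C b d * pack_integral (\<sigma> - {b, d}) K + C c d * pack_integral (\<sigma> - {c, d}) K)) / 4
       - 2 * (w a * \<psi> a * 0 + w b * \<psi> b * 0 + w c * \<psi> c * 0 + w d * \<psi> d * 0))"
      using mem ne by (intro has_bochner_integral_diff has_bochner_integral_add has_bochner_integral_mult_right
          has_bochner_integral_divide has_bochner_integral_minus hD hE)
    from has_bochner_integral_integral_eq[OF this] show ?thesis
      unfolding pw by (simp add: \<sigma> Diff_distinct4[OF dist])
  qed
  also have "\<dots> = - (\<Sum>i\<in>\<sigma>. arcoth (K i) * (2 * (\<Sum>j\<in>\<sigma> - {i}. \<psi> j))) / 8"
  proof -
    \<comment> \<open>For opposite edges the factor \<open>w i + w j\<close> equals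
      \<open>K k + K l\<close> and cancels the denominator in
      \<open>pack_integral_pair\<close>.\<close>
    have CI: "C i j * pack_integral {k, l} K = (\<psi> i + \<psi> j) * (arcoth (K k) + arcoth (K l)) / 2"
      if "w i + w j = K k + K l" "k \<in> \<sigma>" "l \<in> \<sigma>" "k \<noteq> l" for i j k l
    proof -
      have 1: "K k > 1" "K l > 1" using gt that by (auto simp: K_def)
      show ?thesis unfolding C_def that(1) pack_integral_pair[OF that(4) 1] ln_arcoth[OF 1] using 1 by (simp add: field_simps)
    qed
    have ww: "w a + w b = K c + K d" "w a + w c = K b + K d" "w a + w d = K b + K c"
      "w b + w c = K a + K d" "w b + w d = K a + K c" "w c + w d = K a + K b"
      unfolding w_def pack_w_def \<sigma> sum_distinct4[OF dist] by (simp_all add: field_simps)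
    have S: "(\<Sum>i\<in>\<sigma>. arcoth (K i) * (2 * (\<Sum>j\<in>\<sigma> - {i}. \<psi> j))) =
       arcoth (K a) * (2 * (\<psi> b + \<psi> c + \<psi> d)) + arcoth (K b) * (2 * (\<psi> a + \<psi> c + \<psi> d))
       + arcoth (K c) * (2 * (\<psi> a + \<psi> b + \<psi> d)) + arcoth (K d) * (2 * (\<psi> a + \<psi> b + \<psi> c))"
      unfolding \<sigma> sum_distinct4[OF dist] Diff_distinct4[OF dist] using dist by (simp add: algebra_simps)
    show ?thesis unfolding S
      by (simp add: CI[OF ww(1)] CI[OF ww(2)] CI[OF ww(3)] CI[OF ww(4)] CI[OF ww(5)] CI[OF ww(6)] mem ne) (simp add: field_simps)
  qed
  ultimately have "((\<lambda>t. sqrt (pack_Q \<sigma> (\<kappa> t)) * pack_integral \<sigma> (\<kappa> t)) has_real_derivative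
      - (\<Sum>i\<in>\<sigma>. arcoth (K i) * (2 * (\<Sum>j\<in>\<sigma> - {i}. \<psi> j))) / 8) (at t0)" by simp
  \<comment> \<open>The factor 8 is the 2 of the claim times the 4 in
    \<open>pack_vol\<close>.\<close>
  from DERIV_cmult[OF this, of 8] show ?thesis
    by (simp add: pack_vol_def mult.assoc K_def)
qed

section \<open>Convexity in the angle coordinates\<close>

text \<open>
  Up to the factor \<open>2 / sqrt Q\<close>, the second derivative of twice the volume along a line with
  velocity \<open>\<psi>\<close> in the angle coordinates, extended to a bilinear form.
\<close>

definition pack_hess :: "'i set \<Rightarrow> ('i \<Rightarrow> real) \<Rightarrow> ('i \<Rightarrow> real) \<Rightarrow> ('i \<Rightarrow> real) \<Rightarrow> real" where
  "pack_hess \<sigma> \<kappa> \<psi> \<eta> =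
    (\<Sum>i\<in>\<sigma>. pack_grad \<sigma> \<kappa> (\<lambda>i. pack_P \<sigma> \<kappa> i * \<psi> i) i / ((\<kappa> i)\<^sup>2 - 1) * ((\<Sum>j\<in>\<sigma>. \<eta> j) - \<eta> i))"

lemma square_minus_one_neq_zero: "1 < x \<Longrightarrow> x\<^sup>2 - 1 \<noteq> (0::real)"
proof -
  assume "1 < x"
  then have "0 < (x - 1) * (x + 1)" by simp
  then show ?thesis by (simp add: power2_eq_square algebra_simps)
qed

lemma pack_P_pos: "pack_Q \<sigma> \<kappa> > 0 \<Longrightarrow> pack_P \<sigma> \<kappa> i > 0"
  unfolding pack_P_def by (intro add_pos_nonneg) auto

text \<open>If \<open>a\<close>, \<open>b\<close>, \<open>c\<close> are the parameters of three
  vertices, the first factor on the right is \<open>pack_P\<close> of the fourth one. Multiplying by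
  \<open>pack_P\<close> of the vertex with parameter \<open>c\<close> therefore gives an expression
  symmetric in these two vertices, as \<open>pack_hess_symmetric\<close> needs.\<close>

lemma hess_coefficient:
  fixes a b c d :: real
  assumes "a\<^sup>2 \<noteq> 1" "b\<^sup>2 \<noteq> 1"
  shows "1 + (a * c + 1) / (a\<^sup>2 - 1) + (b * c + 1) / (b\<^sup>2 - 1)
    = (1 + a * b + b * c + a * c) * (a * b - 1) / ((a\<^sup>2 - 1) * (b\<^sup>2 - 1))"
proof -
  have "a\<^sup>2 - 1 \<noteq> 0" "b\<^sup>2 - 1 \<noteq> 0" using assms by auto
  then show ?thesis by (simp add: divide_simps) (simp add: power2_eq_square algebra_simps)
qed

lemma pack_P_eq:
  assumes "distinct [a, b, c, d]"
  shows "pack_P {a, b, c, d} \<kappa> a = 1 + \<kappa> b * \<kappa> c + \<kappa> c * \<kappa> d + \<kappa> b * \<kappa> d"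
    "pack_P {a, b, c, d} \<kappa> b = 1 + \<kappa> a * \<kappa> c + \<kappa> c * \<kappa> d + \<kappa> a * \<kappa> d"
    "pack_P {a, b, c, d} \<kappa> c = 1 + \<kappa> a * \<kappa> b + \<kappa> b * \<kappa> d + \<kappa> a * \<kappa> d"
    "pack_P {a, b, c, d} \<kappa> d = 1 + \<kappa> a * \<kappa> b + \<kappa> b * \<kappa> c + \<kappa> a * \<kappa> c"
  unfolding pack_P_def pack_Q_def pack_w_def sum_distinct4[OF assms]
  by (simp_all add: power2_eq_square field_simps)

text \<open>The difference of the two sides is a combination of the antisymmetric expressions
  \<open>pa * qb - pb * qa\<close> and their analogues, and its six coefficients are the differences
  that \<open>s\<close> makes vanish.\<close>

lemma bilinear4_symmetric:
  fixes Pa Pb Pc Pd pa pb pc pd qa qb qc qd :: real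
  assumes s: "Pa * (1 + Rca + Rda) = Pb * (1 + Rcb + Rdb)" "Pa * (1 + Rba + Rda) = Pc * (1 + Rbc + Rdc)"
    "Pa * (1 + Rba + Rca) = Pd * (1 + Rbd + Rcd)" "Pb * (1 + Rab + Rdb) = Pc * (1 + Rac + Rdc)"
    "Pb * (1 + Rab + Rcb) = Pd * (1 + Rad + Rcd)" "Pc * (1 + Rac + Rbc) = Pd * (1 + Rad + Rbd)"
  shows "(Pa * pa + Rab * (Pb * pb) + Rac * (Pc * pc) + Rad * (Pd * pd)) * (qb + qc + qd)
    + (Rba * (Pa * pa) + Pb * pb + Rbc * (Pc * pc) + Rbd * (Pd * pd)) * (qa + qc + qd)
    + (Rca * (Pa * pa) + Rcb * (Pb * pb) + Pc * pc + Rcd * (Pd * pd)) * (qa + qb + qd)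
    + (Rda * (Pa * pa) + Rdb * (Pb * pb) + Rdc * (Pc * pc) + Pd * pd) * (qa + qb + qc)
   = (Pa * qa + Rab * (Pb * qb) + Rac * (Pc * qc) + Rad * (Pd * qd)) * (pb + pc + pd)
    + (Rba * (Pa * qa) + Pb * qb + Rbc * (Pc * qc) + Rbd * (Pd * qd)) * (pa + pc + pd)
    + (Rca * (Pa * qa) + Rcb * (Pb * qb) + Pc * qc + Rcd * (Pd * qd)) * (pa + pb + pd)
    + (Rda * (Pa * qa) + Rdb * (Pb * qb) + Rdc * (Pc * qc) + Pd * qd) * (pa + pb + pc)" (is "?L = ?R")
proof -
  have "?L - ?R = (Pa * (1 + Rca + Rda) - Pb * (1 + Rcb + Rdb)) * (pa * qb - pb * qa)
    + (Pa * (1 + Rba + Rda) - Pc * (1 + Rbc + Rdc)) * (pa * qc - pc * qa)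
    + (Pa * (1 + Rba + Rca) - Pd * (1 + Rbd + Rcd)) * (pa * qd - pd * qa)
    + (Pb * (1 + Rab + Rdb) - Pc * (1 + Rac + Rdc)) * (pb * qc - pc * qb)
    + (Pb * (1 + Rab + Rcb) - Pd * (1 + Rad + Rcd)) * (pb * qd - pd * qb)
    + (Pc * (1 + Rac + Rbc) - Pd * (1 + Rad + Rbd)) * (pc * qd - pd * qc)"
    by (simp add: algebra_simps)
  then show ?thesis unfolding s by simp
qed

text \<open>This is the symmetry of the mixed second derivatives of the volume, obtained by algebra:
  each of the six coefficient conditions compares two expressions that contain the same product of
  two values of \<open>pack_P\<close>.\<close>

lemma pack_hess_symmetric:
  assumes card: "card \<sigma> = 4" and gt: "\<forall>i\<in>\<sigma>. 1 < \<kappa> i"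
  shows "pack_hess \<sigma> \<kappa> \<psi> \<eta> = pack_hess \<sigma> \<kappa> \<eta> \<psi>"
proof -
  obtain a b c d where \<sigma>: "\<sigma> = {a, b, c, d}" and dist: "distinct [a, b, c, d]" using card_4_obtain[OF card] .
  have ne: "(\<kappa> a)\<^sup>2 - 1 \<noteq> 0" "(\<kappa> b)\<^sup>2 - 1 \<noteq> 0" "(\<kappa> c)\<^sup>2 - 1 \<noteq> 0" "(\<kappa> d)\<^sup>2 - 1 \<noteq> 0"
    by (intro square_minus_one_neq_zero; use gt \<sigma> in simp)+
  define R where "R i j = (\<kappa> i * \<kappa> j + 1) / ((\<kappa> i)\<^sup>2 - 1)" for i j
  define p where "p = pack_P \<sigma> \<kappa>"
  have cross: "p y * (1 + R u x + R v x) = ((1 + \<kappa> u * \<kappa> v + \<kappa> v * \<kappa> x + \<kappa> u * \<kappa> x) * p y) * (\<kappa> u * \<kappa> v - 1) / (((\<kappa> u)\<^sup>2 - 1) * ((\<kappa> v)\<^sup>2 - 1))"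
    if "(\<kappa> u)\<^sup>2 - 1 \<noteq> 0" "(\<kappa> v)\<^sup>2 - 1 \<noteq> 0" for x y u v
    using hess_coefficient[of "\<kappa> u" "\<kappa> v" "\<kappa> x"] that unfolding R_def by simp
  have grad: "pack_grad \<sigma> \<kappa> z i / ((\<kappa> i)\<^sup>2 - 1) = (\<Sum>j\<in>\<sigma>. (if i = j then 1 else R i j) * z j)"
    if "i \<in> \<sigma>" "(\<kappa> i)\<^sup>2 - 1 \<noteq> 0" for i and z :: "'a \<Rightarrow> real"
  proof -
    have "(\<Sum>j\<in>\<sigma>. (if i = j then 1 else R i j) * z j) = (\<Sum>j\<in>\<sigma>. R i j * z j + (if i = j then (1 - R i i) * z i else 0))"
      by (intro sum.cong) (auto simp: algebra_simps)
    also have "\<dots> = (\<Sum>j\<in>\<sigma>. R i j * z j) + (1 - R i i) * z i"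
      using that by (simp add: sum.distrib \<sigma>)
    also have "(\<Sum>j\<in>\<sigma>. R i j * z j) = (\<kappa> i * (\<Sum>j\<in>\<sigma>. \<kappa> j * z j) + (\<Sum>j\<in>\<sigma>. z j)) / ((\<kappa> i)\<^sup>2 - 1)"
      by (simp add: R_def sum_distrib_left algebra_simps add_divide_distrib sum_divide_distrib sum.distrib)
    also have "\<dots> + (1 - R i i) * z i = pack_grad \<sigma> \<kappa> z i / ((\<kappa> i)\<^sup>2 - 1)"
    proof -
      have "1 - R i i = - 2 / ((\<kappa> i)\<^sup>2 - 1)"
        using that(2) by (simp add: R_def divide_simps) (simp add: power2_eq_square)
      then show ?thesis by (simp add: pack_grad_def diff_divide_distrib)
    qed
    finally show ?thesis by simp
  qed
  have expand: "pack_hess \<sigma> \<kappa> \<psi> \<eta> =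
     (p a * \<psi> a + R a b * (p b * \<psi> b) + R a c * (p c * \<psi> c) + R a d * (p d * \<psi> d)) * (\<eta> b + \<eta> c + \<eta> d)
    + (R b a * (p a * \<psi> a) + p b * \<psi> b + R b c * (p c * \<psi> c) + R b d * (p d * \<psi> d)) * (\<eta> a + \<eta> c + \<eta> d)
    + (R c a * (p a * \<psi> a) + R c b * (p b * \<psi> b) + p c * \<psi> c + R c d * (p d * \<psi> d)) * (\<eta> a + \<eta> b + \<eta> d)
    + (R d a * (p a * \<psi> a) + R d b * (p b * \<psi> b) + R d c * (p c * \<psi> c) + p d * \<psi> d) * (\<eta> a + \<eta> b + \<eta> c)" for \<psi> \<eta>
  proof -
    have "pack_hess \<sigma> \<kappa> \<psi> \<eta> = (\<Sum>i\<in>\<sigma>. (\<Sum>j\<in>\<sigma>. (if i = j then 1 else R i j) * (p j * \<psi> j)) * ((\<Sum>j\<in>\<sigma>. \<eta> j) - \<eta> i))"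
      unfolding pack_hess_def p_def by (intro sum.cong refl, subst grad) (use ne \<sigma> in auto)
    moreover have "a \<noteq> b" "a \<noteq> c" "a \<noteq> d" "b \<noteq> c" "b \<noteq> d" "c \<noteq> d"
      "b \<noteq> a" "c \<noteq> a" "d \<noteq> a" "c \<noteq> b" "d \<noteq> b" "d \<noteq> c" using dist by auto
    ultimately show ?thesis unfolding \<sigma> sum_distinct4[OF dist] by (simp add: add.assoc)
  qed
  show ?thesis unfolding expand
  proof (rule bilinear4_symmetric)
    note P = pack_P_eq[OF dist, of \<kappa>, folded \<sigma>, folded p_def]
    show "p a * (1 + R c a + R d a) = p b * (1 + R c b + R d b)"
      "p a * (1 + R b a + R d a) = p c * (1 + R b c + R d c)"
      "p a * (1 + R b a + R c a) = p d * (1 + R b d + R c d)"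
      "p b * (1 + R a b + R d b) = p c * (1 + R a c + R d c)"
      "p b * (1 + R a b + R c b) = p d * (1 + R a d + R c d)"
      "p c * (1 + R a c + R b c) = p d * (1 + R a d + R b d)"
      by (simp_all only: cross ne not_False_eq_True) (simp_all add: P mult_ac add_ac)
  qed
qed

lemma pack_hess_cong:
  "(\<And>i. i \<in> \<sigma> \<Longrightarrow> \<psi> i = \<psi>' i) \<Longrightarrow> (\<And>i. i \<in> \<sigma> \<Longrightarrow> \<eta> i = \<eta>' i) \<Longrightarrow> pack_hess \<sigma> \<kappa> \<psi> \<eta> = pack_hess \<sigma> \<kappa> \<psi>' \<eta>'"
  by (simp add: pack_hess_def pack_grad_def)

lemma pack_grad_linear: "pack_grad \<sigma> \<kappa> (\<lambda>i. p i * (x i + s * y i)) i =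
    pack_grad \<sigma> \<kappa> (\<lambda>i. p i * x i) i + s * pack_grad \<sigma> \<kappa> (\<lambda>i. p i * y i) i"
  by (simp add: pack_grad_def sum.distrib sum_distrib_left algebra_simps)

lemma pack_hess_linear_left:
  "pack_hess \<sigma> \<kappa> (\<lambda>i. x i + s * y i) \<eta> = pack_hess \<sigma> \<kappa> x \<eta> + s * pack_hess \<sigma> \<kappa> y \<eta>"
  unfolding pack_hess_def pack_grad_linear
  by (simp add: add_divide_distrib sum.distrib sum_distrib_left algebra_simps)

lemma pack_hess_linear_right:
  "pack_hess \<sigma> \<kappa> \<eta> (\<lambda>i. x i + s * y i) = pack_hess \<sigma> \<kappa> \<eta> x + s * pack_hess \<sigma> \<kappa> \<eta> y"
proof -
  have "A * ((\<Sum>i\<in>\<sigma>. x i + s * y i) - (x j + s * y j)) = A * ((\<Sum>i\<in>\<sigma>. x i) - x j) + s * (A * ((\<Sum>i\<in>\<sigma>. y i) - y j))" for A j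
    by (simp add: sum.distrib sum_distrib_left[symmetric] algebra_simps)
  then show ?thesis unfolding pack_hess_def by (simp only: sum.distrib sum_distrib_left)
qed

text \<open>Suitable test vectors \<open>\<eta>\<close> isolate the gradient entries one by one, so
  all of them vanish. As Q is positive, \<open>pack_w_grad\<close> and
  \<open>pack_grad_inverse\<close> invert the matrix of the form, and \<open>pack_P\<close> is
  positive.\<close>

lemma pack_hess_nondegenerate:
  fixes \<kappa> \<psi> :: "'i \<Rightarrow> real"
  assumes card: "card \<sigma> = 4" and gt: "\<forall>i\<in>\<sigma>. 1 < \<kappa> i" and Q: "pack_Q \<sigma> \<kappa> > 0"
    and zero: "\<And>\<eta>. pack_hess \<sigma> \<kappa> \<psi> \<eta> = 0" and i: "i \<in> \<sigma>"
  shows "\<psi> i = 0"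
proof -
  have fin: "finite \<sigma>" using card by (metis card.infinite zero_neq_numeral)
  define z where "z i = pack_P \<sigma> \<kappa> i * \<psi> i" for i
  have grad: "pack_grad \<sigma> \<kappa> z j = 0" if j: "j \<in> \<sigma>" for j
  proof -
    \<comment> \<open>This choice solves the requirement that the sum of \<open>\<eta>\<close> minus
      \<open>\<eta> i\<close> be 1 for \<open>i = j\<close> and 0 otherwise: the four entries add up
      to 4/3 - 1 = 1/3.\<close>
    define \<eta> :: "'i \<Rightarrow> real" where "\<eta> i = 1 / 3 - (if i = j then 1 else 0)" for i
    have "(\<Sum>i\<in>\<sigma>. \<eta> i) = 1 / 3" using fin j card by (simp add: \<eta>_def sum_subtractf)
    then have "(\<Sum>i\<in>\<sigma>. \<eta> i) - \<eta> i = (if i = j then 1 else 0)" for i by (simp add: \<eta>_def)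
    then have "pack_hess \<sigma> \<kappa> \<psi> \<eta> = (\<Sum>i\<in>\<sigma>. if i = j then pack_grad \<sigma> \<kappa> z i / ((\<kappa> i)\<^sup>2 - 1) else 0)"
      unfolding pack_hess_def z_def[abs_def] by (intro sum.cong) auto
    also have "\<dots> = pack_grad \<sigma> \<kappa> z j / ((\<kappa> j)\<^sup>2 - 1)" using fin j by simp
    finally show ?thesis using zero square_minus_one_neq_zero[OF gt[rule_format, OF j]] by simp
  qed
  have "pack_Q \<sigma> \<kappa> * (\<Sum>i\<in>\<sigma>. \<kappa> i * z i) / 2 = 0"
    using pack_w_grad[OF card, of \<kappa> z] grad by simp
  then have "(\<Sum>i\<in>\<sigma>. \<kappa> i * z i) = 0" using Q by simp
  then have "z i = 0" using pack_grad_inverse[OF card, of z i \<kappa>] grad i by simp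
  then show ?thesis using pack_P_pos[OF Q, of i] by (simp add: z_def)
qed

text \<open>The Cauchy-Schwarz argument: a null vector of a semidefinite symmetric form lies in its
  kernel.\<close>

lemma pack_hess_null:
  assumes card: "card \<sigma> = 4" and gt: "\<forall>i\<in>\<sigma>. 1 < \<kappa> i"
    and nonneg: "\<And>\<eta>. 0 \<le> pack_hess \<sigma> \<kappa> \<eta> \<eta>" and null: "pack_hess \<sigma> \<kappa> \<psi> \<psi> = 0"
  shows "pack_hess \<sigma> \<kappa> \<psi> \<eta> = 0"
proof -
  define c D where "c = pack_hess \<sigma> \<kappa> \<psi> \<eta>" and "D = pack_hess \<sigma> \<kappa> \<eta> \<eta>"
  have D: "D \<ge> 0" using nonneg by (simp add: D_def)
  \<comment> \<open>The optimal step would be \<open>- c / D\<close>; adding 1 avoids a vanishing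
    denominator and still gives a negative value unless \<open>c = 0\<close>.\<close>
  define s where "s = - c / (D + 1)"
  have "0 \<le> pack_hess \<sigma> \<kappa> (\<lambda>i. \<psi> i + s * \<eta> i) (\<lambda>i. \<psi> i + s * \<eta> i)" by (rule nonneg)
  also have "\<dots> = 2 * s * c + s\<^sup>2 * D"
    unfolding pack_hess_linear_left pack_hess_linear_right null
    using pack_hess_symmetric[OF card gt, of \<eta> \<psi>] by (simp add: c_def D_def power2_eq_square algebra_simps)
  also have "\<dots> = - (c\<^sup>2 * (D + 2)) / (D + 1)\<^sup>2"
  proof -
    have "D + 1 \<noteq> 0" using D by simp
    then show ?thesis unfolding s_def
      by (simp add: power_divide divide_simps) (simp add: power2_eq_square algebra_simps)
  qed
  finally have "c\<^sup>2 * (D + 2) \<le> 0" using D by (simp add: divide_le_0_iff zero_le_divide_iff)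
  then have "c\<^sup>2 \<le> 0" using D by (simp add: mult_le_0_iff)
  then show ?thesis by (simp add: c_def)
qed

text \<open>Expanding the quadratic Q along the segment gives
  \<open>t\<^sup>2 * pack_Q \<sigma> \<kappa>\<close>, constants with nonnegative coefficients, and
  a cross term proportional to the sum of the parameters, which is nonnegative. Hence the
  deformation to the regular point stays nondegenerate.\<close>

lemma pack_Q_segment:
  assumes card: "card \<sigma> = 4" and gt: "\<forall>i\<in>\<sigma>. 1 < \<kappa> i" and Q: "pack_Q \<sigma> \<kappa> > 0" and t: "0 \<le> t" "t \<le> 1"
  shows "pack_Q \<sigma> (\<lambda>i. (1 - t) * 2 + t * \<kappa> i) > 0"
proof -
  have s: "(\<Sum>i\<in>\<sigma>. (1 - t) * 2 + t * \<kappa> i) = 8 * (1 - t) + t * (\<Sum>i\<in>\<sigma>. \<kappa> i)"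
    using card by (simp add: sum.distrib sum_distrib_left)
  have "((1 - t) * 2 + t * \<kappa> i)\<^sup>2 = 4 * (1 - t)\<^sup>2 + 4 * (1 - t) * t * \<kappa> i + t\<^sup>2 * (\<kappa> i)\<^sup>2" for i
    by (simp add: power2_eq_square algebra_simps)
  then have q: "(\<Sum>i\<in>\<sigma>. ((1 - t) * 2 + t * \<kappa> i)\<^sup>2) = 16 * (1 - t)\<^sup>2 + 4 * (1 - t) * t * (\<Sum>i\<in>\<sigma>. \<kappa> i) + t\<^sup>2 * (\<Sum>i\<in>\<sigma>. (\<kappa> i)\<^sup>2)"
    using card by (simp add: sum.distrib sum_distrib_left)
  have "pack_Q \<sigma> (\<lambda>i. (1 - t) * 2 + t * \<kappa> i) = t\<^sup>2 * pack_Q \<sigma> \<kappa> + 4 * (1 - t) * (1 + t) + 32 * (1 - t)\<^sup>2 + 8 * (t * (1 - t) * (\<Sum>i\<in>\<sigma>. \<kappa> i))"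
    unfolding pack_Q_def s q by (simp add: power2_eq_square algebra_simps)
  moreover have "0 \<le> (\<Sum>i\<in>\<sigma>. \<kappa> i)" using gt by (intro sum_nonneg) force
  then have "0 \<le> t * (1 - t) * (\<Sum>i\<in>\<sigma>. \<kappa> i)" "0 \<le> 4 * (1 - t) * (1 + t)" using t by auto
  moreover have "0 < t\<^sup>2 * pack_Q \<sigma> \<kappa> + 32 * (1 - t)\<^sup>2"
  proof (cases "t = 0")
    case False
    then have "0 < t\<^sup>2 * pack_Q \<sigma> \<kappa>" using Q by simp
    then show ?thesis by (rule add_pos_nonneg) simp
  qed simp
  ultimately show ?thesis by linarith
qed

text \<open>At the regular point the form is invariant under permutations, hence a combination of
  the squared sum and the sum of squares; both coefficients are positive.\<close>

lemma pack_hess_two: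
  assumes card: "card \<sigma> = 4"
  shows "0 \<le> pack_hess \<sigma> (\<lambda>_. 2) \<psi> \<psi>"
proof -
  obtain a b c d where \<sigma>: "\<sigma> = {a, b, c, d}" and dist: "distinct [a, b, c, d]" using card_4_obtain[OF card] .
  have P: "pack_P \<sigma> (\<lambda>_. 2) i = 13" for i
    unfolding pack_P_def pack_Q_def pack_w_def using card by simp
  define s where "s = (\<Sum>i\<in>\<sigma>. \<psi> i)"
  have "pack_grad \<sigma> (\<lambda>_. 2) (\<lambda>i. 13 * \<psi> i) i = 65 * s - 26 * \<psi> i" for i
    by (simp add: pack_grad_def s_def sum_distrib_left[symmetric])
  note grad = this
  have "pack_hess \<sigma> (\<lambda>_. 2) \<psi> \<psi> = (\<Sum>i\<in>\<sigma>. (13 / 3) * ((5 * s - 2 * \<psi> i) * (s - \<psi> i)))"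
    unfolding pack_hess_def P s_def[symmetric] grad by (intro sum.cong) (simp_all add: field_simps)
  also have "\<dots> = (13 / 3) * (20 * s\<^sup>2 - 7 * s * (\<Sum>i\<in>\<sigma>. \<psi> i) + 2 * (\<Sum>i\<in>\<sigma>. (\<psi> i)\<^sup>2))"
    unfolding \<sigma> sum_distinct4[OF dist] by (simp add: power2_eq_square algebra_simps)
  also have "\<dots> = (13 / 3) * (13 * s\<^sup>2 + 2 * (\<Sum>i\<in>\<sigma>. (\<psi> i)\<^sup>2))"
    by (simp add: s_def[symmetric] power2_eq_square)
  also have "0 \<le> \<dots>" by (intro mult_nonneg_nonneg add_nonneg_nonneg sum_nonneg) auto
  finally show ?thesis .
qed

text \<open>
  The Hessian is nondegenerate as long as \<open>Q > 0\<close>, so its signature cannot change along the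
  segment from \<open>\<kappa>\<close> to the regular configuration \<open>(2, 2, 2, 2)\<close>.
\<close>

lemma pack_hess_nonneg:
  fixes \<kappa> \<psi> :: "'i \<Rightarrow> real"
  assumes card: "card \<sigma> = 4" and gt: "\<forall>i\<in>\<sigma>. 1 < \<kappa> i" and Q: "pack_Q \<sigma> \<kappa> > 0"
  shows "0 \<le> pack_hess \<sigma> \<kappa> \<psi> \<psi>"
proof -
  obtain a b c d where \<sigma>: "\<sigma> = {a, b, c, d}" and dist: "distinct [a, b, c, d]" using card_4_obtain[OF card] .
  \<comment> \<open>Encodes the four relevant values of a velocity as a point of a normed space, so
    that the compact unit sphere is available.\<close>
  define \<Psi> :: "real \<times> real \<times> real \<times> real \<Rightarrow> 'i \<Rightarrow> real" where
    "\<Psi> v i = (if i = a then fst v else if i = b then fst (snd v) else if i = c then fst (snd (snd v)) else snd (snd (snd v)))" for v i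
  define k where "k t i = (1 - t) * 2 + t * \<kappa> i" for t i
  define h where "h x = pack_hess \<sigma> (k (fst x)) (\<Psi> (snd x)) (\<Psi> (snd x))" for x :: "real \<times> real \<times> real \<times> real \<times> real"
  let ?S = "sphere (0 :: real \<times> real \<times> real \<times> real) 1"
  have k_gt: "k t i > 1" if "i \<in> \<sigma>" "t \<in> {0..1}" for t i
  proof -
    show ?thesis
    proof (cases "t = 0")
      case False
      then have "t * 1 < t * \<kappa> i" using gt that by (intro mult_strict_left_mono) auto
      moreover have "t \<le> 1" using that by simp
      moreover have "k t i = 2 - 2 * t + t * \<kappa> i" by (simp add: k_def)
      ultimately show ?thesis by linarith
    qed (simp add: k_def)
  qed
  have k_ne: "(k t i)\<^sup>2 - 1 \<noteq> 0" if "i \<in> \<sigma>" "t \<in> {0..1}" for t i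
    by (rule square_minus_one_neq_zero[OF k_gt[OF that]])
  have k_Q: "pack_Q \<sigma> (k t) > 0" if "t \<in> {0..1}" for t
    unfolding k_def using pack_Q_segment[OF card gt Q] that by simp
  have \<Psi>_eq: "\<Psi> (\<eta> a, \<eta> b, \<eta> c, \<eta> d) i = \<eta> i" if "i \<in> \<sigma>" for \<eta> i
    using that dist by (auto simp: \<sigma> \<Psi>_def)
  have \<Psi>_scale: "\<Psi> v i = 0 + norm v * \<Psi> (v /\<^sub>R norm v) i" if "v \<noteq> 0" for v i
    using that by (simp add: \<Psi>_def)
  have psd: "0 \<le> pack_hess \<sigma> (k t) \<eta> \<eta>" if *: "\<And>v. v \<in> ?S \<Longrightarrow> 0 \<le> h (t, v)" for t \<eta>
  proof -
    define v where "v = (\<eta> a, \<eta> b, \<eta> c, \<eta> d)"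
    have eq: "pack_hess \<sigma> (k t) \<eta> \<eta> = pack_hess \<sigma> (k t) (\<Psi> v) (\<Psi> v)"
      by (rule pack_hess_cong) (simp_all add: \<Psi>_eq v_def)
    show ?thesis
    proof (cases "v = 0")
      case True
      then have "\<Psi> v = (\<lambda>i. 0)" by (auto simp: \<Psi>_def)
      then show ?thesis unfolding eq by (simp add: pack_hess_def pack_grad_def)
    next
      case False
      have z: "pack_hess \<sigma> (k t) (\<lambda>i. 0) \<eta> = 0" "pack_hess \<sigma> (k t) \<eta> (\<lambda>i. 0) = 0" for \<eta>
        by (simp_all add: pack_hess_def pack_grad_def)
      have "\<Psi> v = (\<lambda>i. 0 + norm v * \<Psi> (v /\<^sub>R norm v) i)" using \<Psi>_scale[OF False] by auto
      then have "pack_hess \<sigma> (k t) (\<Psi> v) (\<Psi> v) = pack_hess \<sigma> (k t) (\<lambda>i. 0 + norm v * \<Psi> (v /\<^sub>R norm v) i) (\<lambda>i. 0 + norm v * \<Psi> (v /\<^sub>R norm v) i)"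
        by (simp only:)
      also have "\<dots> = norm v * (norm v * h (t, v /\<^sub>R norm v))"
        unfolding pack_hess_linear_left pack_hess_linear_right z by (simp add: h_def)
      finally show ?thesis unfolding eq using False by (simp add: *)
    qed
  qed
  have cont: "continuous_on ({0..1} \<times> ?S) h"
  proof -
    have c\<Psi>: "continuous_on ({0..1} \<times> ?S) (\<lambda>x. \<Psi> (snd x) i)" for i
      unfolding \<Psi>_def by (cases "i = a"; cases "i = b"; cases "i = c") (auto intro!: continuous_intros)
    have ck: "continuous_on ({0..1} \<times> ?S) (\<lambda>x. k (fst x) i)" for i
      unfolding k_def by (intro continuous_intros)
    show ?thesis
      unfolding h_def pack_hess_def pack_grad_def pack_P_def pack_Q_def pack_w_def
      by (intro continuous_intros c\<Psi> ck) (use k_ne in auto)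
  qed
  \<comment> \<open>\<open>A\<close> collects the parameters at which the form is nonpositive
    somewhere on the sphere, \<open>C\<close> those at which it is semidefinite. Both are closed and
    together they cover the interval; disjointness and connectedness then force \<open>A\<close> to
    be empty because 0 lies in \<open>C\<close>.\<close>
  define N where "N = ({0..1} \<times> ?S) \<inter> h -` {..0}"
  define A where "A = fst ` N"
  define C where "C = {t \<in> {0..1}. \<forall>v\<in>?S. 0 \<le> h (t, v)}"
  have comp: "compact ({0..1::real} \<times> ?S)" by (intro compact_Times compact_sphere compact_Icc)
  have "closed N"
    unfolding N_def by (rule continuous_closed_preimage[OF cont compact_imp_closed[OF comp] closed_atMost])
  from compact_Int_closed[OF comp this] have "compact N" by (simp add: N_def)
  moreover have "continuous_on N fst" by (intro continuous_intros)
  ultimately have "compact A" unfolding A_def using compact_continuous_image by blast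
  then have A: "closed A" by (rule compact_imp_closed)
  have C: "closed C"
  proof -
    have "closed {t \<in> {0..1}. 0 \<le> h (t, v)}" if "v \<in> ?S" for v
    proof -
      have "continuous_on {0..1} (\<lambda>t. h (t, v))"
        by (rule continuous_on_compose2[OF cont]) (use that in \<open>auto intro!: continuous_intros\<close>)
      from continuous_closed_preimage[OF this closed_atLeastAtMost, of "{0..}"]
      have "closed ({0..1} \<inter> (\<lambda>t. h (t, v)) -` {0..})" by simp
      also have "{0..1} \<inter> (\<lambda>t. h (t, v)) -` {0..} = {t \<in> {0..1}. 0 \<le> h (t, v)}" by auto
      finally show ?thesis .
    qed
    then have "closed ({0..1} \<inter> (\<Inter>v\<in>?S. {t \<in> {0..1}. 0 \<le> h (t, v)}))" by (intro closed_Int closed_INT) auto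
    also have "{0..1} \<inter> (\<Inter>v\<in>?S. {t \<in> {0..1}. 0 \<le> h (t, v)}) = C" by (auto simp: C_def)
    finally show ?thesis .
  qed
  have AC: "{0..1} \<subseteq> A \<union> C"
  proof
    fix t :: real assume t: "t \<in> {0..1}"
    show "t \<in> A \<union> C"
    proof (cases "\<forall>v\<in>?S. 0 \<le> h (t, v)")
      case False
      then obtain v where "v \<in> ?S" "h (t, v) \<le> 0" by force
      then have "t \<in> A" unfolding A_def N_def using t by (intro image_eqI[of _ _ "(t, v)"]) auto
      then show ?thesis ..
    qed (use t in \<open>simp add: C_def\<close>)
  qed
  \<comment> \<open>At a common parameter a semidefinite form would have a null vector on the unit
    sphere, which nondegeneracy excludes.\<close>
  have disj: "A \<inter> C = {}"
  proof (rule ccontr)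
    assume "A \<inter> C \<noteq> {}"
    then obtain t where tA: "t \<in> A" and tC: "t \<in> C" by blast
    have t: "t \<in> {0..1}" and nn: "\<And>v. v \<in> ?S \<Longrightarrow> 0 \<le> h (t, v)" using tC by (simp_all add: C_def)
    obtain x where x: "x \<in> N" "t = fst x" using tA unfolding A_def by blast
    define v where "v = snd x"
    have v: "v \<in> ?S" and "h (t, v) \<le> 0" using x by (auto simp: N_def v_def mem_Times_iff)
    with nn[OF v] have "h (t, v) = 0" by simp
    then have 0: "pack_hess \<sigma> (k t) (\<Psi> v) (\<Psi> v) = 0" by (auto simp: h_def intro: antisym)
    have null: "pack_hess \<sigma> (k t) (\<Psi> v) \<eta> = 0" for \<eta>
      by (rule pack_hess_null[OF card _ psd[OF nn] 0]) (use k_gt t in auto)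
    have "\<Psi> v i = 0" if "i \<in> \<sigma>" for i
      by (rule pack_hess_nondegenerate[OF card _ k_Q[OF t] null that]) (use k_gt t in auto)
    then have "\<Psi> v a = 0" "\<Psi> v b = 0" "\<Psi> v c = 0" "\<Psi> v d = 0" by (simp_all add: \<sigma>)
    then have "v = 0" using dist by (cases v) (auto simp: \<Psi>_def zero_prod_def)
    with v show False by simp
  qed
  have "0 \<in> C" unfolding C_def h_def k_def using pack_hess_two[OF card] by simp
  then have "A \<inter> {0..1} = {}"
    using connected_closedD[OF connected_Icc _ AC A C] disj by (auto simp: C_def)
  moreover have "1 \<in> {0..1::real}" by simp
  ultimately have "1 \<in> C" using AC by blast
  then have "0 \<le> pack_hess \<sigma> (k 1) \<psi> \<psi>" by (intro psd) (auto simp: C_def)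
  then show ?thesis by (simp add: k_def[abs_def])
qed

section \<open>The angle coordinates\<close>

definition pack_angle :: "'i set \<Rightarrow> ('i \<Rightarrow> real) \<Rightarrow> 'i \<Rightarrow> real" where
  "pack_angle \<sigma> \<kappa> i = arctan (2 * pack_w \<sigma> \<kappa> i / sqrt (pack_Q \<sigma> \<kappa>))"

text \<open>The dihedral angle at an edge is the sum of \<open>pack_angle\<close> over the two
  vertices off the edge, so each of the three vertices other than \<open>i\<close> contributes to
  two of the three dihedral angles at \<open>i\<close>.\<close>

definition pack_solid :: "'i set \<Rightarrow> ('i \<Rightarrow> real) \<Rightarrow> 'i \<Rightarrow> real" where
  "pack_solid \<sigma> \<kappa> i = 2 * (\<Sum>j\<in>\<sigma> - {i}. pack_angle \<sigma> \<kappa> j) - pi"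

text \<open>The inverse of the coordinate change \<open>\<kappa> \<mapsto> 2 w / sqrt Q\<close>, with \<open>Q = 16 / E\<close>.\<close>

definition angle_E :: "'i set \<Rightarrow> ('i \<Rightarrow> real) \<Rightarrow> real" where
  "angle_E \<sigma> W = 4 + 2 * (\<Sum>i\<in>\<sigma>. (W i)\<^sup>2) - (\<Sum>i\<in>\<sigma>. W i)\<^sup>2"

definition angle_kappa :: "'i set \<Rightarrow> ('i \<Rightarrow> real) \<Rightarrow> 'i \<Rightarrow> real" where
  "angle_kappa \<sigma> W i = ((\<Sum>j\<in>\<sigma>. W j) - 2 * W i) / sqrt (angle_E \<sigma> W)"

lemma angle_kappa_sums:
  assumes card: "card \<sigma> = 4" and E: "angle_E \<sigma> W > 0"
  shows "(\<Sum>i\<in>\<sigma>. angle_kappa \<sigma> W i) = 2 * (\<Sum>i\<in>\<sigma>. W i) / sqrt (angle_E \<sigma> W)"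
    and "(\<Sum>i\<in>\<sigma>. (angle_kappa \<sigma> W i)\<^sup>2) = 4 * (\<Sum>i\<in>\<sigma>. (W i)\<^sup>2) / angle_E \<sigma> W"
proof -
  show "(\<Sum>i\<in>\<sigma>. angle_kappa \<sigma> W i) = 2 * (\<Sum>i\<in>\<sigma>. W i) / sqrt (angle_E \<sigma> W)"
    unfolding angle_kappa_def sum_divide_distrib[symmetric] using card
    by (simp add: sum_subtractf sum_distrib_left[symmetric])
  have "(\<Sum>i\<in>\<sigma>. (S - 2 * W i)\<^sup>2) = 4 * S\<^sup>2 - 4 * S * (\<Sum>i\<in>\<sigma>. W i) + 4 * (\<Sum>i\<in>\<sigma>. (W i)\<^sup>2)" for S
  proof -
    have "(S - 2 * W i)\<^sup>2 = S\<^sup>2 - 4 * S * W i + 4 * (W i)\<^sup>2" for i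
      by (simp add: power2_eq_square algebra_simps)
    then show ?thesis using card by (simp add: sum.distrib sum_subtractf sum_distrib_left)
  qed
  from this[of "\<Sum>i\<in>\<sigma>. W i"] show "(\<Sum>i\<in>\<sigma>. (angle_kappa \<sigma> W i)\<^sup>2) = 4 * (\<Sum>i\<in>\<sigma>. (W i)\<^sup>2) / angle_E \<sigma> W"
    unfolding angle_kappa_def power_divide sum_divide_distrib[symmetric] using E by (simp add: power2_eq_square)
qed

lemma pack_Q_angle_kappa:
  assumes card: "card \<sigma> = 4" and E: "angle_E \<sigma> W > 0"
  shows "pack_Q \<sigma> (angle_kappa \<sigma> W) = 16 / angle_E \<sigma> W"
proof -
  have "pack_Q \<sigma> (angle_kappa \<sigma> W) = (4 * (\<Sum>i\<in>\<sigma>. W i)\<^sup>2 - 8 * (\<Sum>i\<in>\<sigma>. (W i)\<^sup>2)) / angle_E \<sigma> W + 4"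
    unfolding pack_Q_def angle_kappa_sums[OF assms] using E by (simp add: power_divide power_mult_distrib diff_divide_distrib)
  also have "\<dots> = 16 / angle_E \<sigma> W"
    using E by (simp add: field_simps) (simp add: angle_E_def)
  finally show ?thesis .
qed

lemma pack_w_angle_kappa:
  assumes card: "card \<sigma> = 4" and E: "angle_E \<sigma> W > 0"
  shows "pack_w \<sigma> (angle_kappa \<sigma> W) i = 2 * W i / sqrt (angle_E \<sigma> W)"
  unfolding pack_w_def angle_kappa_sums[OF assms] by (simp add: angle_kappa_def diff_divide_distrib)

lemma sqrt_pack_Q_angle_kappa:
  assumes card: "card \<sigma> = 4" and E: "angle_E \<sigma> W > 0"
  shows "sqrt (pack_Q \<sigma> (angle_kappa \<sigma> W)) = 4 / sqrt (angle_E \<sigma> W)"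
  unfolding pack_Q_angle_kappa[OF assms] by (simp add: real_sqrt_divide)

text \<open>Because there are four entries, \<open>pack_w\<close> has the same sum and the same sum
  of squares as \<open>\<kappa>\<close>. This determines \<open>angle_E\<close> in terms of Q, and
  the parameters follow.\<close>

lemma angle_kappa_pack_angle:
  assumes card: "card \<sigma> = 4" and Q: "pack_Q \<sigma> \<kappa> > 0"
  defines "W \<equiv> \<lambda>i. tan (pack_angle \<sigma> \<kappa> i)"
  shows "angle_E \<sigma> W = 16 / pack_Q \<sigma> \<kappa>" and "angle_kappa \<sigma> W i = \<kappa> i"
proof -
  define q where "q = pack_Q \<sigma> \<kappa>"
  have q: "q > 0" using Q by (simp add: q_def)
  have W: "W i = 2 * pack_w \<sigma> \<kappa> i / sqrt q" for i by (simp add: W_def pack_angle_def tan_arctan q_def)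
  have sw: "(\<Sum>i\<in>\<sigma>. pack_w \<sigma> \<kappa> i) = (\<Sum>i\<in>\<sigma>. \<kappa> i)"
    using card by (simp add: pack_w_def sum_subtractf)
  have "(\<Sum>i\<in>\<sigma>. (s / 2 - \<kappa> i)\<^sup>2) = s\<^sup>2 - s * (\<Sum>i\<in>\<sigma>. \<kappa> i) + (\<Sum>i\<in>\<sigma>. (\<kappa> i)\<^sup>2)" for s
    using card by (simp add: power2_diff sum_subtractf sum.distrib sum_distrib_left algebra_simps power_divide)
  from this[of "\<Sum>i\<in>\<sigma>. \<kappa> i"] have sw2: "(\<Sum>i\<in>\<sigma>. (pack_w \<sigma> \<kappa> i)\<^sup>2) = (\<Sum>i\<in>\<sigma>. (\<kappa> i)\<^sup>2)"
    by (simp add: pack_w_def power2_eq_square)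
  have s: "(\<Sum>i\<in>\<sigma>. W i) = 2 * (\<Sum>i\<in>\<sigma>. \<kappa> i) / sqrt q"
    unfolding W sum_divide_distrib[symmetric] sum_distrib_left[symmetric] sw ..
  have s2: "(\<Sum>i\<in>\<sigma>. (W i)\<^sup>2) = 4 * (\<Sum>i\<in>\<sigma>. (\<kappa> i)\<^sup>2) / q"
    unfolding W power_divide power_mult_distrib sum_divide_distrib[symmetric] sum_distrib_left[symmetric] sw2 using q by simp
  have "angle_E \<sigma> W = 4 + (8 * (\<Sum>i\<in>\<sigma>. (\<kappa> i)\<^sup>2) - 4 * (\<Sum>i\<in>\<sigma>. \<kappa> i)\<^sup>2) / q"
    unfolding angle_E_def s s2 using q by (simp add: power_divide power_mult_distrib diff_divide_distrib)
  also have "\<dots> = 16 / q"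
    using q by (simp add: field_simps) (simp add: q_def pack_Q_def)
  finally show E: "angle_E \<sigma> W = 16 / pack_Q \<sigma> \<kappa>" by (simp add: q_def)
  show "angle_kappa \<sigma> W i = \<kappa> i"
    unfolding angle_kappa_def s E unfolding W using q
    by (simp add: q_def[symmetric] real_sqrt_divide pack_w_def field_simps)
qed

lemma pack_angle_bound: "\<bar>pack_angle \<sigma> \<kappa> i\<bar> < pi / 2"
  unfolding pack_angle_def abs_less_iff
  using arctan_bounded[of "2 * pack_w \<sigma> \<kappa> i / sqrt (pack_Q \<sigma> \<kappa>)"] by linarith

lemma cos_pos_abs: "\<bar>x\<bar> < pi / 2 \<Longrightarrow> 0 < cos x"
  by (rule cos_gt_zero_pi) linarith+

text \<open>The left side is 4 times the sum of pairwise products of the other three tangents, minus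
  4. The addition theorem expresses the cosine of a sum of three angles by the same quantity. The
  sign thus tells whether \<open>angle_kappa\<close> exceeds 1 in absolute value.\<close>

lemma angle_excess:
  assumes card: "card \<sigma> = 4" and i: "i \<in> \<sigma>" and lt: "\<forall>j\<in>\<sigma>. \<bar>\<phi> j\<bar> < pi / 2"
  shows "((\<Sum>j\<in>\<sigma>. tan (\<phi> j)) - 2 * tan (\<phi> i))\<^sup>2 - angle_E \<sigma> (\<lambda>j. tan (\<phi> j))
    = - 4 * cos (\<Sum>j\<in>\<sigma> - {i}. \<phi> j) / (\<Prod>j\<in>\<sigma> - {i}. cos (\<phi> j))"
proof -
  have "card (\<sigma> - {i}) = 3" using card i by (simp add: card_Diff_singleton)
  then obtain a b c where abc: "\<sigma> - {i} = {a, b, c}" "a \<noteq> b" "a \<noteq> c" "b \<noteq> c"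
    by (auto simp: card_3_iff)
  then have \<sigma>: "\<sigma> = {i, a, b, c}" and dist: "distinct [i, a, b, c]" using i by auto
  have cpos: "cos (\<phi> j) > 0" if "j \<in> \<sigma>" for j
    using lt that by (intro cos_pos_abs) auto
  have tan: "tan (\<phi> j) = sin (\<phi> j) / cos (\<phi> j)" for j by (simp add: tan_def)
  have "cos (\<Sum>j\<in>\<sigma> - {i}. \<phi> j) = cos (\<phi> a + \<phi> b + \<phi> c)" unfolding abc(1) using abc(2-) by (simp add: add.assoc)
  also have "\<dots> = cos (\<phi> a) * cos (\<phi> b) * cos (\<phi> c) * (1 - (tan (\<phi> a) * tan (\<phi> b) + tan (\<phi> b) * tan (\<phi> c) + tan (\<phi> a) * tan (\<phi> c)))"
    using cpos[of a] cpos[of b] cpos[of c] unfolding tan cos_add sin_add by (simp add: \<sigma> field_simps)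
  finally have cos: "cos (\<Sum>j\<in>\<sigma> - {i}. \<phi> j) = cos (\<phi> a) * cos (\<phi> b) * cos (\<phi> c) * (1 - (tan (\<phi> a) * tan (\<phi> b) + tan (\<phi> b) * tan (\<phi> c) + tan (\<phi> a) * tan (\<phi> c)))" .
  have prod: "(\<Prod>j\<in>\<sigma> - {i}. cos (\<phi> j)) = cos (\<phi> a) * cos (\<phi> b) * cos (\<phi> c)" unfolding abc(1) using abc(2-) by (simp add: mult.assoc)
  have pos: "cos (\<phi> a) * cos (\<phi> b) * cos (\<phi> c) > 0" using cpos by (simp add: \<sigma>)
  have "((\<Sum>j\<in>\<sigma>. tan (\<phi> j)) - 2 * tan (\<phi> i))\<^sup>2 - angle_E \<sigma> (\<lambda>j. tan (\<phi> j))
    = - 4 * (1 - (tan (\<phi> a) * tan (\<phi> b) + tan (\<phi> b) * tan (\<phi> c) + tan (\<phi> a) * tan (\<phi> c)))"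
    unfolding angle_E_def \<sigma> sum_distinct4[OF dist] by (simp add: power2_eq_square algebra_simps)
  also have "\<dots> = - 4 * cos (\<Sum>j\<in>\<sigma> - {i}. \<phi> j) / (\<Prod>j\<in>\<sigma> - {i}. cos (\<phi> j))"
  proof -
    have "- 4 * x = - 4 * (C * x) / C" if "C > 0" for C x :: real using that by simp
    from this[OF pos] show ?thesis unfolding cos prod .
  qed
  finally show ?thesis .
qed

lemma angle_kappa_gt_1:
  assumes "angle_E \<sigma> W > 0" "(\<Sum>j\<in>\<sigma>. W j) - 2 * W i > 0" "((\<Sum>j\<in>\<sigma>. W j) - 2 * W i)\<^sup>2 > angle_E \<sigma> W"
  shows "angle_kappa \<sigma> W i > 1"
  unfolding angle_kappa_def using assms by (simp add: real_less_lsqrt)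

text \<open>Positivity of the solid angle at \<open>i\<close>. By \<open>angle_excess\<close>, a
  parameter above 1 makes the cosine of the sum negative. The sum itself is positive because any two
  of the three angles have a positive sum, so it must lie beyond a right angle.\<close>

lemma pack_solid_pos:
  assumes card: "card \<sigma> = 4" and gt: "\<forall>i\<in>\<sigma>. 1 < \<kappa> i" and Q: "pack_Q \<sigma> \<kappa> > 0" and i: "i \<in> \<sigma>"
  shows "(\<Sum>j\<in>\<sigma> - {i}. pack_angle \<sigma> \<kappa> j) > pi / 2"
proof -
  have "card (\<sigma> - {i}) = 3" using card i by (simp add: card_Diff_singleton)
  then obtain a b c where abc: "\<sigma> - {i} = {a, b, c}" "a \<noteq> b" "a \<noteq> c" "b \<noteq> c"
    by (auto simp: card_3_iff)
  then have \<sigma>: "\<sigma> = {i, a, b, c}" and dist: "distinct [i, a, b, c]" using i by auto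
  let ?\<phi> = "pack_angle \<sigma> \<kappa>"
  let ?W = "\<lambda>i. tan (?\<phi> i)"
  \<comment> \<open>The sum of two entries of \<open>pack_w\<close> equals the sum of the two
    complementary parameters.\<close>
  have w: "pack_w \<sigma> \<kappa> x + pack_w \<sigma> \<kappa> y > 0" if "x \<in> {a, b, c}" "y \<in> {a, b, c}" "x \<noteq> y" for x y
  proof -
    have "\<kappa> i > 1" "\<kappa> a > 1" "\<kappa> b > 1" "\<kappa> c > 1" using gt by (simp_all add: \<sigma>)
    then show ?thesis using that unfolding pack_w_def \<sigma> sum_distinct4[OF dist] by auto
  qed
  have pair: "?\<phi> x + ?\<phi> y > 0" if "x \<in> {a, b, c}" "y \<in> {a, b, c}" "x \<noteq> y" for x y
  proof -
    have "- (2 * pack_w \<sigma> \<kappa> x / sqrt (pack_Q \<sigma> \<kappa>)) < 2 * pack_w \<sigma> \<kappa> y / sqrt (pack_Q \<sigma> \<kappa>)"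
    proof -
      have "0 < 2 * (pack_w \<sigma> \<kappa> x + pack_w \<sigma> \<kappa> y) / sqrt (pack_Q \<sigma> \<kappa>)" using w[OF that] Q by simp
      also have "\<dots> = 2 * pack_w \<sigma> \<kappa> x / sqrt (pack_Q \<sigma> \<kappa>) + 2 * pack_w \<sigma> \<kappa> y / sqrt (pack_Q \<sigma> \<kappa>)"
        by (simp add: distrib_left add_divide_distrib)
      finally show ?thesis by linarith
    qed
    then have "arctan (- (2 * pack_w \<sigma> \<kappa> x / sqrt (pack_Q \<sigma> \<kappa>))) < arctan (2 * pack_w \<sigma> \<kappa> y / sqrt (pack_Q \<sigma> \<kappa>))"
      by (simp only: arctan_less_iff)
    then show ?thesis by (simp add: pack_angle_def arctan_minus)
  qed
  have s: "(\<Sum>j\<in>\<sigma> - {i}. ?\<phi> j) = ?\<phi> a + ?\<phi> b + ?\<phi> c" unfolding abc(1) using abc(2-) by (simp add: add.assoc)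
  have pos: "?\<phi> a + ?\<phi> b + ?\<phi> c > 0"
    using pair[of a b] pair[of b c] pair[of a c] abc(2-) by simp
  have "cos (?\<phi> a + ?\<phi> b + ?\<phi> c) < 0"
  proof -
    note E = angle_kappa_pack_angle(1)[OF card Q]
    have Epos: "angle_E \<sigma> ?W > 0" unfolding E using Q by simp
    have "angle_kappa \<sigma> ?W i > 1" using angle_kappa_pack_angle(2)[OF card Q, of i] gt i by simp
    then have x: "(\<Sum>j\<in>\<sigma>. ?W j) - 2 * ?W i > sqrt (angle_E \<sigma> ?W)"
      unfolding angle_kappa_def using Epos by (simp add: less_divide_eq)
    then have "(sqrt (angle_E \<sigma> ?W))\<^sup>2 < ((\<Sum>j\<in>\<sigma>. ?W j) - 2 * ?W i)\<^sup>2"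
      using Epos by (intro power_strict_mono) auto
    then have "0 < ((\<Sum>j\<in>\<sigma>. ?W j) - 2 * ?W i)\<^sup>2 - angle_E \<sigma> ?W" using Epos by simp
    also have "\<dots> = - 4 * cos (\<Sum>j\<in>\<sigma> - {i}. ?\<phi> j) / (\<Prod>j\<in>\<sigma> - {i}. cos (?\<phi> j))"
      by (rule angle_excess[OF card i]) (blast intro: pack_angle_bound)
    finally have "0 < - 4 * cos (\<Sum>j\<in>\<sigma> - {i}. ?\<phi> j) / (\<Prod>j\<in>\<sigma> - {i}. cos (?\<phi> j))" .
    moreover have "0 < (\<Prod>j\<in>\<sigma> - {i}. cos (?\<phi> j))"
      by (intro prod_pos ballI cos_pos_abs pack_angle_bound)
    moreover have "x < 0" if "0 < - 4 * x / C" "0 < C" for x C :: real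
      using that by (simp add: divide_less_0_iff)
    ultimately have "cos (\<Sum>j\<in>\<sigma> - {i}. ?\<phi> j) < 0" by blast
    then show ?thesis by (simp only: s)
  qed
  moreover have "0 \<le> cos (?\<phi> a + ?\<phi> b + ?\<phi> c)" if "?\<phi> a + ?\<phi> b + ?\<phi> c \<le> pi / 2"
    using that pos by (intro cos_ge_zero) auto
  ultimately show ?thesis unfolding s by linarith
qed

lemma arcoth_deriv:
  assumes "x > 1"
  shows "(arcoth has_real_derivative - 1 / (x\<^sup>2 - 1)) (at x)"
proof (rule has_field_derivative_transform_within_open[of _ _ _ "{1<..}"])
  have ne: "x - 1 \<noteq> 0" "x + 1 \<noteq> 0" using assms by auto
  have "((\<lambda>x. (ln (x + 1) - ln (x - 1)) / 2) has_real_derivative (1 / (x + 1) - 1 / (x - 1)) / 2) (at x)"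
    using assms by (auto intro!: derivative_eq_intros)
  also have "(1 / (x + 1) - 1 / (x - 1)) / 2 = - 1 / ((x - 1) * (x + 1))"
    using ne by (simp add: divide_simps)
  also have "(x - 1) * (x + 1) = x\<^sup>2 - 1" by (simp add: power2_eq_square algebra_simps)
  finally show "((\<lambda>x. (ln (x + 1) - ln (x - 1)) / 2) has_real_derivative - 1 / (x\<^sup>2 - 1)) (at x)" .
qed (use assms in \<open>auto simp: arcoth_def ln_div\<close>)

text \<open>With \<open>W\<close> the tangents of the angles and \<open>\<psi>\<close> the angle
  velocity, \<open>W'\<close> is the velocity of \<open>W\<close> and the left side is the quotient
  rule for \<open>angle_kappa\<close>. Since \<open>pack_P\<close> is 4/E times
  \<open>1 + (W i)\<^sup>2\<close>, this is exactly the direction for which Plackett's identity was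
  set up.\<close>

lemma angle_kappa_velocity:
  fixes W \<psi> :: "'i \<Rightarrow> real"
  assumes card: "card \<sigma> = 4" and E: "angle_E \<sigma> W > 0"
  defines "W' \<equiv> \<lambda>i. (1 + (W i)\<^sup>2) * \<psi> i" and "\<kappa> \<equiv> angle_kappa \<sigma> W"
  shows "((\<Sum>j\<in>\<sigma>. W' j) - 2 * W' i) / sqrt (angle_E \<sigma> W)
      - ((\<Sum>j\<in>\<sigma>. W j) - 2 * W i) * (2 * (\<Sum>j\<in>\<sigma>. W j * W' j) - (\<Sum>j\<in>\<sigma>. W j) * (\<Sum>j\<in>\<sigma>. W' j))
        / (angle_E \<sigma> W * sqrt (angle_E \<sigma> W))
    = pack_grad \<sigma> \<kappa> (\<lambda>i. pack_P \<sigma> \<kappa> i * \<psi> i) i / sqrt (pack_Q \<sigma> \<kappa>)"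
proof -
  define e where "e = sqrt (angle_E \<sigma> W)"
  have e: "e > 0" "angle_E \<sigma> W = e * e" using E by (simp_all add: e_def)
  define S where "S = (\<Sum>j\<in>\<sigma>. W j)"
  have P: "pack_P \<sigma> \<kappa> i * \<psi> i = 4 / (e * e) * W' i" for i
    unfolding pack_P_def \<kappa>_def pack_Q_angle_kappa[OF card E] pack_w_angle_kappa[OF card E] e_def[symmetric] e(2) W'_def
    using e(1) by (simp add: field_simps power2_eq_square)
  have k: "\<kappa> j = (S - 2 * W j) / e" for j by (simp add: \<kappa>_def angle_kappa_def S_def e_def)
  have s1: "(\<Sum>j\<in>\<sigma>. 4 / (e * e) * W' j) = 4 / (e * e) * (\<Sum>j\<in>\<sigma>. W' j)" by (simp only: sum_distrib_left)
  have s2: "(\<Sum>j\<in>\<sigma>. \<kappa> j * (4 / (e * e) * W' j)) = 4 / (e * e * e) * (S * (\<Sum>j\<in>\<sigma>. W' j) - 2 * (\<Sum>j\<in>\<sigma>. W j * W' j))"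
  proof -
    have "\<kappa> j * (4 / (e * e) * W' j) = 4 / (e * e * e) * (S * W' j - 2 * (W j * W' j))" for j
      unfolding k using e(1) by (simp add: field_simps)
    then show ?thesis by (simp only: sum_distrib_left[symmetric] sum_subtractf)
  qed
  have sq: "sqrt (pack_Q \<sigma> \<kappa>) = 4 / e" unfolding \<kappa>_def sqrt_pack_Q_angle_kappa[OF card E] e_def ..
  show ?thesis
    unfolding pack_grad_def P s1 s2 sq e_def[symmetric] e(2) S_def[symmetric] k[of i]
    using e(1) by (simp add: field_simps)
qed

section \<open>Motion along straight lines in the angle coordinates\<close>

definition line_kappa :: "'i set \<Rightarrow> ('i \<Rightarrow> real) \<Rightarrow> ('i \<Rightarrow> real) \<Rightarrow> real \<Rightarrow> 'i \<Rightarrow> real" where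
  "line_kappa \<sigma> \<phi> \<psi> t = angle_kappa \<sigma> (\<lambda>i. tan (\<phi> i + t * \<psi> i))"

definition line_E :: "'i set \<Rightarrow> ('i \<Rightarrow> real) \<Rightarrow> ('i \<Rightarrow> real) \<Rightarrow> real \<Rightarrow> real" where
  "line_E \<sigma> \<phi> \<psi> t = angle_E \<sigma> (\<lambda>i. tan (\<phi> i + t * \<psi> i))"

lemma isCont_line_tan:
  assumes "\<bar>\<phi> i + t * \<psi> i\<bar> < pi / 2"
  shows "isCont (\<lambda>t. tan (\<phi> i + t * \<psi> i)) t"
proof (rule isCont_tan')
  show "isCont (\<lambda>t. \<phi> i + t * \<psi> i) t" by (intro continuous_intros)
  show "cos (\<phi> i + t * \<psi> i) \<noteq> 0" using cos_pos_abs[OF assms] by simp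
qed

lemma isCont_line_E:
  assumes "\<forall>i\<in>\<sigma>. \<bar>\<phi> i + t * \<psi> i\<bar> < pi / 2"
  shows "isCont (line_E \<sigma> \<phi> \<psi>) t"
  unfolding line_E_def[abs_def] angle_E_def
  by (intro isCont_diff isCont_add isCont_mult isCont_power isCont_sum continuous_const ballI
      isCont_line_tan bspec[OF assms])

definition line_velocity :: "'i set \<Rightarrow> ('i \<Rightarrow> real) \<Rightarrow> ('i \<Rightarrow> real) \<Rightarrow> real \<Rightarrow> 'i \<Rightarrow> real" where
  "line_velocity \<sigma> \<phi> \<psi> t i = (let W = \<lambda>i. tan (\<phi> i + t * \<psi> i); W' = \<lambda>i. (1 + (W i)\<^sup>2) * \<psi> i in
      ((\<Sum>j\<in>\<sigma>. W' j) - 2 * W' i) / sqrt (angle_E \<sigma> W)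
      - ((\<Sum>j\<in>\<sigma>. W j) - 2 * W i) * (2 * (\<Sum>j\<in>\<sigma>. W j * W' j) - (\<Sum>j\<in>\<sigma>. W j) * (\<Sum>j\<in>\<sigma>. W' j))
        / (angle_E \<sigma> W * sqrt (angle_E \<sigma> W)))"

lemma line_kappa_deriv:
  assumes lt: "\<forall>i\<in>\<sigma>. \<bar>\<phi> i + t * \<psi> i\<bar> < pi / 2" and E: "line_E \<sigma> \<phi> \<psi> t > 0" and i: "i \<in> \<sigma>"
  shows "((\<lambda>t. line_kappa \<sigma> \<phi> \<psi> t i) has_real_derivative line_velocity \<sigma> \<phi> \<psi> t i) (at t)"
proof -
  let ?W = "\<lambda>t i. tan (\<phi> i + t * \<psi> i)"
  define W' where "W' i = (1 + (?W t i)\<^sup>2) * \<psi> i" for i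
  have dW: "((\<lambda>t. ?W t i) has_real_derivative W' i) (at t)" if "i \<in> \<sigma>" for i
  proof -
    have c: "cos (\<phi> i + t * \<psi> i) \<noteq> 0" using cos_pos_abs lt that by force
    have "((\<lambda>t. ?W t i) has_real_derivative inverse ((cos (\<phi> i + t * \<psi> i))\<^sup>2) * \<psi> i) (at t)"
      using c by (auto intro!: derivative_eq_intros)
    also have "inverse ((cos (\<phi> i + t * \<psi> i))\<^sup>2) = 1 + (?W t i)\<^sup>2"
      using tan_sec[OF c] by (simp add: power_inverse)
    finally show ?thesis by (simp add: W'_def)
  qed
  have dS: "((\<lambda>t. \<Sum>j\<in>\<sigma>. ?W t j) has_real_derivative (\<Sum>j\<in>\<sigma>. W' j)) (at t)"
    by (rule DERIV_sum) (rule dW)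
  have dS2: "((\<lambda>t. \<Sum>j\<in>\<sigma>. (?W t j)\<^sup>2) has_real_derivative 2 * (\<Sum>j\<in>\<sigma>. ?W t j * W' j)) (at t)"
    unfolding sum_distrib_left by (rule DERIV_sum) (use DERIV_power[OF dW, where n = 2] in \<open>simp add: mult_ac\<close>)
  have dE: "((\<lambda>t. line_E \<sigma> \<phi> \<psi> t) has_real_derivative
      2 * (2 * (\<Sum>j\<in>\<sigma>. ?W t j * W' j) - (\<Sum>j\<in>\<sigma>. ?W t j) * (\<Sum>j\<in>\<sigma>. W' j))) (at t)"
  proof -
    have "((\<lambda>t. line_E \<sigma> \<phi> \<psi> t) has_real_derivative
      (0 + 2 * (2 * (\<Sum>j\<in>\<sigma>. ?W t j * W' j))) - of_nat 2 * ((\<Sum>j\<in>\<sigma>. W' j) * (\<Sum>j\<in>\<sigma>. ?W t j) ^ (2 - Suc 0))) (at t)"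
      unfolding line_E_def angle_E_def by (intro DERIV_diff DERIV_add DERIV_const DERIV_cmult DERIV_power dS dS2)
    then show ?thesis by (simp add: algebra_simps)
  qed
  define e where "e = sqrt (line_E \<sigma> \<phi> \<psi> t)"
  have e: "e > 0" "line_E \<sigma> \<phi> \<psi> t = e * e" using E by (simp_all add: e_def)
  define Y where "Y = 2 * (\<Sum>j\<in>\<sigma>. ?W t j * W' j) - (\<Sum>j\<in>\<sigma>. ?W t j) * (\<Sum>j\<in>\<sigma>. W' j)"
  have ds: "((\<lambda>t. sqrt (line_E \<sigma> \<phi> \<psi> t)) has_real_derivative Y / e) (at t)"
  proof -
    have "((\<lambda>t. sqrt (line_E \<sigma> \<phi> \<psi> t)) has_real_derivative inverse (sqrt (line_E \<sigma> \<phi> \<psi> t)) / 2 * (2 * Y)) (at t)"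
      unfolding Y_def by (rule DERIV_chain'[OF dE DERIV_real_sqrt[OF E]])
    then show ?thesis by (simp add: e_def inverse_eq_divide)
  qed
  have "((\<lambda>t. ((\<Sum>j\<in>\<sigma>. ?W t j) - 2 * ?W t i) / sqrt (line_E \<sigma> \<phi> \<psi> t)) has_real_derivative
     ((((\<Sum>j\<in>\<sigma>. W' j) - 2 * W' i)) * e - ((\<Sum>j\<in>\<sigma>. ?W t j) - 2 * ?W t i) * (Y / e)) / (e * e)) (at t)"
  proof -
    have "sqrt (line_E \<sigma> \<phi> \<psi> t) \<noteq> 0" using E by simp
    from DERIV_divide[OF DERIV_diff[OF dS DERIV_cmult[OF dW[OF i], of 2]] ds this]
    show ?thesis by (simp only: e_def[symmetric])
  qed
  also have "((((\<Sum>j\<in>\<sigma>. W' j) - 2 * W' i)) * e - ((\<Sum>j\<in>\<sigma>. ?W t j) - 2 * ?W t i) * (Y / e)) / (e * e)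
    = ((\<Sum>j\<in>\<sigma>. W' j) - 2 * W' i) / e - ((\<Sum>j\<in>\<sigma>. ?W t j) - 2 * ?W t i) * Y / (e * e * e)"
    using e(1) by (simp add: field_simps)
  also have "\<dots> = line_velocity \<sigma> \<phi> \<psi> t i"
    unfolding line_velocity_def Let_def line_E_def[symmetric] Y_def W'_def
    unfolding e_def[symmetric] unfolding e(2) ..
  finally show ?thesis unfolding line_kappa_def angle_kappa_def line_E_def .
qed

lemma isCont_line_velocity:
  assumes lt: "\<forall>i\<in>\<sigma>. \<bar>\<phi> i + t * \<psi> i\<bar> < pi / 2" and E: "line_E \<sigma> \<phi> \<psi> t > 0" and i: "i \<in> \<sigma>"
  shows "isCont (\<lambda>t. line_velocity \<sigma> \<phi> \<psi> t i) t"
  unfolding line_velocity_def Let_def line_E_def[symmetric] using E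
  by (intro isCont_diff isCont_add isCont_mult isCont_power isCont_sum isCont_divide continuous_real_sqrt continuous_const ballI
      isCont_line_tan bspec[OF lt] isCont_line_E lt i) auto

lemma line_velocity_eq:
  assumes card: "card \<sigma> = 4" and E: "line_E \<sigma> \<phi> \<psi> t > 0"
  defines "\<kappa> \<equiv> line_kappa \<sigma> \<phi> \<psi> t"
  shows "line_velocity \<sigma> \<phi> \<psi> t i = pack_grad \<sigma> \<kappa> (\<lambda>i. pack_P \<sigma> \<kappa> i * \<psi> i) i / sqrt (pack_Q \<sigma> \<kappa>)"
  unfolding line_velocity_def Let_def \<kappa>_def line_kappa_def
  by (rule angle_kappa_velocity[OF card E[unfolded line_E_def]])

lemma sum_Diff_singleton: "finite \<sigma> \<Longrightarrow> i \<in> \<sigma> \<Longrightarrow> (\<Sum>j\<in>\<sigma> - {i}. f j) = (\<Sum>j\<in>\<sigma>. f j) - (f i :: real)"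
  by (simp add: sum_diff1)

context
  fixes \<sigma> :: "'i set" and \<phi> \<psi> :: "'i \<Rightarrow> real" and t :: real
  assumes card: "card \<sigma> = 4"
    and lt: "\<forall>i\<in>\<sigma>. \<bar>\<phi> i + t * \<psi> i\<bar> < pi / 2" and E: "line_E \<sigma> \<phi> \<psi> t > 0"
    and gt: "\<forall>i\<in>\<sigma>. line_kappa \<sigma> \<phi> \<psi> t i > 1"
begin

lemma fin: "finite \<sigma>" using card by (metis card.infinite zero_neq_numeral)

lemma line_Q: "pack_Q \<sigma> (line_kappa \<sigma> \<phi> \<psi> t) > 0"
  unfolding line_kappa_def using pack_Q_angle_kappa[OF card E[unfolded line_E_def]] E[unfolded line_E_def] by simp

text \<open>Schlaefli's formula along the line. The derivative of the parameters must be known near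
  \<open>t\<close>, which holds because the bounds on the angles and the positivity of
  \<open>line_E\<close> are open conditions.\<close>

lemma line_vol_deriv:
  "((\<lambda>t. 2 * pack_vol \<sigma> (line_kappa \<sigma> \<phi> \<psi> t)) has_real_derivative
    - (\<Sum>i\<in>\<sigma>. arcoth (line_kappa \<sigma> \<phi> \<psi> t i) * (2 * (\<Sum>j\<in>\<sigma> - {i}. \<psi> j)))) (at t)"
proof (rule pack_vol_has_derivative[where k = "line_velocity \<sigma> \<phi> \<psi>", OF card])
  have "\<forall>\<^sub>F s in nhds t. (\<forall>i\<in>\<sigma>. \<bar>\<phi> i + s * \<psi> i\<bar> < pi / 2) \<and> line_E \<sigma> \<phi> \<psi> s > 0"
  proof (intro eventually_conj eventually_ball_finite fin ballI)
    show "\<forall>\<^sub>F s in nhds t. \<bar>\<phi> i + s * \<psi> i\<bar> < pi / 2" if "i \<in> \<sigma>" for i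
    proof (rule order_tendstoD(2)[of _ "\<bar>\<phi> i + t * \<psi> i\<bar>"])
      show "((\<lambda>s. \<bar>\<phi> i + s * \<psi> i\<bar>) \<longlongrightarrow> \<bar>\<phi> i + t * \<psi> i\<bar>) (nhds t)"
        by (intro tendsto_intros filterlim_ident)
    qed (use lt that in auto)
    have "(line_E \<sigma> \<phi> \<psi> \<longlongrightarrow> line_E \<sigma> \<phi> \<psi> t) (nhds t)"
      using isCont_line_E[OF lt] by (simp add: continuous_at tendsto_nhds_iff)
    then show "\<forall>\<^sub>F s in nhds t. 0 < line_E \<sigma> \<phi> \<psi> s" using E by (rule order_tendstoD)
  qed
  then show "\<forall>\<^sub>F s in nhds t. \<forall>i\<in>\<sigma>. ((\<lambda>t. line_kappa \<sigma> \<phi> \<psi> t i) has_real_derivative line_velocity \<sigma> \<phi> \<psi> s i) (at s)"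
    by eventually_elim (use line_kappa_deriv[where \<sigma> = \<sigma>] in blast)
  show "isCont (\<lambda>t. line_velocity \<sigma> \<phi> \<psi> t i) t" if "i \<in> \<sigma>" for i
    by (rule isCont_line_velocity[OF lt E that])
  show "1 < line_kappa \<sigma> \<phi> \<psi> t i" if "i \<in> \<sigma>" for i using gt that by blast
qed (rule line_Q line_velocity_eq[OF card E])+

text \<open>The angle velocity is constant along the line, so differentiating Schlaefli's formula
  affects only the radii; the derivative of \<open>arcoth\<close> supplies the denominators in
  \<open>pack_hess\<close>.\<close>

lemma line_arcoth_deriv:
  "((\<lambda>t. - (\<Sum>i\<in>\<sigma>. arcoth (line_kappa \<sigma> \<phi> \<psi> t i) * (2 * (\<Sum>j\<in>\<sigma> - {i}. \<psi> j)))) has_real_derivative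
    2 * pack_hess \<sigma> (line_kappa \<sigma> \<phi> \<psi> t) \<psi> \<psi> / sqrt (pack_Q \<sigma> (line_kappa \<sigma> \<phi> \<psi> t))) (at t)"
proof -
  let ?k = "line_kappa \<sigma> \<phi> \<psi> t"
  have "((\<lambda>t. - (\<Sum>i\<in>\<sigma>. arcoth (line_kappa \<sigma> \<phi> \<psi> t i) * (2 * (\<Sum>j\<in>\<sigma> - {i}. \<psi> j)))) has_real_derivative
    - (\<Sum>i\<in>\<sigma>. (- 1 / ((?k i)\<^sup>2 - 1) * line_velocity \<sigma> \<phi> \<psi> t i) * (2 * (\<Sum>j\<in>\<sigma> - {i}. \<psi> j)))) (at t)"
    using gt by (intro DERIV_minus DERIV_sum DERIV_cmult_right DERIV_chain2[OF arcoth_deriv] line_kappa_deriv[OF lt E]) auto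
  also have "- (\<Sum>i\<in>\<sigma>. (- 1 / ((?k i)\<^sup>2 - 1) * line_velocity \<sigma> \<phi> \<psi> t i) * (2 * (\<Sum>j\<in>\<sigma> - {i}. \<psi> j)))
    = 2 * pack_hess \<sigma> ?k \<psi> \<psi> / sqrt (pack_Q \<sigma> ?k)"
  proof -
    define c where "c i = (\<Sum>j\<in>\<sigma> - {i}. \<psi> j)" for i
    have c: "(\<Sum>j\<in>\<sigma>. \<psi> j) - \<psi> i = c i" if "i \<in> \<sigma>" for i
      using that by (simp add: c_def sum_Diff_singleton fin)
    have "pack_hess \<sigma> ?k \<psi> \<psi> = (\<Sum>i\<in>\<sigma>. pack_grad \<sigma> ?k (\<lambda>i. pack_P \<sigma> ?k i * \<psi> i) i / ((?k i)\<^sup>2 - 1) * c i)"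
      unfolding pack_hess_def by (intro sum.cong) (simp_all add: c)
    then show ?thesis
      unfolding line_velocity_eq[OF card E] c_def[symmetric]
      by (simp only: sum_distrib_left sum_divide_distrib sum_negf[symmetric]) (intro sum.cong; simp)
  qed
  finally show ?thesis .
qed

lemma line_arcoth_deriv_nonneg:
  "0 \<le> 2 * pack_hess \<sigma> (line_kappa \<sigma> \<phi> \<psi> t) \<psi> \<psi> / sqrt (pack_Q \<sigma> (line_kappa \<sigma> \<phi> \<psi> t))"
  using pack_hess_nonneg[OF card gt line_Q] line_Q by simp

end

section \<open>The tangent inequality for the volume\<close>

lemma convex_above_tangent:
  fixes f g g' :: "real \<Rightarrow> real"
  assumes t: "0 \<le> t"
    and f: "\<And>s. 0 \<le> s \<Longrightarrow> s \<le> t \<Longrightarrow> (f has_real_derivative g s) (at s)"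
    and g: "\<And>s. 0 \<le> s \<Longrightarrow> s \<le> t \<Longrightarrow> (g has_real_derivative g' s) (at s)"
    and g': "\<And>s. 0 \<le> s \<Longrightarrow> s \<le> t \<Longrightarrow> 0 \<le> g' s"
  shows "f 0 + t * g 0 \<le> f t"
proof (cases "t = 0")
  case False
  then have "0 < t" using t by simp
  from MVT2[OF this f] obtain z where z: "0 < z" "z < t" "f t - f 0 = (t - 0) * g z" by auto
  have "g 0 \<le> g z"
  proof (rule DERIV_nonneg_imp_nondecreasing[where f = g and a = 0 and b = z])
    fix x assume "0 \<le> x" "x \<le> z"
    then show "\<exists>y. (g has_real_derivative y) (at x) \<and> 0 \<le> y"
      using g[of x] g'[of x] z by auto
  qed (use z in auto)
  then have "t * g 0 \<le> t * g z" using \<open>0 < t\<close> by simp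
  with z(3) show ?thesis by simp
qed simp

lemma pack_vol_nonneg: "pack_Q \<sigma> \<kappa> > 0 \<Longrightarrow> 0 \<le> pack_vol \<sigma> \<kappa>"
  by (simp add: pack_vol_def pack_integral_nonneg)

text \<open>The hypothesis \<open>ge\<close> puts the squared parameters above 1 by at least
  \<delta>/E, so the Gaussian integral is of order E^2, while sqrt Q is only 4 / sqrt E. The volume
  is therefore of order E^(3/2) as E tends to 0.\<close>

lemma pack_vol_degenerate_bound:
  assumes card: "card \<sigma> = 4" and E: "angle_E \<sigma> W > 0" and \<delta>: "\<delta> > 0"
    and pos: "\<forall>i\<in>\<sigma>. (\<Sum>j\<in>\<sigma>. W j) - 2 * W i > 0"
    and ge: "\<forall>i\<in>\<sigma>. ((\<Sum>j\<in>\<sigma>. W j) - 2 * W i)\<^sup>2 - angle_E \<sigma> W \<ge> \<delta>"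
  shows "pack_vol \<sigma> (angle_kappa \<sigma> W) \<le> 16 * (\<integral>x. exp (- x\<^sup>2) \<partial>halfline) ^ 4 / \<delta>\<^sup>2 * (angle_E \<sigma> W * sqrt (angle_E \<sigma> W))"
proof -
  define e where "e = angle_E \<sigma> W"
  have e: "e > 0" using E by (simp add: e_def)
  have fin: "finite \<sigma>" using card by (metis card.infinite zero_neq_numeral)
  let ?k = "angle_kappa \<sigma> W"
  let ?c = "\<integral>x. exp (- x\<^sup>2) \<partial>halfline"
  interpret pack_bounds \<sigma> ?k "\<delta> / e" "Max (?k ` \<sigma>)"
  proof
    fix i assume i: "i \<in> \<sigma>"
    show "0 \<le> ?k i" using pos i by (simp add: angle_kappa_def less_imp_le E)
    have "((\<Sum>j\<in>\<sigma>. W j) - 2 * W i)\<^sup>2 \<ge> e + \<delta>" using ge i by (auto simp: e_def)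
    then have "(e + \<delta>) / e \<le> ((\<Sum>j\<in>\<sigma>. W j) - 2 * W i)\<^sup>2 / e"
      using e by (intro divide_right_mono) auto
    then show "1 + \<delta> / e \<le> (?k i)\<^sup>2"
      unfolding angle_kappa_def power_divide e_def[symmetric] using e by (simp add: add_divide_distrib)
  qed (use fin e \<delta> in auto)
  have "pack_vol \<sigma> ?k = 16 / sqrt e * pack_integral \<sigma> ?k"
    unfolding pack_vol_def sqrt_pack_Q_angle_kappa[OF card E] e_def by simp
  also have "\<dots> \<le> 16 / sqrt e * ((?c / sqrt (\<delta> / e)) ^ card \<sigma>)"
    using e by (intro mult_left_mono pack_integral_le) auto
  also have "(?c / sqrt (\<delta> / e)) ^ card \<sigma> = ?c ^ 4 * e\<^sup>2 / \<delta>\<^sup>2"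
  proof -
    have "sqrt (\<delta> / e) ^ 4 = (\<delta> / e)\<^sup>2"
      using e \<delta> power_mult[of "sqrt (\<delta> / e)" 2 2] by simp
    then show ?thesis unfolding card by (simp add: power_divide)
  qed
  also have "16 / sqrt e * (?c ^ 4 * e\<^sup>2 / \<delta>\<^sup>2) = 16 * ?c ^ 4 / \<delta>\<^sup>2 * (e * (e / sqrt e))"
    by (simp add: power2_eq_square mult_ac)
  also have "e / sqrt e = sqrt e" using e by (simp add: real_div_sqrt)
  finally show ?thesis by (simp add: e_def)
qed

text \<open>
  In the coordinates \<open>\<phi>\<close> the volume is convex with gradient given by Schlaefli's formula. If the
  segment leaves the domain, then at the first exit point all radii and hence the volume tend to 0,
  which makes the tangent at the starting point nonpositive at the other end.
\<close>

lemma pack_vol_above_tangent: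
  fixes \<kappa>0 \<kappa>1 :: "'i \<Rightarrow> real"
  assumes card: "card \<sigma> = 4"
    and gt0: "\<forall>i\<in>\<sigma>. 1 < \<kappa>0 i" and Q0: "pack_Q \<sigma> \<kappa>0 > 0"
    and gt1: "\<forall>i\<in>\<sigma>. 1 < \<kappa>1 i" and Q1: "pack_Q \<sigma> \<kappa>1 > 0"
  shows "(\<Sum>i\<in>\<sigma>. arcoth (\<kappa>0 i) * pack_solid \<sigma> \<kappa>0 i) + 2 * pack_vol \<sigma> \<kappa>0
    \<le> (\<Sum>i\<in>\<sigma>. arcoth (\<kappa>0 i) * pack_solid \<sigma> \<kappa>1 i) + 2 * pack_vol \<sigma> \<kappa>1"
proof -
  have fin: "finite \<sigma>" using card by (metis card.infinite zero_neq_numeral)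
  define \<phi> where "\<phi> = pack_angle \<sigma> \<kappa>0"
  define \<psi> where "\<psi> i = pack_angle \<sigma> \<kappa>1 i - pack_angle \<sigma> \<kappa>0 i" for i
  define E where "E = line_E \<sigma> \<phi> \<psi>"
  define k where "k = line_kappa \<sigma> \<phi> \<psi>"
  define X where "X t i = (\<Sum>j\<in>\<sigma>. tan (\<phi> j + t * \<psi> j)) - 2 * tan (\<phi> i + t * \<psi> i)" for t i
  define f where "f t = 2 * pack_vol \<sigma> (k t)" for t
  define g where "g t = - (\<Sum>i\<in>\<sigma>. arcoth (k t i) * (2 * (\<Sum>j\<in>\<sigma> - {i}. \<psi> j)))" for t
  have conv: "\<phi> i + t * \<psi> i = (1 - t) * pack_angle \<sigma> \<kappa>0 i + t * pack_angle \<sigma> \<kappa>1 i" for t i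
    by (simp add: \<phi>_def \<psi>_def algebra_simps)
  have k0: "k 0 = \<kappa>0" unfolding k_def line_kappa_def \<phi>_def using angle_kappa_pack_angle(2)[OF card Q0] by auto
  have k1: "k 1 = \<kappa>1" unfolding k_def line_kappa_def conv using angle_kappa_pack_angle(2)[OF card Q1] by auto
  have E0: "E 0 > 0" unfolding E_def line_E_def \<phi>_def using angle_kappa_pack_angle(1)[OF card Q0] Q0 by simp
  have lt: "\<forall>i\<in>\<sigma>. \<bar>\<phi> i + t * \<psi> i\<bar> < pi / 2" if "t \<in> {0..1}" for t
  proof
    fix i
    have "(1 - t) *\<^sub>R pack_angle \<sigma> \<kappa>0 i + t *\<^sub>R pack_angle \<sigma> \<kappa>1 i \<in> {- (pi / 2)<..<pi / 2}"
      using that pack_angle_bound[of \<sigma> \<kappa>0 i] pack_angle_bound[of \<sigma> \<kappa>1 i]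
      by (intro convexD_alt) (auto simp: abs_less_iff)
    then have "\<phi> i + t * \<psi> i \<in> {- (pi / 2)<..<pi / 2}" by (simp only: conv real_scaleR_def)
    then show "\<bar>\<phi> i + t * \<psi> i\<bar> < pi / 2" unfolding greaterThanLessThan_iff by linarith
  qed
  \<comment> \<open>The sum of three angles lies above pi/2 at both ends and hence throughout, and
    it stays below 3 pi/2, so its cosine is negative. The resulting inequality holds on the whole
    segment, even where \<open>E\<close> is not positive.\<close>
  have excess: "E t < (X t i)\<^sup>2" if t: "t \<in> {0..1}" and i: "i \<in> \<sigma>" for t i
  proof -
    define y where "y = (\<Sum>j\<in>\<sigma> - {i}. \<phi> j + t * \<psi> j)"
    have "y = (1 - t) * (\<Sum>j\<in>\<sigma> - {i}. pack_angle \<sigma> \<kappa>0 j) + t * (\<Sum>j\<in>\<sigma> - {i}. pack_angle \<sigma> \<kappa>1 j)"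
      unfolding y_def conv by (simp add: sum.distrib sum_distrib_left)
    moreover have "(1 - t) *\<^sub>R (\<Sum>j\<in>\<sigma> - {i}. pack_angle \<sigma> \<kappa>0 j) + t *\<^sub>R (\<Sum>j\<in>\<sigma> - {i}. pack_angle \<sigma> \<kappa>1 j) \<in> {pi / 2<..}"
      using t pack_solid_pos[OF card gt0 Q0 i] pack_solid_pos[OF card gt1 Q1 i] by (intro convexD_alt) auto
    ultimately have y1: "y > pi / 2" by simp
    have c3: "card (\<sigma> - {i}) = 3" using card i by (simp add: card_Diff_singleton)
    have "y < (\<Sum>j\<in>\<sigma> - {i}. pi / 2)"
    proof -
      have "\<sigma> - {i} \<noteq> {}" using c3 by (metis card.empty zero_neq_numeral)
      moreover have "\<phi> j + t * \<psi> j < pi / 2" if "j \<in> \<sigma>" for j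
        using bspec[OF lt[OF t] that] by linarith
      ultimately show ?thesis unfolding y_def using fin by (intro sum_strict_mono) blast+
    qed
    then have y2: "y < 3 * pi / 2" using c3 by simp
    have "0 < cos (y - pi)" using y1 y2 by (intro cos_gt_zero_pi) auto
    then have "cos y < 0" by simp
    moreover have "0 < (\<Prod>j\<in>\<sigma> - {i}. cos (\<phi> j + t * \<psi> j))"
      using lt[OF t] by (intro prod_pos ballI cos_pos_abs) auto
    ultimately have "0 < - 4 * cos y / (\<Prod>j\<in>\<sigma> - {i}. cos (\<phi> j + t * \<psi> j))"
      by (intro divide_pos_pos) auto
    then show ?thesis
      using angle_excess[OF card i lt[OF t]] by (simp add: X_def E_def line_E_def y_def)
  qed
  have contX: "isCont (\<lambda>t. X t i) t" if "t \<in> {0..1}" "i \<in> \<sigma>" for t i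
    unfolding X_def
    by (intro isCont_diff isCont_mult isCont_sum continuous_const ballI isCont_line_tan bspec[OF lt[OF that(1)]] that(2))
  have contE: "isCont E t" if "t \<in> {0..1}" for t
    unfolding E_def by (rule isCont_line_E[OF lt[OF that]])
  have X0: "X 0 i > 0" if "i \<in> \<sigma>" for i
  proof -
    have "k 0 i > 0" using gt0 that by (auto simp: k0)
    then show ?thesis using E0 unfolding k_def line_kappa_def angle_kappa_def X_def E_def line_E_def
      by (simp add: zero_less_divide_iff)
  qed
  \<comment> \<open>A zero of \<open>X\<close> would force \<open>E\<close> to be negative there by
    \<open>excess\<close>, so \<open>X\<close> keeps its sign as long as \<open>E\<close> is
    nonnegative.\<close>
  have Xpos: "X t i > 0" if t: "t \<in> {0..1}" and i: "i \<in> \<sigma>" and E: "\<And>s. 0 \<le> s \<Longrightarrow> s < t \<Longrightarrow> E s > 0" and Et: "0 \<le> E t" for t i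
  proof (rule ccontr)
    assume "\<not> X t i > 0"
    then have "\<exists>s. 0 \<le> s \<and> s \<le> t \<and> X s i = 0"
      using X0[OF i] t by (intro IVT2') (auto intro!: continuous_at_imp_continuous_on contX i)
    then obtain s where s: "0 \<le> s" "s \<le> t" "X s i = 0" by blast
    then have "E s < 0" using excess[of s i] t i by simp
    with s E[of s] Et show False by (cases "s = t") auto
  qed
  have kgt: "\<forall>i\<in>\<sigma>. k t i > 1" if t: "t \<in> {0..1}" and E: "\<And>s. 0 \<le> s \<Longrightarrow> s \<le> t \<Longrightarrow> E s > 0" for t
  proof
    fix i assume i: "i \<in> \<sigma>"
    show "k t i > 1" unfolding k_def line_kappa_def
      using excess[OF t i] Xpos[OF t i] E t
      by (intro angle_kappa_gt_1) (auto simp: X_def E_def line_E_def less_imp_le)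
  qed
  have tangent: "f 0 + t * g 0 \<le> f t" if t: "t \<in> {0..1}" and E: "\<And>s. 0 \<le> s \<Longrightarrow> s \<le> t \<Longrightarrow> E s > 0" for t
  proof (rule convex_above_tangent)
    fix s assume s: "0 \<le> s" "s \<le> t"
    then have s1: "s \<in> {0..1}" using t by auto
    have Es: "line_E \<sigma> \<phi> \<psi> s > 0" using E[OF s] by (simp add: E_def)
    have ks: "\<forall>i\<in>\<sigma>. line_kappa \<sigma> \<phi> \<psi> s i > 1"
      using kgt[OF s1] E s by (simp add: k_def)
    show "(f has_real_derivative g s) (at s)"
      unfolding f_def g_def k_def by (rule line_vol_deriv[OF card lt[OF s1] Es ks])
    show "(g has_real_derivative 2 * pack_hess \<sigma> (k s) \<psi> \<psi> / sqrt (pack_Q \<sigma> (k s))) (at s)"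
      unfolding g_def k_def by (rule line_arcoth_deriv[OF card lt[OF s1] Es ks])
    show "0 \<le> 2 * pack_hess \<sigma> (k s) \<psi> \<psi> / sqrt (pack_Q \<sigma> (k s))"
      unfolding k_def by (rule line_arcoth_deriv_nonneg[OF card lt[OF s1] Es ks])
  qed (use t in auto)
  have main: "f 0 + g 0 \<le> f 1"
  proof (cases "\<forall>s\<in>{0..1}. E s > 0")
    case True
    then show ?thesis using tangent[of 1] by simp
  next
    case False
    \<comment> \<open>The least element \<open>t1\<close> of \<open>Z\<close> is the first exit
      point; before it \<open>E\<close> is positive, and at it \<open>E\<close> is 0 by
      continuity.\<close>
    define Z where "Z = {0..1} \<inter> E -` {..0}"
    have "continuous_on {0..1} E" by (intro continuous_at_imp_continuous_on ballI contE)
    then have "closed Z" unfolding Z_def by (rule continuous_closed_preimage) auto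
    then have "compact Z" using compact_Int_closed[of "{0..1}" Z] by (simp add: Z_def)
    moreover have "Z \<noteq> {}" using False by (force simp: Z_def)
    ultimately have "\<exists>s\<in>Z. \<forall>t\<in>Z. s \<le> t" by (rule compact_attains_inf)
    then obtain t1 where t1: "t1 \<in> Z" "\<And>t. t \<in> Z \<Longrightarrow> t1 \<le> t" by blast
    have t1': "t1 \<in> {0..1}" "E t1 \<le> 0" using t1 by (auto simp: Z_def)
    have "t1 \<noteq> 0" using t1' E0 by auto
    then have t1_pos: "t1 > 0" using t1' by simp
    have Epos: "E t > 0" if "0 \<le> t" "t < t1" for t
      using t1(2)[of t] that t1' by (force simp: Z_def)
    have Elim: "(E \<longlongrightarrow> E t1) (at_left t1)"
      using contE[OF t1'(1)] unfolding continuous_at by (rule tendsto_within_subset) auto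
    have ev: "\<forall>\<^sub>F t in at_left t1. 0 < t \<and> t < t1"
      using t1_pos eventually_at_left_real by (force simp: eventually_at_left_field)
    have "0 \<le> E t1"
      by (rule tendsto_lowerbound[OF Elim]) (use ev Epos in \<open>auto elim!: eventually_mono simp: less_imp_le\<close>)
    with t1' have Et1: "E t1 = 0" by simp
    have X1: "X t1 i > 0" if "i \<in> \<sigma>" for i
      by (rule Xpos[OF t1'(1) that]) (use Epos Et1 in auto)
    \<comment> \<open>At \<open>t1\<close>, where \<open>E\<close> vanishes, half of the squared
      \<open>X\<close> leaves enough room for the bound to persist slightly to the left, where the
      volume estimate is applied.\<close>
    define \<delta> where "\<delta> = Min ((\<lambda>i. (X t1 i)\<^sup>2 / 2) ` \<sigma>)"
    have "\<sigma> \<noteq> {}" using card by auto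
    then have \<delta>: "\<delta> > 0" unfolding \<delta>_def using fin X1 by (subst Min_gr_iff) (auto simp: less_imp_neq[symmetric])
    have \<delta>le: "\<delta> < (X t1 i)\<^sup>2 - E t1" if "i \<in> \<sigma>" for i
    proof -
      have "\<delta> \<le> (X t1 i)\<^sup>2 / 2" unfolding \<delta>_def using fin that by (intro Min_le) auto
      also have "\<dots> < (X t1 i)\<^sup>2" using X1[OF that] by simp
      finally show ?thesis using Et1 by simp
    qed
    have Xlim: "((\<lambda>t. X t i) \<longlongrightarrow> X t1 i) (at_left t1)" if "i \<in> \<sigma>" for i
      using contX[OF t1'(1) that] unfolding continuous_at by (rule tendsto_within_subset) auto
    have "\<forall>\<^sub>F t in at_left t1. \<forall>i\<in>\<sigma>. \<delta> < (X t i)\<^sup>2 - E t"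
      by (intro eventually_ball_finite fin ballI order_tendstoD(1)[OF tendsto_diff[OF tendsto_power[OF Xlim] Elim]] \<delta>le)
    moreover have "\<forall>\<^sub>F t in at_left t1. \<forall>i\<in>\<sigma>. 0 < X t i"
      by (intro eventually_ball_finite fin ballI order_tendstoD(1)[OF Xlim] X1)
    ultimately have "\<forall>\<^sub>F t in at_left t1. f 0 + t * g 0 \<le>
        2 * (16 * (\<integral>x. exp (- x\<^sup>2) \<partial>halfline) ^ 4 / \<delta>\<^sup>2 * (E t * sqrt (E t)))"
      using ev
    proof eventually_elim
      case (elim t)
      have "t \<in> {0..1}" using elim t1' by auto
      then have "f 0 + t * g 0 \<le> f t" using elim Epos by (intro tangent) auto
      also have "\<dots> \<le> 2 * (16 * (\<integral>x. exp (- x\<^sup>2) \<partial>halfline) ^ 4 / \<delta>\<^sup>2 * (E t * sqrt (E t)))"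
        unfolding f_def k_def line_kappa_def E_def line_E_def
        using elim \<delta> Epos[of t] by (intro mult_left_mono pack_vol_degenerate_bound[OF card]) (auto simp: X_def E_def line_E_def less_imp_le)
      finally show ?case .
    qed
    moreover have "((\<lambda>t. 2 * (16 * (\<integral>x. exp (- x\<^sup>2) \<partial>halfline) ^ 4 / \<delta>\<^sup>2 * (E t * sqrt (E t)))) \<longlongrightarrow>
        2 * (16 * (\<integral>x. exp (- x\<^sup>2) \<partial>halfline) ^ 4 / \<delta>\<^sup>2 * (E t1 * sqrt (E t1)))) (at_left t1)"
      by (intro tendsto_intros Elim)
    moreover have "((\<lambda>t. f 0 + t * g 0) \<longlongrightarrow> f 0 + t1 * g 0) (at_left t1)"
      by (intro tendsto_intros)
    \<comment> \<open>The limit of the tangent inequality as \<open>t\<close> tends to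
      \<open>t1\<close>: the bound on the volume tends to 0 with \<open>E\<close>.\<close>
    ultimately have le0: "f 0 + t1 * g 0 \<le> 0"
      using tendsto_le[of "at_left t1"] Et1 by fastforce
    \<comment> \<open>As the initial volume is nonnegative, the slope \<open>g 0\<close> is
      nonpositive. Continuing the tangent from \<open>t1\<close> to 1 can only lower it, so it stays
      below the nonnegative volume at the end.\<close>
    have f0: "0 \<le> f 0" "0 \<le> f 1" unfolding f_def k0 k1 using pack_vol_nonneg Q0 Q1 by auto
    then have "t1 * g 0 \<le> 0" using le0 by linarith
    then have "g 0 \<le> 0" using t1_pos by (simp add: mult_le_0_iff)
    then have "g 0 \<le> t1 * g 0" using t1' by (simp add: mult_le_cancel_right1)
    then show ?thesis using le0 f0 by linarith
  qed
  have c: "2 * (\<Sum>j\<in>\<sigma> - {i}. \<psi> j) = pack_solid \<sigma> \<kappa>1 i - pack_solid \<sigma> \<kappa>0 i" for i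
    by (simp add: pack_solid_def \<psi>_def sum_subtractf)
  have "g 0 = (\<Sum>i\<in>\<sigma>. arcoth (\<kappa>0 i) * pack_solid \<sigma> \<kappa>0 i) - (\<Sum>i\<in>\<sigma>. arcoth (\<kappa>0 i) * pack_solid \<sigma> \<kappa>1 i)"
    unfolding g_def c k0 by (simp add: right_diff_distrib sum_subtractf)
  then show ?thesis using main unfolding f_def k0 k1 by linarith
qed

section \<open>Packing tetrahedra in the Klein model\<close>

text \<open>The matrix of \<open>pack_form\<close>. Multiplied by the hyperbolic sines of the two
  radii, it becomes the matrix of hyperbolic cosines of the distances, with ones on the
  diagonal.\<close>

definition pack_gram :: "('i \<Rightarrow> real) \<Rightarrow> 'i \<Rightarrow> 'i \<Rightarrow> real" where
  "pack_gram \<kappa> i j = (if i = j then (\<kappa> i)\<^sup>2 - 1 else \<kappa> i * \<kappa> j + 1)"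

lemma coth_gt_1: "0 < x \<Longrightarrow> 1 < coth x"
  using sinh_less_cosh_real[of x] by (simp add: coth_def)

lemma coth_square: "0 < x \<Longrightarrow> (coth x)\<^sup>2 - 1 = 1 / (sinh x)\<^sup>2"
  using hyperbolic_pythagoras[of x] by (simp add: coth_def power_divide diff_divide_eq_iff) (simp add: field_simps)

lemma arcoth_coth:
  assumes "0 < x" shows "arcoth (coth x) = x"
proof -
  have s: "sinh x > 0" using assms by simp
  have "(coth x + 1) / (coth x - 1) = (cosh x + sinh x) / (cosh x - sinh x)"
    using s sinh_less_cosh_real[of x] by (simp add: coth_def field_simps)
  also have "\<dots> = exp x / exp (- x)" by (simp only: cosh_plus_sinh cosh_minus_sinh)
  also have "\<dots> = exp (2 * x)" by (simp flip: exp_diff)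
  finally show ?thesis by (simp add: arcoth_def)
qed

lemma cosh_add_coth:
  assumes "0 < x" "0 < y"
  shows "cosh (x + y) = sinh x * sinh y * (coth x * coth y + 1)"
  using assms by (simp add: coth_def cosh_add field_simps)

text \<open>The reversed Cauchy-Schwarz inequality for the timelike vectors (1, x) and (1, y) of
  Minkowski space. It puts the argument of \<open>arcosh\<close> in \<open>hyp_dist\<close> into the
  range where \<open>cosh\<close> inverts it.\<close>

lemma klein_product_ge:
  fixes x y :: "'a::real_inner"
  assumes "x \<bullet> x < 1" "y \<bullet> y < 1"
  shows "sqrt (1 - x \<bullet> x) * sqrt (1 - y \<bullet> y) \<le> 1 - x \<bullet> y"
proof -
  have n: "norm x < 1" "norm y < 1" using assms by (simp_all add: norm_eq_sqrt_inner)
  have "norm x * norm y \<le> 1 * 1" using n by (intro mult_mono) auto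
  then have nn: "norm x * norm y \<le> 1" by simp
  have "0 \<le> (norm x - norm y)\<^sup>2" by simp
  then have "(1 - x \<bullet> x) * (1 - y \<bullet> y) \<le> (1 - norm x * norm y)\<^sup>2"
    by (simp add: dot_square_norm power2_eq_square algebra_simps)
  then have "sqrt ((1 - x \<bullet> x) * (1 - y \<bullet> y)) \<le> 1 - norm x * norm y"
    using nn by (intro real_le_lsqrt) auto
  also have "\<dots> \<le> 1 - x \<bullet> y" using norm_cauchy_schwarz[of x y] by simp
  finally show ?thesis by (simp add: real_sqrt_mult)
qed

lemma hyp_space_inner: "x \<in> hyp_space \<longleftrightarrow> x \<bullet> x < 1"
  by (simp add: hyp_space_def norm_eq_sqrt_inner)

text \<open>Prescribed distances fix the Minkowski products of the vertices up to the scaling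
  \<open>\<rho>\<close>. Angles and volume will turn out to be independent of \<open>\<rho>\<close>,
  hence of the tetrahedron chosen.\<close>

lemma packing_tetrahedron_gram:
  assumes r: "\<And>i. i \<in> \<sigma> \<Longrightarrow> 0 < r $ i" and p: "packing_tetrahedron r \<sigma> p"
  obtains \<rho> where "\<And>i. i \<in> \<sigma> \<Longrightarrow> 0 < \<rho> i"
    "\<And>i j. i \<in> \<sigma> \<Longrightarrow> j \<in> \<sigma> \<Longrightarrow> 1 - p i \<bullet> p j = \<rho> i * \<rho> j * pack_gram (\<lambda>i. coth (r $ i)) i j"
proof
  define \<rho> where "\<rho> i = sqrt (1 - p i \<bullet> p i) * sinh (r $ i)" for i
  have inside: "p i \<bullet> p i < 1" if "i \<in> \<sigma>" for i
    using p that by (auto simp: packing_tetrahedron_def hyp_space_inner)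
  show "0 < \<rho> i" if "i \<in> \<sigma>" for i using inside[OF that] r[OF that] by (simp add: \<rho>_def)
  fix i j assume ij: "i \<in> \<sigma>" "j \<in> \<sigma>"
  show "1 - p i \<bullet> p j = \<rho> i * \<rho> j * pack_gram (\<lambda>i. coth (r $ i)) i j"
  proof (cases "i = j")
    case True
    have "\<rho> i * \<rho> i = (1 - p i \<bullet> p i) * (sinh (r $ i))\<^sup>2"
      using inside[OF ij(1)] by (simp add: \<rho>_def power2_eq_square)
    moreover have "sinh (r $ i) \<noteq> 0" using r[OF ij(1)] by simp
    ultimately show ?thesis using True coth_square[OF r[OF ij(1)]] by (simp add: pack_gram_def)
  next
    case False
    let ?s = "sqrt (1 - p i \<bullet> p i) * sqrt (1 - p j \<bullet> p j)"
    have s: "?s > 0" using inside ij by simp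
    have "arcosh ((1 - p i \<bullet> p j) / ?s) = r $ i + r $ j"
      using p ij False by (auto simp: packing_tetrahedron_def hyp_dist_def)
    moreover have "1 \<le> (1 - p i \<bullet> p j) / ?s"
      using klein_product_ge[OF inside[OF ij(1)] inside[OF ij(2)]] s by simp
    ultimately have "(1 - p i \<bullet> p j) / ?s = cosh (r $ i + r $ j)" by (metis cosh_arcosh_real)
    then have "1 - p i \<bullet> p j = ?s * cosh (r $ i + r $ j)" using s
      by (metis less_irrefl mult.commute nonzero_eq_divide_eq)
    then show ?thesis using False cosh_add_coth[OF r[OF ij(1)] r[OF ij(2)]]
      by (simp add: \<rho>_def pack_gram_def mult_ac)
  qed
qed

lemma klein_metric_linear:
  "klein_metric x (u - c *\<^sub>R w) v = klein_metric x u v - c * klein_metric x w v"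
  "klein_metric x v (u - c *\<^sub>R w) = klein_metric x v u - c * klein_metric x v w"
  unfolding klein_metric_def inner_diff_left inner_diff_right inner_scaleR_left inner_scaleR_right
  by (simp_all add: diff_divide_distrib algebra_simps)

lemma klein_metric_commute: "klein_metric x u v = klein_metric x v u"
  by (simp add: klein_metric_def inner_commute)

lemma klein_metric_orth:
  assumes "klein_metric x w w \<noteq> 0"
  shows "klein_metric x (orth_component x w u) (orth_component x w v)
    = klein_metric x u v - klein_metric x u w * klein_metric x v w / klein_metric x w w"
  unfolding orth_component_def klein_metric_linear
  using assms klein_metric_commute[of x w u] klein_metric_commute[of x w v] by (simp add: field_simps)

text \<open>Expresses the metric at a vertex through the Minkowski products
  \<open>1 - x \<bullet> y\<close> alone; the numerator has the shape of a Schur complement.\<close>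

lemma klein_metric_gram:
  assumes "1 - a \<bullet> a \<noteq> 0"
  shows "klein_metric a (x - a) (y - a) = ((1 - a \<bullet> x) * (1 - a \<bullet> y) - (1 - a \<bullet> a) * (1 - x \<bullet> y)) / (1 - a \<bullet> a)\<^sup>2"
proof -
  have "klein_metric a (x - a) (y - a) = ((1 - a \<bullet> a) * ((x - a) \<bullet> (y - a)) + (a \<bullet> (x - a)) * (a \<bullet> (y - a))) / (1 - a \<bullet> a)\<^sup>2"
    unfolding klein_metric_def using assms by (simp add: power2_eq_square add_divide_distrib)
  also have "(1 - a \<bullet> a) * ((x - a) \<bullet> (y - a)) + (a \<bullet> (x - a)) * (a \<bullet> (y - a)) =
      (1 - a \<bullet> x) * (1 - a \<bullet> y) - (1 - a \<bullet> a) * (1 - x \<bullet> y)"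
    by (simp add: inner_diff_left inner_diff_right inner_commute algebra_simps)
  finally show ?thesis .
qed

text \<open>The Schur complement of the Gram matrix with respect to \<open>a\<close>, multiplied by \<open>- pack_gram \<kappa> a a\<close>.\<close>

definition schur :: "('i \<Rightarrow> real) \<Rightarrow> 'i \<Rightarrow> 'i \<Rightarrow> 'i \<Rightarrow> real" where
  "schur \<kappa> a x y = pack_gram \<kappa> a x * pack_gram \<kappa> a y - pack_gram \<kappa> a a * pack_gram \<kappa> x y"

lemma schur_commute: "schur \<kappa> a x y = schur \<kappa> a y x"
  by (simp add: schur_def pack_gram_def mult.commute)

lemma schur_diag: "a \<noteq> x \<Longrightarrow> schur \<kappa> a x x = (\<kappa> a + \<kappa> x)\<^sup>2"
  by (simp add: schur_def pack_gram_def power2_eq_square algebra_simps)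

text \<open>By Sylvester's identity a 2 by 2 minor of this rescaled Schur complement is the pivot
  \<open>(\<kappa> a)\<^sup>2 - 1\<close> times a 3 by 3 minor of the Gram matrix. The minor is the
  numerator of the cosine of the dihedral angle at the edge ab; the next lemma gives the
  denominators.\<close>

lemma schur_off_minor:
  assumes "distinct [a, b, c, d]"
  shows "schur \<kappa> a b b * schur \<kappa> a c d - schur \<kappa> a c b * schur \<kappa> a d b
    = ((\<kappa> a)\<^sup>2 - 1) * (pack_Q {a, b, c, d} \<kappa> - 4 * pack_w {a, b, c, d} \<kappa> c * pack_w {a, b, c, d} \<kappa> d)"
proof -
  have "a \<noteq> b" "a \<noteq> c" "a \<noteq> d" "b \<noteq> c" "b \<noteq> d" "c \<noteq> d" "c \<noteq> b" "d \<noteq> b" "d \<noteq> c" using assms by auto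
  then show ?thesis
    unfolding schur_def pack_Q_def pack_w_def sum_distinct4[OF assms] pack_gram_def
    by (simp add: power2_eq_square field_simps)
qed

lemma schur_minor:
  assumes "distinct [a, b, c, d]"
  shows "schur \<kappa> a b b * schur \<kappa> a c c - schur \<kappa> a c b * schur \<kappa> a c b
    = ((\<kappa> a)\<^sup>2 - 1) * (pack_Q {a, b, c, d} \<kappa> + 4 * (pack_w {a, b, c, d} \<kappa> d)\<^sup>2)"
proof -
  have "a \<noteq> b" "a \<noteq> c" "a \<noteq> d" "b \<noteq> c" "b \<noteq> d" "c \<noteq> d" "c \<noteq> b" "d \<noteq> b" "d \<noteq> c" using assms by auto
  then show ?thesis
    unfolding schur_def pack_Q_def pack_w_def sum_distinct4[OF assms] pack_gram_def
    by (simp add: power2_eq_square field_simps)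
qed

lemma cos_add_arctan:
  "cos (arctan x + arctan y) = (1 - x * y) / (sqrt (1 + x\<^sup>2) * sqrt (1 + y\<^sup>2))"
  by (simp add: cos_add cos_arctan sin_arctan diff_divide_distrib)

text \<open>Dividing by Q turns the quotient into the cosine of a sum of two arctangents. The sign
  condition places that sum between 0 and pi, where \<open>arccos\<close> inverts the
  cosine.\<close>

lemma pack_angle_pair:
  assumes Q: "pack_Q \<sigma> \<kappa> > 0" and pos: "pack_w \<sigma> \<kappa> x + pack_w \<sigma> \<kappa> y > 0"
  shows "arccos ((pack_Q \<sigma> \<kappa> - 4 * pack_w \<sigma> \<kappa> x * pack_w \<sigma> \<kappa> y) /
      (sqrt (pack_Q \<sigma> \<kappa> + 4 * (pack_w \<sigma> \<kappa> x)\<^sup>2) * sqrt (pack_Q \<sigma> \<kappa> + 4 * (pack_w \<sigma> \<kappa> y)\<^sup>2)))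
    = pack_angle \<sigma> \<kappa> x + pack_angle \<sigma> \<kappa> y"
proof -
  define q where "q = sqrt (pack_Q \<sigma> \<kappa>)"
  have q: "q > 0" "pack_Q \<sigma> \<kappa> = q * q" using Q by (simp_all add: q_def)
  let ?X = "2 * pack_w \<sigma> \<kappa> x / q" and ?Y = "2 * pack_w \<sigma> \<kappa> y / q"
  have s: "sqrt (q * q + 4 * v\<^sup>2) = q * sqrt (1 + (2 * v / q)\<^sup>2)" for v
  proof -
    have "q * q + 4 * v\<^sup>2 = q\<^sup>2 * (1 + (2 * v / q)\<^sup>2)"
      using q(1) by (simp add: power2_eq_square field_simps)
    then show ?thesis using q(1) by (simp add: real_sqrt_mult)
  qed
  have n: "q * q - 4 * v * u = q * q * (1 - (2 * v / q) * (2 * u / q))" for v u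
    using q(1) by (simp add: field_simps)
  have "(pack_Q \<sigma> \<kappa> - 4 * pack_w \<sigma> \<kappa> x * pack_w \<sigma> \<kappa> y) /
      (sqrt (pack_Q \<sigma> \<kappa> + 4 * (pack_w \<sigma> \<kappa> x)\<^sup>2) * sqrt (pack_Q \<sigma> \<kappa> + 4 * (pack_w \<sigma> \<kappa> y)\<^sup>2))
     = (q * q * (1 - ?X * ?Y)) / (q * q * (sqrt (1 + ?X\<^sup>2) * sqrt (1 + ?Y\<^sup>2)))"
    unfolding q(2) n s by (simp only: mult_ac)
  also have "\<dots> = cos (pack_angle \<sigma> \<kappa> x + pack_angle \<sigma> \<kappa> y)"
    unfolding pack_angle_def q_def[symmetric] cos_add_arctan using q(1) by simp
  finally have eq: "(pack_Q \<sigma> \<kappa> - 4 * pack_w \<sigma> \<kappa> x * pack_w \<sigma> \<kappa> y) /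
      (sqrt (pack_Q \<sigma> \<kappa> + 4 * (pack_w \<sigma> \<kappa> x)\<^sup>2) * sqrt (pack_Q \<sigma> \<kappa> + 4 * (pack_w \<sigma> \<kappa> y)\<^sup>2))
     = cos (pack_angle \<sigma> \<kappa> x + pack_angle \<sigma> \<kappa> y)" .
  have "0 < (2 * pack_w \<sigma> \<kappa> x + 2 * pack_w \<sigma> \<kappa> y) / q" using pos q(1) by simp
  then have "- ?X < ?Y" unfolding add_divide_distrib by linarith
  then have "arctan (- ?X) < arctan ?Y" by (simp only: arctan_less_iff)
  then have "0 \<le> pack_angle \<sigma> \<kappa> x + pack_angle \<sigma> \<kappa> y" by (simp add: pack_angle_def q_def arctan_minus)
  moreover have "pack_angle \<sigma> \<kappa> x + pack_angle \<sigma> \<kappa> y \<le> pi"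
    using pack_angle_bound[of \<sigma> \<kappa> x] pack_angle_bound[of \<sigma> \<kappa> y] by linarith
  ultimately show ?thesis unfolding eq by (rule arccos_cos)
qed

text \<open>Projecting orthogonally to the edge is a second elimination step, so the cosine becomes
  a quotient of minors of the Schur complement; the scalings \<open>\<rho>\<close> and the pivot
  cancel.\<close>

lemma hyp_dihedral_pack:
  fixes p :: "'i \<Rightarrow> real^3" and \<kappa> \<rho> :: "'i \<Rightarrow> real"
  assumes \<sigma>: "\<sigma> = {a, b, c, d}" and dist: "distinct [a, b, c, d]"
    and gt: "\<forall>i\<in>\<sigma>. 1 < \<kappa> i" and Q: "pack_Q \<sigma> \<kappa> > 0"
    and \<rho>: "\<And>i. i \<in> \<sigma> \<Longrightarrow> 0 < \<rho> i"
    and gram: "\<And>i j. i \<in> \<sigma> \<Longrightarrow> j \<in> \<sigma> \<Longrightarrow> 1 - p i \<bullet> p j = \<rho> i * \<rho> j * pack_gram \<kappa> i j"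
  shows "hyp_dihedral (p a) (p b) (p c) (p d) = pack_angle \<sigma> \<kappa> c + pack_angle \<sigma> \<kappa> d"
proof -
  have mem: "a \<in> \<sigma>" "b \<in> \<sigma>" "c \<in> \<sigma>" "d \<in> \<sigma>" by (simp_all add: \<sigma>)
  have k: "\<kappa> a > 1" "\<kappa> b > 1" "\<kappa> c > 1" "\<kappa> d > 1" using gt mem by auto
  define Ea where "Ea = (\<kappa> a)\<^sup>2 - 1"
  have Ea: "Ea > 0" using one_less_power[OF k(1), of 2] by (simp add: Ea_def)
  define N where "N = 1 - p a \<bullet> p a"
  have N: "N = \<rho> a * \<rho> a * Ea" using gram[OF mem(1) mem(1)] by (simp add: N_def pack_gram_def Ea_def)
  have Npos: "N > 0" unfolding N using \<rho> mem Ea by simp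
  define C where "C = (\<rho> a)\<^sup>2 / N\<^sup>2"
  have C: "C > 0" using Npos \<rho>[OF mem(1)] by (simp add: C_def)
  define M where "M = schur \<kappa> a"
  have g: "klein_metric (p a) (p x - p a) (p y - p a) = C * (\<rho> x * \<rho> y) * M x y" if "x \<in> \<sigma>" "y \<in> \<sigma>" for x y
  proof -
    have "klein_metric (p a) (p x - p a) (p y - p a) = ((1 - p a \<bullet> p x) * (1 - p a \<bullet> p y) - N * (1 - p x \<bullet> p y)) / N\<^sup>2"
      using klein_metric_gram[of "p a" "p x" "p y"] Npos by (simp add: N_def)
    also have "(1 - p a \<bullet> p x) * (1 - p a \<bullet> p y) - N * (1 - p x \<bullet> p y) = (\<rho> a)\<^sup>2 * (\<rho> x * \<rho> y) * M x y"
      unfolding N gram[OF mem(1) that(1)] gram[OF mem(1) that(2)] gram[OF that] M_def schur_def Ea_def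
      by (simp add: pack_gram_def power2_eq_square algebra_simps)
    finally show ?thesis by (simp add: C_def)
  qed
  have Mbb: "M b b > 0" unfolding M_def using dist k by (subst schur_diag) auto
  define D where "D = C / M b b"
  have D: "D > 0" using C Mbb by (simp add: D_def)
  have gbb: "klein_metric (p a) (p b - p a) (p b - p a) \<noteq> 0"
    unfolding g[OF mem(2) mem(2)] using C Mbb \<rho>[OF mem(2)] by simp
  have orth: "klein_metric (p a) (orth_component (p a) (p b - p a) (p x - p a)) (orth_component (p a) (p b - p a) (p y - p a))
      = D * (\<rho> x * \<rho> y) * (M b b * M x y - M x b * M y b)" if "x \<in> \<sigma>" "y \<in> \<sigma>" for x y
  proof -
    have "C * (\<rho> x * \<rho> y) * M x y - (C * (\<rho> x * \<rho> b) * M x b) * (C * (\<rho> y * \<rho> b) * M y b) / (C * (\<rho> b * \<rho> b) * M b b)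
      = D * (\<rho> x * \<rho> y) * (M b b * M x y - M x b * M y b)"
      using C Mbb \<rho>[OF mem(2)] by (simp add: D_def field_simps)
    then show ?thesis unfolding klein_metric_orth[OF gbb] g[OF that] g[OF that(1) mem(2)] g[OF that(2) mem(2)] g[OF mem(2) mem(2)] .
  qed
  have dist': "distinct [a, b, d, c]" and \<sigma>': "\<sigma> = {a, b, d, c}" using dist \<sigma> by auto
  have m1: "M b b * M c d - M c b * M d b = Ea * (pack_Q \<sigma> \<kappa> - 4 * pack_w \<sigma> \<kappa> c * pack_w \<sigma> \<kappa> d)"
    unfolding M_def Ea_def \<sigma> by (rule schur_off_minor[OF dist])
  have m2: "M b b * M c c - M c b * M c b = Ea * (pack_Q \<sigma> \<kappa> + 4 * (pack_w \<sigma> \<kappa> d)\<^sup>2)"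
    unfolding M_def Ea_def \<sigma> by (rule schur_minor[OF dist])
  have m3: "M b b * M d d - M d b * M d b = Ea * (pack_Q \<sigma> \<kappa> + 4 * (pack_w \<sigma> \<kappa> c)\<^sup>2)"
    unfolding M_def Ea_def \<sigma>' by (rule schur_minor[OF dist'])
  have sq: "sqrt (D * (\<rho> x * \<rho> x) * (Ea * y)) = sqrt (D * Ea) * \<rho> x * sqrt y" if "x \<in> \<sigma>" for x y
  proof -
    have "sqrt (D * (\<rho> x * \<rho> x) * (Ea * y)) = sqrt ((D * Ea) * (\<rho> x * \<rho> x) * y)" by (simp only: mult_ac)
    then show ?thesis using \<rho>[OF that] by (simp only: real_sqrt_mult real_sqrt_mult_self abs_of_pos)
  qed
  have "D * Ea > 0" using D Ea by simp
  then have DE: "sqrt (D * Ea) * sqrt (D * Ea) = D * Ea" by simp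
  have "hyp_dihedral (p a) (p b) (p c) (p d) = arccos (D * (\<rho> c * \<rho> d) * (Ea * (pack_Q \<sigma> \<kappa> - 4 * pack_w \<sigma> \<kappa> c * pack_w \<sigma> \<kappa> d)) /
      ((sqrt (D * Ea) * \<rho> c * sqrt (pack_Q \<sigma> \<kappa> + 4 * (pack_w \<sigma> \<kappa> d)\<^sup>2)) * (sqrt (D * Ea) * \<rho> d * sqrt (pack_Q \<sigma> \<kappa> + 4 * (pack_w \<sigma> \<kappa> c)\<^sup>2))))"
    unfolding hyp_dihedral_def hyp_angle_def orth[OF mem(3) mem(4)] orth[OF mem(3) mem(3)] orth[OF mem(4) mem(4)] m1 m2 m3 sq[OF mem(3)] sq[OF mem(4)] ..
  also have "D * (\<rho> c * \<rho> d) * (Ea * (pack_Q \<sigma> \<kappa> - 4 * pack_w \<sigma> \<kappa> c * pack_w \<sigma> \<kappa> d)) /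
      ((sqrt (D * Ea) * \<rho> c * sqrt (pack_Q \<sigma> \<kappa> + 4 * (pack_w \<sigma> \<kappa> d)\<^sup>2)) * (sqrt (D * Ea) * \<rho> d * sqrt (pack_Q \<sigma> \<kappa> + 4 * (pack_w \<sigma> \<kappa> c)\<^sup>2)))
    = ((D * Ea * (\<rho> c * \<rho> d)) * (pack_Q \<sigma> \<kappa> - 4 * pack_w \<sigma> \<kappa> c * pack_w \<sigma> \<kappa> d)) /
      ((sqrt (D * Ea) * sqrt (D * Ea) * (\<rho> c * \<rho> d)) * (sqrt (pack_Q \<sigma> \<kappa> + 4 * (pack_w \<sigma> \<kappa> c)\<^sup>2) * sqrt (pack_Q \<sigma> \<kappa> + 4 * (pack_w \<sigma> \<kappa> d)\<^sup>2)))"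
    by (simp only: mult_ac)
  also have "\<dots> = (pack_Q \<sigma> \<kappa> - 4 * pack_w \<sigma> \<kappa> c * pack_w \<sigma> \<kappa> d) /
      (sqrt (pack_Q \<sigma> \<kappa> + 4 * (pack_w \<sigma> \<kappa> c)\<^sup>2) * sqrt (pack_Q \<sigma> \<kappa> + 4 * (pack_w \<sigma> \<kappa> d)\<^sup>2))"
    unfolding DE using \<open>D * Ea > 0\<close> \<rho>[OF mem(3)] \<rho>[OF mem(4)] by (intro mult_divide_mult_cancel_left) auto
  also have "arccos \<dots> = pack_angle \<sigma> \<kappa> c + pack_angle \<sigma> \<kappa> d"
  proof (rule pack_angle_pair[OF Q])
    show "0 < pack_w \<sigma> \<kappa> c + pack_w \<sigma> \<kappa> d"
      using k unfolding pack_w_def \<sigma> sum_distinct4[OF dist] by (simp add: field_simps)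
  qed
  finally show ?thesis .
qed

section \<open>Construction of a packing tetrahedron\<close>

lemma cholesky3:
  fixes m11 m12 m13 m22 m23 m33 :: real
  assumes "m11 > 0" and A: "m11 * m22 - m12 * m12 > 0"
    and det: "(m11 * m22 - m12 * m12) * (m11 * m33 - m13 * m13) - (m11 * m23 - m12 * m13)\<^sup>2 > 0"
  obtains x1 y1 y2 z1 z2 z3 where "x1 > 0" "y2 > 0" "z3 > 0" "x1 * x1 = m11" "x1 * y1 = m12" "x1 * z1 = m13"
    "y1 * y1 + y2 * y2 = m22" "y1 * z1 + y2 * z2 = m23" "z1 * z1 + z2 * z2 + z3 * z3 = m33"
proof -
  define x1 where "x1 = sqrt m11"
  define y2 where "y2 = sqrt ((m11 * m22 - m12 * m12) / m11)"
  \<comment> \<open>The numerator is \<open>m11\<close> times the determinant, by Sylvester's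
    identity, so this is the last Cholesky pivot.\<close>
  define z3 where "z3 = sqrt (((m11 * m22 - m12 * m12) * (m11 * m33 - m13 * m13) - (m11 * m23 - m12 * m13)\<^sup>2) / (m11 * (m11 * m22 - m12 * m12)))"
  define y1 where "y1 = m12 / x1"
  define z1 where "z1 = m13 / x1"
  define z2 where "z2 = (m23 - y1 * z1) / y2"
  have x1: "x1 > 0" "x1 * x1 = m11" using assms by (simp_all add: x1_def)
  have y2: "y2 > 0" "y2 * y2 = (m11 * m22 - m12 * m12) / m11" using assms by (simp_all add: y2_def)
  have z3: "z3 > 0" "z3 * z3 = ((m11 * m22 - m12 * m12) * (m11 * m33 - m13 * m13) - (m11 * m23 - m12 * m13)\<^sup>2) / (m11 * (m11 * m22 - m12 * m12))"
    using assms by (simp_all add: z3_def)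
  have p: "y1 * y1 = m12 * m12 / m11" "y1 * z1 = m12 * m13 / m11" "z1 * z1 = m13 * m13 / m11"
    unfolding y1_def z1_def x1(2)[symmetric] by simp_all
  have z2: "z2 * z2 = (m11 * m23 - m12 * m13)\<^sup>2 / (m11 * (m11 * m22 - m12 * m12))"
  proof -
    have "z2 * z2 = (m23 - y1 * z1)\<^sup>2 / (y2 * y2)" by (simp add: z2_def power2_eq_square)
    also have "m23 - y1 * z1 = (m11 * m23 - m12 * m13) / m11" unfolding p using assms(1) by (simp add: field_simps)
    finally show ?thesis unfolding y2(2) using assms(1) A by (simp add: power_divide power2_eq_square)
  qed
  show ?thesis
  proof
    show "x1 > 0" "y2 > 0" "z3 > 0" "x1 * x1 = m11" by fact+
    show "x1 * y1 = m12" "x1 * z1 = m13" using x1 by (simp_all add: y1_def z1_def)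
    show "y1 * y1 + y2 * y2 = m22" unfolding p y2(2) using assms(1) by (simp add: field_simps)
    show "y1 * z1 + y2 * z2 = m23" using y2(1) by (simp add: z2_def)
    have "z2 * z2 + z3 * z3 = (m11 * m33 - m13 * m13) / m11"
      unfolding z2 z3(2) add_divide_distrib[symmetric] using A assms(1) by simp
    then show "z1 * z1 + z2 * z2 + z3 * z3 = m33" unfolding p(3) using assms(1) by (simp add: field_simps)
  qed
qed

text \<open>With the vertex \<open>a\<close> at the origin, the products of the other vertices are
  prescribed by the Schur complement. It is positive definite, so a Cholesky factor provides three
  vectors, which a rescaling moves into the Klein ball.\<close>

lemma packing_tetrahedron_exists:
  fixes r :: "real^'n::finite"
  assumes card: "card \<sigma> = 4" and r: "\<And>i. i \<in> \<sigma> \<Longrightarrow> 0 < r $ i" and Q: "Q_form r \<sigma> > 0"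
  shows "\<exists>p. packing_tetrahedron r \<sigma> p"
proof -
  obtain a b c d where \<sigma>: "\<sigma> = {a, b, c, d}" and dist: "distinct [a, b, c, d]" using card_4_obtain[OF card] .
  have mem: "a \<in> \<sigma>" "b \<in> \<sigma>" "c \<in> \<sigma>" "d \<in> \<sigma>" by (simp_all add: \<sigma>)
  have ne: "a \<noteq> b" "a \<noteq> c" "a \<noteq> d" "b \<noteq> c" "b \<noteq> d" "c \<noteq> d" "b \<noteq> a" "c \<noteq> a" "d \<noteq> a" "c \<noteq> b" "d \<noteq> b" "d \<noteq> c" using dist by auto
  define \<kappa> where "\<kappa> i = coth (r $ i)" for i
  have k: "\<kappa> i > 1" if "i \<in> \<sigma>" for i using coth_gt_1[OF r[OF that]] by (simp add: \<kappa>_def)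
  have Q': "pack_Q \<sigma> \<kappa> > 0" using Q by (simp add: Q_form_def pack_Q_def \<kappa>_def)
  define E where "E i = (\<kappa> i)\<^sup>2 - 1" for i
  have E: "E i > 0" if "i \<in> \<sigma>" for i using one_less_power[OF k[OF that], of 2] by (simp add: E_def)
  define M where "M = schur \<kappa> a"
  define w where "w = pack_w \<sigma> \<kappa>"
  define q where "q = pack_Q \<sigma> \<kappa>"
  have dist': "distinct [a, b, d, c]" and \<sigma>': "\<sigma> = {a, b, d, c}" using dist \<sigma> by auto
  have m1: "M b b * M c d - M b c * M b d = E a * (q - 4 * w c * w d)"
    unfolding M_def E_def \<sigma> w_def q_def schur_commute[of \<kappa> a b c] schur_commute[of \<kappa> a b d] by (rule schur_off_minor[OF dist])
  have m2: "M b b * M c c - M b c * M b c = E a * (q + 4 * (w d)\<^sup>2)"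
    unfolding M_def E_def \<sigma> w_def q_def schur_commute[of \<kappa> a b c] by (rule schur_minor[OF dist])
  have m3: "M b b * M d d - M b d * M b d = E a * (q + 4 * (w c)\<^sup>2)"
    unfolding M_def E_def \<sigma>' w_def q_def schur_commute[of \<kappa> a b d] by (rule schur_minor[OF dist'])
  have q: "q > 0" using Q' by (simp add: q_def)
  have Mbb: "M b b > 0" unfolding M_def using ne k[OF mem(1)] k[OF mem(2)] by (subst schur_diag) auto
  have A: "M b b * M c c - M b c * M b c > 0" unfolding m2 using E[OF mem(1)] q by (intro mult_pos_pos add_pos_nonneg) auto
  \<comment> \<open>This determinant contains the factor \<open>q\<close>; here positivity of Q
    decides that the tetrahedron is non-degenerate.\<close>
  have det: "(M b b * M c c - M b c * M b c) * (M b b * M d d - M b d * M b d) - (M b b * M c d - M b c * M b d)\<^sup>2 > 0"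
  proof -
    have "(M b b * M c c - M b c * M b c) * (M b b * M d d - M b d * M b d) - (M b b * M c d - M b c * M b d)\<^sup>2
      = (E a)\<^sup>2 * (4 * q * (w c + w d)\<^sup>2)"
      unfolding m1 m2 m3 by (simp add: power2_eq_square algebra_simps)
    moreover have "w c + w d = \<kappa> a + \<kappa> b" unfolding w_def pack_w_def \<sigma> sum_distinct4[OF dist] by (simp add: field_simps)
    moreover have "\<kappa> a + \<kappa> b > 0" using k[OF mem(1)] k[OF mem(2)] by simp
    ultimately show ?thesis using E[OF mem(1)] q by simp
  qed
  obtain x1 y1 y2 z1 z2 z3 where pos: "x1 > 0" "y2 > 0" "z3 > 0" and eqs: "x1 * x1 = M b b" "x1 * y1 = M b c" "x1 * z1 = M b d"
    "y1 * y1 + y2 * y2 = M c c" "y1 * z1 + y2 * z2 = M c d" "z1 * z1 + z2 * z2 + z3 * z3 = M d d"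
    using cholesky3[OF Mbb A det] .
  define v :: "'n \<Rightarrow> real^3" where "v i = (if i = b then vector [x1, 0, 0] else if i = c then vector [y1, y2, 0]
    else if i = d then vector [z1, z2, z3] else 0)" for i
  define G where "G = pack_gram \<kappa>"
  \<comment> \<open>Since \<open>M i j = G a i * G a j - E a * G i j\<close>, dividing by
    \<open>G a i\<close> makes \<open>1 - p i \<bullet> p j\<close> a positive rescaling of the Gram
    matrix.\<close>
  define p :: "'n \<Rightarrow> real^3" where "p i = (1 / G a i) *\<^sub>R v i" for i
  have vv: "v i \<bullet> v j = M i j" if "i \<in> \<sigma>" "j \<in> \<sigma>" for i j
  proof -
    have M0: "M a x = 0" "M x a = 0" for x unfolding M_def schur_def by (simp_all add: pack_gram_def)
    have sym: "M x y = M y x" for x y unfolding M_def by (rule schur_commute)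
    have dot: "(vector [x, y, z] :: real^3) \<bullet> vector [x', y', z'] = x * x' + y * y' + z * z'" for x y z x' y' z'
      by (simp add: inner_vec_def sum_3)
    have v: "v a = 0" "v b = vector [x1, 0, 0]" "v c = vector [y1, y2, 0]" "v d = vector [z1, z2, z3]"
      using ne by (simp_all add: v_def)
    have t: "v b \<bullet> v b = M b b" "v b \<bullet> v c = M b c" "v b \<bullet> v d = M b d"
      "v c \<bullet> v c = M c c" "v c \<bullet> v d = M c d" "v d \<bullet> v d = M d d"
      unfolding v dot eqs[symmetric] by simp_all
    have t': "v c \<bullet> v b = M c b" "v d \<bullet> v b = M d b" "v d \<bullet> v c = M d c"
      unfolding inner_commute[of "v c" "v b"] inner_commute[of "v d" "v b"] inner_commute[of "v d" "v c"] t
      by (rule sym)+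
    show ?thesis using that unfolding \<sigma>
      by (elim insertE emptyE) (simp_all only: t t' v(1) M0 inner_zero_left inner_zero_right)
  qed
  have Gpos: "G i j > 0" if "i \<in> \<sigma>" "j \<in> \<sigma>" for i j
  proof -
    have "0 < \<kappa> i * \<kappa> j" using k[OF that(1)] k[OF that(2)] by (intro mult_pos_pos) auto
    then show ?thesis using E[OF that(1)] by (cases "i = j") (simp_all add: G_def pack_gram_def E_def)
  qed
  have gram: "1 - p i \<bullet> p j = E a * G i j / (G a i * G a j)" if "i \<in> \<sigma>" "j \<in> \<sigma>" for i j
  proof -
    have "p i \<bullet> p j = M i j / (G a i * G a j)" by (simp add: p_def vv[OF that])
    also have "\<dots> = 1 - E a * G i j / (G a i * G a j)"
    proof -
      have "M i j = G a i * G a j - E a * G i j"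
        by (simp add: M_def schur_def G_def pack_gram_def E_def)
      then show ?thesis
        using Gpos[OF mem(1) that(1)] Gpos[OF mem(1) that(2)] by (simp add: diff_divide_distrib)
    qed
    finally show ?thesis by simp
  qed
  have Gii: "G i i = E i" for i by (simp add: G_def pack_gram_def E_def)
  have inside: "p i \<in> hyp_space" if "i \<in> \<sigma>" for i
  proof -
    have "0 < 1 - p i \<bullet> p i" unfolding gram[OF that that] using E[OF mem(1)] Gpos that mem by simp
    then show ?thesis by (simp add: hyp_space_inner)
  qed
  have dist_eq: "hyp_dist (p i) (p j) = r $ i + r $ j" if ij: "i \<in> \<sigma>" "j \<in> \<sigma>" "i \<noteq> j" for i j
  proof -
    have Ei: "sqrt (E i) = 1 / sinh (r $ i)" if "i \<in> \<sigma>" for i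
      using coth_square[OF r[OF that]] r[OF that] by (simp add: E_def \<kappa>_def real_sqrt_divide)
    have s: "sqrt (1 - p x \<bullet> p x) = sqrt (E a) * sqrt (E x) / G a x" if "x \<in> \<sigma>" for x
      unfolding gram[OF that that] Gii using Gpos[OF mem(1) that] by (simp add: real_sqrt_divide real_sqrt_mult)
    have Ea: "sqrt (E a) * sqrt (E a) = E a" "sqrt (E a) > 0" using E[OF mem(1)] by simp_all
    have "(1 - p i \<bullet> p j) / (sqrt (1 - p i \<bullet> p i) * sqrt (1 - p j \<bullet> p j)) = G i j / (sqrt (E i) * sqrt (E j))"
    proof -
      have "(1 - p i \<bullet> p j) / (sqrt (1 - p i \<bullet> p i) * sqrt (1 - p j \<bullet> p j))
        = (E a / (G a i * G a j) * G i j) / (E a / (G a i * G a j) * (sqrt (E i) * sqrt (E j)))"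
      proof -
        have "sqrt (1 - p i \<bullet> p i) * sqrt (1 - p j \<bullet> p j) = (sqrt (E a) * sqrt (E a)) / (G a i * G a j) * (sqrt (E i) * sqrt (E j))"
          unfolding s[OF ij(1)] s[OF ij(2)] by (simp only: times_divide_times_eq times_divide_eq_left times_divide_eq_right divide_divide_eq_left mult_ac)
        then show ?thesis unfolding gram[OF ij(1,2)] Ea(1) by simp
      qed
      also have "\<dots> = G i j / (sqrt (E i) * sqrt (E j))"
        using E[OF mem(1)] Gpos[OF mem(1) ij(1)] Gpos[OF mem(1) ij(2)] by (intro mult_divide_mult_cancel_left) simp
      finally show ?thesis .
    qed
    also have "\<dots> = cosh (r $ i + r $ j)"
      unfolding Ei[OF ij(1)] Ei[OF ij(2)] cosh_add_coth[OF r[OF ij(1)] r[OF ij(2)]] using ij by (simp add: G_def pack_gram_def \<kappa>_def)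
    finally show ?thesis unfolding hyp_dist_def using r[OF ij(1)] r[OF ij(2)] by (simp add: arcosh_cosh_real)
  qed
  have inj: "inj_on p \<sigma>"
  proof (rule inj_onI, rule ccontr)
    fix i j assume ij: "i \<in> \<sigma>" "j \<in> \<sigma>" "p i = p j" "i \<noteq> j"
    have "p j \<bullet> p j < 1" using inside[OF ij(2)] by (simp add: hyp_space_inner)
    then have "hyp_dist (p i) (p j) = 0" using ij(3) by (simp add: hyp_dist_def)
    then show False using dist_eq[OF ij(1,2,4)] r[OF ij(1)] r[OF ij(2)] by simp
  qed
  have pa: "p a = 0" using ne by (simp add: p_def v_def)
  have "independent {p b, p c, p d}"
  proof (rule independent_if_scalars_zero)
    fix f x assume sum: "(\<Sum>x\<in>{p b, p c, p d}. f x *\<^sub>R x) = 0" and x: "x \<in> {p b, p c, p d}"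
    have pne: "p b \<noteq> p c" "p b \<noteq> p d" "p c \<noteq> p d" using inj ne mem by (auto dest: inj_onD)
    have s: "f (p b) *\<^sub>R p b + f (p c) *\<^sub>R p c + f (p d) *\<^sub>R p d = 0" using sum pne by (simp add: add.assoc)
    have g: "G a b > 0" "G a c > 0" "G a d > 0" using Gpos mem by auto
    have v: "v b = vector [x1, 0, 0]" "v c = vector [y1, y2, 0]" "v d = vector [z1, z2, z3]" using ne by (simp_all add: v_def)
    have d0: "f (p d) = 0" using arg_cong[OF s, of "\<lambda>x. x $ 3"] pos(3) g by (simp add: p_def v)
    have c0: "f (p c) = 0" using arg_cong[OF s, of "\<lambda>x. x $ 2"] pos(2) g d0 by (simp add: p_def v)
    have b0: "f (p b) = 0" using arg_cong[OF s, of "\<lambda>x. x $ 1"] pos(1) g d0 c0 by (simp add: p_def v)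
    show "f x = 0" using x d0 c0 b0 by auto
  qed simp
  moreover have "p a \<notin> {p b, p c, p d}" using inj ne mem by (auto dest: inj_onD)
  ultimately have "\<not> affine_dependent (insert (p a) {p b, p c, p d})"
    by (simp add: affine_dependent_iff_dependent pa)
  then have "\<not> affine_dependent (p ` \<sigma>)" by (simp add: \<sigma>)
  with inside inj dist_eq have "packing_tetrahedron r \<sigma> p"
    unfolding packing_tetrahedron_def by auto
  then show ?thesis by (rule exI[of _ p])
qed

text \<open>Each vertex other than \<open>i\<close> lies off two of the three edges through
  \<open>i\<close>, so its angle occurs twice in the sum of the dihedral angles.\<close>

lemma solid_angle_pack:
  fixes r :: "real^'n::finite"
  assumes card: "card \<sigma> = 4" and r: "\<And>i. i \<in> \<sigma> \<Longrightarrow> 0 < r $ i" and Q: "Q_form r \<sigma> > 0" and i: "i \<in> \<sigma>"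
  shows "solid_angle r \<sigma> i = pack_solid \<sigma> (\<lambda>i. coth (r $ i)) i"
proof -
  define \<kappa> where "\<kappa> i = coth (r $ i)" for i
  have gt: "\<forall>i\<in>\<sigma>. 1 < \<kappa> i" using coth_gt_1 r by (auto simp: \<kappa>_def)
  have Q': "pack_Q \<sigma> \<kappa> > 0" using Q by (simp add: Q_form_def pack_Q_def \<kappa>_def)
  have p: "packing_tetrahedron r \<sigma> (tetrahedron r \<sigma>)"
    unfolding tetrahedron_def by (rule someI_ex[OF packing_tetrahedron_exists[OF card r Q]])
  obtain \<rho> where \<rho>: "\<And>i. i \<in> \<sigma> \<Longrightarrow> 0 < \<rho> i"
    and gram: "\<And>i j. i \<in> \<sigma> \<Longrightarrow> j \<in> \<sigma> \<Longrightarrow> 1 - tetrahedron r \<sigma> i \<bullet> tetrahedron r \<sigma> j = \<rho> i * \<rho> j * pack_gram \<kappa> i j"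
    using packing_tetrahedron_gram[OF r p] unfolding \<kappa>_def[symmetric] by blast
  have dihedral: "dihedral_angle r \<sigma> i j = (\<Sum>x\<in>\<sigma> - {i}. pack_angle \<sigma> \<kappa> x) - pack_angle \<sigma> \<kappa> j" if j: "j \<in> \<sigma> - {i}" for j
  proof -
    have "card (\<sigma> - {i, j}) = 2" using card i j card_Diff_subset[of "{i, j}" \<sigma>] by auto
    then obtain k l where kl: "\<sigma> - {i, j} = {k, l}" "k \<noteq> l" by (meson card_2_iff)
    let ?p = "tetrahedron r \<sigma>"
    have ang: "hyp_dihedral (?p i) (?p j) (?p k) (?p l) = pack_angle \<sigma> \<kappa> k + pack_angle \<sigma> \<kappa> l"
      if "\<sigma> - {i, j} = {k, l}" "k \<noteq> l" for k l
    proof -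
      have "k \<in> \<sigma> - {i, j}" "l \<in> \<sigma> - {i, j}" using that(1) by simp_all
      moreover have "\<sigma> = {i, j} \<union> (\<sigma> - {i, j})" using i j by blast
      then have "\<sigma> = {i, j, k, l}" unfolding that(1) by blast
      ultimately show ?thesis
        using j that(2) by (intro hyp_dihedral_pack[OF _ _ gt Q' \<rho> gram]) auto
    qed
    have "dihedral_angle r \<sigma> i j = pack_angle \<sigma> \<kappa> k + pack_angle \<sigma> \<kappa> l"
      unfolding dihedral_angle_def Let_def
    \<comment> \<open>The description is unique because exchanging the two remaining vertices only
      exchanges the two summands.\<close>
    proof (rule the_equality)
      show "\<exists>k' l'. \<sigma> - {i, j} = {k', l'} \<and> k' \<noteq> l' \<and> pack_angle \<sigma> \<kappa> k + pack_angle \<sigma> \<kappa> l = hyp_dihedral (?p i) (?p j) (?p k') (?p l')"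
        using kl ang[OF kl, symmetric] by (intro exI conjI)
      fix \<theta> assume "\<exists>k l. \<sigma> - {i, j} = {k, l} \<and> k \<noteq> l \<and> \<theta> = hyp_dihedral (?p i) (?p j) (?p k) (?p l)"
      then obtain k' l' where kl': "\<sigma> - {i, j} = {k', l'}" "k' \<noteq> l'" "\<theta> = hyp_dihedral (?p i) (?p j) (?p k') (?p l')" by blast
      have "{k', l'} = {k, l}" using kl kl' by simp
      then show "\<theta> = pack_angle \<sigma> \<kappa> k + pack_angle \<sigma> \<kappa> l"
        unfolding kl'(3) ang[OF kl'(1,2)] by (auto simp: doubleton_eq_iff)
    qed
    also have "\<dots> = (\<Sum>x\<in>\<sigma> - {i, j}. pack_angle \<sigma> \<kappa> x)" using kl by simp
    also have "\<dots> = (\<Sum>x\<in>\<sigma> - {i}. pack_angle \<sigma> \<kappa> x) - pack_angle \<sigma> \<kappa> j"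
      using j by (subst sum_Diff_singleton[symmetric]) (auto simp: Diff_insert2[symmetric] insert_commute)
    finally show ?thesis .
  qed
  have "card (\<sigma> - {i}) = 3" using card i by (simp add: card_Diff_singleton)
  then have "(\<Sum>j\<in>\<sigma> - {i}. dihedral_angle r \<sigma> i j) = 2 * (\<Sum>x\<in>\<sigma> - {i}. pack_angle \<sigma> \<kappa> x)"
    by (simp add: dihedral sum_subtractf)
  then show ?thesis by (simp add: solid_angle_def pack_solid_def \<kappa>_def[abs_def])
qed

section \<open>The hyperbolic volume as a Gaussian integral\<close>

text \<open>Bridge from the gauge integral in \<open>hyp_volume\<close> to the nonnegative Lebesgue
  integral, where Fubini's theorem and the substitutions require only measurability.\<close>

lemma compact_nn_integral:
  fixes f :: "'a::euclidean_space \<Rightarrow> real"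
  assumes A: "compact A" and f: "continuous_on A f" and nonneg: "\<And>x. x \<in> A \<Longrightarrow> 0 \<le> f x"
  shows "f absolutely_integrable_on A" "(\<integral>\<^sup>+x. ennreal (f x) * indicator A x \<partial>lborel) = ennreal (integral A f)"
proof -
  have "set_integrable lborel A f"
    unfolding set_integrable_def by (rule borel_integrable_compact[OF A f])
  then have "f integrable_on A" by (rule set_borel_integral_eq_integral)
  then show "f absolutely_integrable_on A" using nonneg by (rule nonnegative_absolutely_integrable_1)
  show "(\<integral>\<^sup>+x. ennreal (f x) * indicator A x \<partial>lborel) = ennreal (integral A f)"
    using nonneg integrable_integral[OF \<open>f integrable_on A\<close>] by (rule nn_integral_has_integral_lebesgue')
qed

lemma nn_integral_lborel_plus:
  fixes a :: "'a::euclidean_space" and f :: "'a \<Rightarrow> ennreal"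
  assumes "f \<in> borel_measurable borel"
  shows "(\<integral>\<^sup>+x. f x \<partial>lborel) = (\<integral>\<^sup>+x. f (a + x) \<partial>lborel)"
  by (subst lborel_distr_plus[of a, symmetric], subst nn_integral_distr) (use assms in auto)

lemma nn_integral_lborel_scale:
  fixes f :: "'a::euclidean_space \<Rightarrow> ennreal"
  assumes [measurable]: "f \<in> borel_measurable borel" and "c \<noteq> 0"
  shows "(\<integral>\<^sup>+x. f x \<partial>lborel) = ennreal (\<bar>c\<bar> ^ DIM('a)) * (\<integral>\<^sup>+x. f (c *\<^sub>R x) \<partial>lborel)"
  by (subst lborel_affine[OF assms(2), of 0]) (simp add: nn_integral_density nn_integral_distr nn_integral_cmult)

lemma integral_linear_image:
  fixes g :: "real^3 \<Rightarrow> real^3" and f :: "real^3 \<Rightarrow> real"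
  assumes g: "linear g" and f: "f absolutely_integrable_on g ` S"
  shows "integral (g ` S) f = \<bar>det (matrix g)\<bar> * integral S (\<lambda>x. f (g x))"
proof -
  \<comment> \<open>Passing through \<open>real^1\<close> brings the scalar integrand into the
    vector-valued form of the linear change of variables.\<close>
  define F :: "real^3 \<Rightarrow> real^1" where "F x = vec (f x)" for x
  have "F absolutely_integrable_on g ` S"
    unfolding absolutely_integrable_on_1_iff using f by (simp add: F_def)
  then have "integral (g ` S) F = \<bar>det (matrix g)\<bar> *\<^sub>R integral S (F \<circ> g)"
    using integral_change_of_variables_linear[OF g] by blast
  from arg_cong[OF this, of "\<lambda>v. v $ 1"] show ?thesis
    unfolding integral_on_1_eq by (simp add: F_def)
qed

text \<open>Trades the density, an inverse square of a quadratic form, for an exponential of that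
  form. The power \<open>s ^ 3\<close> is the Jacobian of a dilation of three-dimensional space and
  is used up by the rescaling in \<open>slice_eq\<close>.\<close>

lemma radial_integral:
  fixes q :: real
  assumes "q > 0"
  shows "(\<integral>\<^sup>+s. ennreal (2 * s ^ 3 * exp (- (s\<^sup>2 * q))) * indicator {0..} s \<partial>lborel) = ennreal (1 / q\<^sup>2)"
proof -
  define F where "F s = - (1 / q\<^sup>2) * ((s\<^sup>2 * q + 1) * exp (- (s\<^sup>2 * q)))" for s
  have "((\<lambda>s. (s\<^sup>2 * q + 1) / exp (s\<^sup>2 * q)) \<longlongrightarrow> 0) at_top"
  proof -
    have "filterlim (\<lambda>s. s\<^sup>2 * q) at_top at_top"
      using assms by (intro filterlim_at_top_mult_tendsto_pos[OF tendsto_const] filterlim_pow_at_top filterlim_ident) auto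
    moreover have "((\<lambda>y::real. (y + 1) / exp y) \<longlongrightarrow> 0) at_top"
      using tendsto_add[OF tendsto_power_div_exp_0[of 1] tendsto_power_div_exp_0[of 0]] by (simp add: add_divide_distrib)
    ultimately show ?thesis by (rule filterlim_compose[rotated])
  qed
  from tendsto_mult_left[OF this, of "- (1 / q\<^sup>2)"]
  moreover have "F = (\<lambda>s. - (1 / q\<^sup>2) * ((s\<^sup>2 * q + 1) / exp (s\<^sup>2 * q)))"
    by (simp add: F_def exp_minus field_simps fun_eq_iff)
  ultimately have lim: "(F \<longlongrightarrow> 0) at_top" by simp
  have "(\<integral>\<^sup>+s. ennreal (2 * s ^ 3 * exp (- (s\<^sup>2 * q))) * indicator {0..} s \<partial>lborel) = ennreal (0 - F 0)"
  proof (rule nn_integral_FTC_atLeast[OF _ _ _ lim])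
    fix s :: real assume "0 \<le> s"
    have "((\<lambda>s. - c * ((s\<^sup>2 * q + 1) * exp (- (s\<^sup>2 * q)))) has_real_derivative c * q\<^sup>2 * (2 * s ^ 3 * exp (- (s\<^sup>2 * q)))) (at s)" for c
      by (auto intro!: derivative_eq_intros simp: power2_eq_square power3_eq_cube algebra_simps)
    from this[of "1 / q\<^sup>2"]
    have "(F has_real_derivative 1 / q\<^sup>2 * q\<^sup>2 * (2 * s ^ 3 * exp (- (s\<^sup>2 * q)))) (at s)"
      unfolding F_def[abs_def] .
    also have "1 / q\<^sup>2 * q\<^sup>2 * (2 * s ^ 3 * exp (- (s\<^sup>2 * q))) = 2 * s ^ 3 * exp (- (s\<^sup>2 * q))"
      using assms by simp
    finally show "(F has_real_derivative 2 * s ^ 3 * exp (- (s\<^sup>2 * q))) (at s)" .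
    show "0 \<le> 2 * s ^ 3 * exp (- (s\<^sup>2 * q))" using \<open>0 \<le> s\<close> by simp
  qed simp
  then show ?thesis by (simp add: F_def)
qed

lemma id_PiM_halfline: "(\<lambda>u. u) \<in> PiM I (\<lambda>_. halfline) \<rightarrow>\<^sub>M PiM I (\<lambda>_. lborel)"
proof (rule measurable_PiM_single')
  show "(\<lambda>u. u i) \<in> PiM I (\<lambda>_. halfline) \<rightarrow>\<^sub>M lborel" if "i \<in> I" for i
    using halfline_coord[OF that] by simp
qed (auto simp: space_PiM PiE_iff)

interpretation lborel_product: product_sigma_finite "\<lambda>_. lborel :: real measure"
  by (simp add: product_sigma_finite_def sigma_finite_lborel)

text \<open>Makes the orthant explicit again, so that the product measure can be compared with
  Lebesgue measure on \<open>real^3\<close>. The induction removes one coordinate by Fubini's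
  theorem.\<close>

lemma nn_integral_PiM_halfline:
  fixes f :: "('i \<Rightarrow> real) \<Rightarrow> ennreal"
  assumes "finite I" "f \<in> borel_measurable (PiM I (\<lambda>_. lborel))"
  shows "(\<integral>\<^sup>+u. f u \<partial>PiM I (\<lambda>_. halfline)) = (\<integral>\<^sup>+u. f u * (\<Prod>i\<in>I. indicator {0..} (u i)) \<partial>PiM I (\<lambda>_. lborel))"
  using assms
proof (induction I arbitrary: f rule: finite_induct)
  case empty
  have "PiM {} (\<lambda>_::'i. halfline) = PiM {} (\<lambda>_. lborel)"
    by (simp add: PiM_empty)
  then show ?case by simp
next
  case (insert i I)
  note f = insert.prems
  have f': "f \<in> borel_measurable (PiM (insert i I) (\<lambda>_. halfline))"
    using measurable_compose[OF id_PiM_halfline f] by simp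
  have ind: "(\<lambda>u. (\<Prod>j\<in>insert i I. indicator {0..} (u j)) :: ennreal) \<in> borel_measurable (PiM (insert i I) (\<lambda>_. lborel :: real measure))"
    by measurable
  have upd: "(\<lambda>y. f (x(i := y))) \<in> borel_measurable borel" if "x \<in> space (PiM I (\<lambda>_. lborel))" for x
  proof -
    have "(\<lambda>y. f (x(i := y))) \<in> borel_measurable lborel"
      by (rule measurable_compose[OF measurable_component_update[OF that insert.hyps(2)] f])
    then show ?thesis by (simp del: fun_upd_apply)
  qed
  have pair: "(\<lambda>(x, y). f (x(i := y))) \<in> borel_measurable (PiM I (\<lambda>_. lborel) \<Otimes>\<^sub>M lborel)"
    using measurable_compose[OF measurable_add_dim f] by (simp only: split_def)
  have g: "(\<lambda>x. \<integral>\<^sup>+y. f (x(i := y)) * indicator {0..} y \<partial>lborel) \<in> borel_measurable (PiM I (\<lambda>_. lborel))"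
  proof (rule lborel.borel_measurable_nn_integral)
    have "(\<lambda>z. indicator {0..} (snd z) :: ennreal) \<in> borel_measurable (PiM I (\<lambda>_. lborel :: real measure) \<Otimes>\<^sub>M (lborel :: real measure))"
      by (rule measurable_compose[OF measurable_snd borel_measurable_indicator]) simp
    from borel_measurable_times_ennreal[OF pair this]
    show "(\<lambda>(x, y). f (x(i := y)) * indicator {0..} y) \<in> borel_measurable (PiM I (\<lambda>_. lborel) \<Otimes>\<^sub>M lborel)"
      by (simp only: split_def)
  qed
  have "(\<integral>\<^sup>+u. f u \<partial>PiM (insert i I) (\<lambda>_. halfline)) = (\<integral>\<^sup>+x. (\<integral>\<^sup>+y. f (x(i := y)) \<partial>halfline) \<partial>PiM I (\<lambda>_. halfline))"
    by (rule halfline.product_nn_integral_insert[OF insert.hyps f'])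
  also have "\<dots> = (\<integral>\<^sup>+x. (\<integral>\<^sup>+y. f (x(i := y)) * indicator {0..} y \<partial>lborel) \<partial>PiM I (\<lambda>_. halfline))"
  proof (rule nn_integral_cong)
    fix x :: "'i \<Rightarrow> real" assume "x \<in> space (PiM I (\<lambda>_. halfline))"
    then have "x \<in> space (PiM I (\<lambda>_. lborel))" by (auto simp: space_PiM PiE_iff)
    from nn_integral_halfline[OF upd[OF this]]
    show "(\<integral>\<^sup>+y. f (x(i := y)) \<partial>halfline) = (\<integral>\<^sup>+y. f (x(i := y)) * indicator {0..} y \<partial>lborel)" .
  qed
  also have "\<dots> = (\<integral>\<^sup>+x. (\<integral>\<^sup>+y. f (x(i := y)) * indicator {0..} y \<partial>lborel) * (\<Prod>j\<in>I. indicator {0..} (x j)) \<partial>PiM I (\<lambda>_. lborel))"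
    by (rule insert.IH[OF g])
  also have "\<dots> = (\<integral>\<^sup>+x. (\<integral>\<^sup>+y. f (x(i := y)) * (\<Prod>j\<in>insert i I. indicator {0..} ((x(i := y)) j)) \<partial>lborel) \<partial>PiM I (\<lambda>_. lborel))"
  proof (rule nn_integral_cong)
    fix x :: "'i \<Rightarrow> real" assume x: "x \<in> space (PiM I (\<lambda>_. lborel))"
    have p: "(\<Prod>j\<in>insert i I. indicator {0..} ((x(i := y)) j)) = indicator {0..} y * (\<Prod>j\<in>I. indicator {0..} (x j) :: ennreal)" for y
    proof -
      have "(\<Prod>j\<in>I. indicator {0..} ((x(i := y)) j)) = (\<Prod>j\<in>I. indicator {0..} (x j) :: ennreal)"
        using insert.hyps by (intro prod.cong) auto
      then show ?thesis using insert.hyps by simp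
    qed
    show "(\<integral>\<^sup>+y. f (x(i := y)) * indicator {0..} y \<partial>lborel) * (\<Prod>j\<in>I. indicator {0..} (x j))
      = (\<integral>\<^sup>+y. f (x(i := y)) * (\<Prod>j\<in>insert i I. indicator {0..} ((x(i := y)) j)) \<partial>lborel)"
      unfolding p mult.assoc[symmetric]
    proof (rule nn_integral_multc[symmetric])
      show "(\<lambda>y. f (x(i := y)) * indicator {0..} y) \<in> borel_measurable lborel"
        unfolding measurable_lborel2 by (intro borel_measurable_times_ennreal upd[OF x] borel_measurable_indicator) simp
    qed
  qed
  also have "\<dots> = (\<integral>\<^sup>+u. f u * (\<Prod>j\<in>insert i I. indicator {0..} (u j)) \<partial>PiM (insert i I) (\<lambda>_. lborel))"
    by (rule lborel_product.product_nn_integral_insert[OF insert.hyps, symmetric])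
      (rule borel_measurable_times_ennreal[OF f ind])
  finally show ?case .
qed

text \<open>Lebesgue measure is determined by its values on boxes, and the preimage of a box is a
  product of intervals.\<close>

lemma lborel_vec3_eq_PiM:
  assumes "distinct [b, c, d]"
  shows "(lborel :: (real^3) measure) = distr (PiM {b, c, d} (\<lambda>_. lborel)) borel
    (\<lambda>u. vector [u b, u c, u d])"
proof (rule lborel_eqI)
  let ?T = "\<lambda>u. vector [u b, u c, u d] :: real^3"
  have Teq: "?T u = u b *\<^sub>R axis 1 1 + u c *\<^sub>R axis 2 1 + u d *\<^sub>R axis 3 1" for u
    by (simp add: vec_eq_iff forall_3 axis_def)
  have T: "?T \<in> PiM {b, c, d} (\<lambda>_. lborel) \<rightarrow>\<^sub>M borel"
    unfolding Teq by measurable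
  fix l u :: "real^3" assume lu: "\<And>b. b \<in> Basis \<Longrightarrow> l \<bullet> b \<le> u \<bullet> b"
  have le: "l $ i \<le> u $ i" for i using lu[of "axis i 1"] by (simp add: inner_axis axis_in_Basis_iff)
  define I where "I i = (if i = b then {l $ 1<..<u $ 1} else if i = c then {l $ 2<..<u $ 2} else {l $ 3<..<u $ 3})" for i
  have "emeasure (distr (PiM {b, c, d} (\<lambda>_. lborel)) borel ?T) (box l u)
    = emeasure (PiM {b, c, d} (\<lambda>_. lborel)) (?T -` box l u \<inter> space (PiM {b, c, d} (\<lambda>_. lborel)))"
    by (rule emeasure_distr[OF T]) simp
  also have "?T -` box l u \<inter> space (PiM {b, c, d} (\<lambda>_. lborel)) = PiE {b, c, d} I"
    using assms by (auto simp: space_PiM PiE_iff I_def mem_box_cart forall_3)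
  also have "emeasure (PiM {b, c, d} (\<lambda>_. lborel)) (PiE {b, c, d} I) = (\<Prod>i\<in>{b, c, d}. emeasure lborel (I i))"
    by (rule lborel_product.emeasure_PiM) (auto simp: I_def)
  also have "\<dots> = ennreal ((u $ 1 - l $ 1) * (u $ 2 - l $ 2) * (u $ 3 - l $ 3))"
  proof -
    have "b \<noteq> c" "b \<noteq> d" "c \<noteq> d" "c \<noteq> b" "d \<noteq> b" "d \<noteq> c" using assms by auto
    then show ?thesis using le[of 1] le[of 2] le[of 3] by (simp add: I_def ennreal_mult mult.assoc)
  qed
  also have "(u $ 1 - l $ 1) * (u $ 2 - l $ 2) * (u $ 3 - l $ 3) = (\<Prod>b\<in>Basis. (u - l) \<bullet> b)"
  proof -
    have B: "(Basis :: (real^3) set) = (\<lambda>i. axis i 1) ` UNIV" by (auto simp: Basis_vec_def)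
    have "inj (\<lambda>i::3. axis i (1::real))" by (auto simp: inj_on_def axis_eq_axis)
    then have "(\<Prod>b\<in>Basis. (u - l) \<bullet> b) = (\<Prod>i\<in>UNIV. (u - l) \<bullet> axis i 1)"
      unfolding B by (simp add: prod.reindex)
    also have "\<dots> = (\<Prod>i\<in>UNIV. (u - l) $ i)" by (simp add: inner_axis)
    also have "\<dots> = (u $ 1 - l $ 1) * (u $ 2 - l $ 2) * (u $ 3 - l $ 3)" unfolding UNIV_3 by (simp add: mult.assoc)
    finally show ?thesis by simp
  qed
  finally show "emeasure (distr (PiM {b, c, d} (\<lambda>_. lborel)) borel ?T) (box l u) = ennreal (\<Prod>b\<in>Basis. (u - l) \<bullet> b)" .
qed simp

text \<open>The left side is the determinant of V B V^T, where V has the rows \<open>v1\<close>,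
  \<open>v2\<close>, \<open>v3\<close> and B is \<open>N\<close> times the identity plus the
  rank-one matrix of \<open>a\<close>. The second factor on the right is det B.\<close>

lemma det_gram_form:
  fixes a v1 v2 v3 :: "real^3" and N :: real
  defines "m \<equiv> \<lambda>u v. N * (u \<bullet> v) + (a \<bullet> u) * (a \<bullet> v)"
  shows "m v1 v1 * (m v2 v2 * m v3 v3 - m v2 v3 * m v2 v3) - m v1 v2 * (m v1 v2 * m v3 v3 - m v2 v3 * m v1 v3)
      + m v1 v3 * (m v1 v2 * m v2 v3 - m v2 v2 * m v1 v3)
    = (det (vector [v1, v2, v3] :: real^3^3))\<^sup>2 * (N\<^sup>2 * (N + a \<bullet> a))"
proof -
  define V where "V = (vector [v1, v2, v3] :: real^3^3)"
  define B where "B = (\<chi> i j. (if i = j then N else 0) + a $ i * a $ j :: real^3^3)"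
  have row: "V $ 1 = v1" "V $ 2 = v2" "V $ 3 = v3" by (simp_all add: V_def)
  have entry: "(V ** B ** transpose V) $ i $ j = m (V $ i) (V $ j)" for i j
    by (simp add: matrix_matrix_mult_def B_def transpose_def m_def inner_vec_def sum_3 algebra_simps)
  have detB: "det B = N\<^sup>2 * (N + a \<bullet> a)"
    by (simp add: det_3 B_def inner_vec_def sum_3 power2_eq_square algebra_simps)
  have comm: "m u v = m v u" for u v by (simp add: m_def inner_commute)
  have "det (V ** B ** transpose V) = (det V)\<^sup>2 * (N\<^sup>2 * (N + a \<bullet> a))"
    by (simp add: det_mul det_transpose detB power2_eq_square)
  moreover have "det (V ** B ** transpose V) = m v1 v1 * (m v2 v2 * m v3 v3 - m v2 v3 * m v2 v3) - m v1 v2 * (m v1 v2 * m v3 v3 - m v2 v3 * m v1 v3)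
      + m v1 v3 * (m v1 v2 * m v2 v3 - m v2 v2 * m v1 v3)"
    unfolding det_3 entry row comm[of v2 v1] comm[of v3 v1] comm[of v3 v2] by (simp add: algebra_simps)
  ultimately show ?thesis by (simp add: V_def)
qed

text \<open>In substance det G = -4Q for the Gram matrix G: passing to the rescaled Schur complement
  multiplies det G by minus the squared pivot. Multiplication by \<open>S b b\<close> reduces the
  determinant to the 2 by 2 minors already known.\<close>

lemma det_schur:
  assumes dist: "distinct [a, b, c, d]" and k: "\<kappa> a > 1" "\<kappa> b > 1" "\<kappa> c > 1" "\<kappa> d > 1"
  defines "S \<equiv> schur \<kappa> a"
  shows "S b b * (S c c * S d d - S c d * S c d) - S b c * (S b c * S d d - S c d * S b d)
      + S b d * (S b c * S c d - S c c * S b d) = 4 * pack_Q {a, b, c, d} \<kappa> * ((\<kappa> a)\<^sup>2 - 1)\<^sup>2" (is "?D = ?R")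
proof -
  let ?\<sigma> = "{a, b, c, d}"
  let ?w = "pack_w ?\<sigma> \<kappa>"
  have dist': "distinct [a, b, d, c]" and \<sigma>': "?\<sigma> = {a, b, d, c}" using dist by auto
  have m1: "S b b * S c d - S b c * S b d = ((\<kappa> a)\<^sup>2 - 1) * (pack_Q ?\<sigma> \<kappa> - 4 * ?w c * ?w d)"
    unfolding S_def schur_commute[of \<kappa> a b c] schur_commute[of \<kappa> a b d] by (rule schur_off_minor[OF dist])
  have m2: "S b b * S c c - S b c * S b c = ((\<kappa> a)\<^sup>2 - 1) * (pack_Q ?\<sigma> \<kappa> + 4 * (?w d)\<^sup>2)"
    unfolding S_def schur_commute[of \<kappa> a b c] by (rule schur_minor[OF dist])
  have m3: "S b b * S d d - S b d * S b d = ((\<kappa> a)\<^sup>2 - 1) * (pack_Q ?\<sigma> \<kappa> + 4 * (?w c)\<^sup>2)"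
    unfolding S_def schur_commute[of \<kappa> a b d] \<sigma>' by (rule schur_minor[OF dist'])
  have Sbb: "S b b = (\<kappa> a + \<kappa> b)\<^sup>2" unfolding S_def using dist by (intro schur_diag) auto
  have ww: "?w c + ?w d = \<kappa> a + \<kappa> b" unfolding pack_w_def sum_distinct4[OF dist] by (simp add: field_simps)
  have "S b b * ?D = (S b b * S c c - S b c * S b c) * (S b b * S d d - S b d * S b d) - (S b b * S c d - S b c * S b d)\<^sup>2"
    by (simp add: power2_eq_square algebra_simps)
  also have "\<dots> = ((\<kappa> a)\<^sup>2 - 1)\<^sup>2 * (4 * pack_Q ?\<sigma> \<kappa> * (?w c + ?w d)\<^sup>2)"
    unfolding m1 m2 m3 by (simp add: power2_eq_square algebra_simps)
  also have "\<dots> = S b b * ?R" unfolding ww Sbb by (simp only: mult_ac)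
  finally have "S b b * ?D = S b b * ?R" .
  moreover have "S b b \<noteq> 0" unfolding Sbb using k by simp
  ultimately show ?thesis by (simp only: mult_cancel_left) simp
qed

lemma pack_form_gram:
  assumes "finite \<sigma>"
  shows "pack_form \<sigma> \<kappa> z = (\<Sum>i\<in>\<sigma>. \<Sum>j\<in>\<sigma>. z i * z j * pack_gram \<kappa> i j)"
proof -
  have "(\<Sum>i\<in>\<sigma>. \<Sum>j\<in>\<sigma>. z i * z j * pack_gram \<kappa> i j)
    = (\<Sum>i\<in>\<sigma>. \<Sum>j\<in>\<sigma>. (\<kappa> i * z i) * (\<kappa> j * z j) + z i * z j - (if i = j then 2 * (z i)\<^sup>2 else 0))"
    by (intro sum.cong) (auto simp: pack_gram_def power2_eq_square algebra_simps)
  also have "\<dots> = pack_form \<sigma> \<kappa> z"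
    using assms by (simp add: sum.distrib sum_subtractf pack_form_def power2_eq_square sum_product[symmetric] sum_distrib_left)
  finally show ?thesis by simp
qed

lemma affine_combination_inner:
  fixes p :: "'i \<Rightarrow> 'a::real_inner"
  assumes fin: "finite \<sigma>" and l: "(\<Sum>i\<in>\<sigma>. l i) = 1"
  shows "1 - (\<Sum>i\<in>\<sigma>. l i *\<^sub>R p i) \<bullet> (\<Sum>i\<in>\<sigma>. l i *\<^sub>R p i) = (\<Sum>i\<in>\<sigma>. \<Sum>j\<in>\<sigma>. l i * l j * (1 - p i \<bullet> p j))"
proof -
  have "(\<Sum>i\<in>\<sigma>. \<Sum>j\<in>\<sigma>. l i * l j * (1 - p i \<bullet> p j)) = (\<Sum>i\<in>\<sigma>. l i) * (\<Sum>j\<in>\<sigma>. l j) - (\<Sum>i\<in>\<sigma>. \<Sum>j\<in>\<sigma>. l i * l j * (p i \<bullet> p j))"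
    unfolding sum_product by (simp add: sum_subtractf right_diff_distrib)
  also have "(\<Sum>i\<in>\<sigma>. \<Sum>j\<in>\<sigma>. l i * l j * (p i \<bullet> p j)) = (\<Sum>i\<in>\<sigma>. l i *\<^sub>R p i) \<bullet> (\<Sum>i\<in>\<sigma>. l i *\<^sub>R p i)"
    by (simp add: inner_sum_left inner_sum_right sum_distrib_left mult_ac inner_commute)
  finally show ?thesis using l by simp
qed

section \<open>Parametrisation of a tetrahedron by a simplex\<close>

locale gram_tetrahedron =
  fixes \<sigma> :: "'i set" and a b c d :: 'i and \<kappa> \<rho> :: "'i \<Rightarrow> real" and p :: "'i \<Rightarrow> real^3"
  assumes \<sigma>: "\<sigma> = {a, b, c, d}" and dist: "distinct [a, b, c, d]"
    and gt: "\<forall>i\<in>\<sigma>. 1 < \<kappa> i" and Q: "pack_Q \<sigma> \<kappa> > 0"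
    and \<rho>: "\<And>i. i \<in> \<sigma> \<Longrightarrow> 0 < \<rho> i"
    and gram: "\<And>i j. i \<in> \<sigma> \<Longrightarrow> j \<in> \<sigma> \<Longrightarrow> 1 - p i \<bullet> p j = \<rho> i * \<rho> j * pack_gram \<kappa> i j"
begin

lemma mem: "a \<in> \<sigma>" "b \<in> \<sigma>" "c \<in> \<sigma>" "d \<in> \<sigma>" by (simp_all add: \<sigma>)

lemma ne: "a \<noteq> b" "a \<noteq> c" "a \<noteq> d" "b \<noteq> c" "b \<noteq> d" "c \<noteq> d" "b \<noteq> a" "c \<noteq> a" "d \<noteq> a" "c \<noteq> b" "d \<noteq> b" "d \<noteq> c"
  using dist by auto

lemma fin: "finite \<sigma>" by (simp add: \<sigma>)

lemma \<rho>_pos: "\<rho> a > 0" "\<rho> b > 0" "\<rho> c > 0" "\<rho> d > 0" using \<rho> mem by auto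

text \<open>The division by \<open>\<rho> k\<close> makes the coordinates with respect to these
  vectors equal to the variables of \<open>pack_form\<close>; the barycentric coordinates are these
  divided by \<open>\<rho>\<close>.\<close>

definition edge :: "'i \<Rightarrow> real^3" where "edge k = (1 / \<rho> k) *\<^sub>R (p k - p a)"

definition V :: "real^3^3" where "V = vector [edge b, edge c, edge d]"

definition g :: "real^3 \<Rightarrow> real^3" where "g x = x $ 1 *\<^sub>R edge b + x $ 2 *\<^sub>R edge c + x $ 3 *\<^sub>R edge d"

definition y :: "real^3" where "y = vector [1 / \<rho> b, 1 / \<rho> c, 1 / \<rho> d]"

text \<open>The inner product with \<open>y\<close> is the sum of the barycentric coordinates at
  \<open>b\<close>, \<open>c\<close> and \<open>d\<close>, so what is missing to 1 belongs to
  \<open>a\<close>.\<close>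

definition \<Delta> :: "(real^3) set" where "\<Delta> = {x. 0 \<le> x $ 1 \<and> 0 \<le> x $ 2 \<and> 0 \<le> x $ 3 \<and> x \<bullet> y \<le> 1}"

definition lab :: "real \<Rightarrow> real^3 \<Rightarrow> 'i \<Rightarrow> real" where
  "lab t x i = (if i = a then t else if i = b then x $ 1 else if i = c then x $ 2 else x $ 3)"

lemma lab_simps: "lab t x a = t" "lab t x b = x $ 1" "lab t x c = x $ 2" "lab t x d = x $ 3"
  using ne by (simp_all add: lab_def)

lemma inner_y: "x \<bullet> y = x $ 1 / \<rho> b + x $ 2 / \<rho> c + x $ 3 / \<rho> d"
  by (simp add: inner_vec_def sum_3 y_def)

lemma g_eq: "g = (\<lambda>x. transpose V *v x)"
  by (auto simp: g_def fun_eq_iff vec_eq_iff matrix_vector_mult_def sum_3 transpose_def V_def algebra_simps)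

lemma linear_g: "linear g" unfolding g_eq by (rule matrix_vector_mul_linear)

text \<open>The case \<open>N = 1 - p a \<bullet> p a\<close> of \<open>det_gram_form\<close>, in
  which \<open>N + p a \<bullet> p a\<close> is 1. The Gram entries of the edges are multiples of
  the Schur complement, whose determinant contributes 4Q, and the powers of \<open>N\<close>
  cancel.\<close>

lemma det_g: "\<bar>det (matrix g)\<bar> = 2 * sqrt (pack_Q \<sigma> \<kappa>) * \<rho> a"
proof -
  have k: "\<kappa> a > 1" "\<kappa> b > 1" "\<kappa> c > 1" "\<kappa> d > 1" using gt mem by auto
  define E where "E = (\<kappa> a)\<^sup>2 - 1"
  have E: "E > 0" using one_less_power[OF k(1), of 2] by (simp add: E_def)
  define N where "N = 1 - p a \<bullet> p a"
  have N: "N = (\<rho> a)\<^sup>2 * E" using gram[OF mem(1) mem(1)] by (simp add: N_def pack_gram_def E_def power2_eq_square)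
  have Npos: "N > 0" unfolding N using E \<rho>_pos by simp
  define m where "m u v = N * (u \<bullet> v) + (p a \<bullet> u) * (p a \<bullet> v)" for u v
  define S where "S = schur \<kappa> a"
  have m: "m (edge i) (edge j) = (\<rho> a)\<^sup>2 * S i j" if "i \<in> \<sigma>" "j \<in> \<sigma>" for i j
  proof -
    have "m (p i - p a) (p j - p a) = (1 - p a \<bullet> p i) * (1 - p a \<bullet> p j) - N * (1 - p i \<bullet> p j)"
      by (simp add: m_def N_def inner_diff_left inner_diff_right inner_commute algebra_simps)
    also have "\<dots> = (\<rho> a)\<^sup>2 * (\<rho> i * \<rho> j) * S i j"
      unfolding N gram[OF mem(1) that(1)] gram[OF mem(1) that(2)] gram[OF that] S_def schur_def E_def
      by (simp add: pack_gram_def power2_eq_square algebra_simps)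
    finally have "m (p i - p a) (p j - p a) = (\<rho> a)\<^sup>2 * (\<rho> i * \<rho> j) * S i j" .
    moreover have "m (edge i) (edge j) = m (p i - p a) (p j - p a) / (\<rho> i * \<rho> j)"
      unfolding m_def edge_def inner_scaleR_left inner_scaleR_right by (simp add: add_divide_distrib)
    ultimately show ?thesis using \<rho>[OF that(1)] \<rho>[OF that(2)] by simp
  qed
  have "(det V)\<^sup>2 * (N\<^sup>2 * (N + p a \<bullet> p a)) = m (edge b) (edge b) * (m (edge c) (edge c) * m (edge d) (edge d) - m (edge c) (edge d) * m (edge c) (edge d))
      - m (edge b) (edge c) * (m (edge b) (edge c) * m (edge d) (edge d) - m (edge c) (edge d) * m (edge b) (edge d))
      + m (edge b) (edge d) * (m (edge b) (edge c) * m (edge c) (edge d) - m (edge c) (edge c) * m (edge b) (edge d))"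
    unfolding V_def m_def by (rule det_gram_form[symmetric])
  also have "\<dots> = ((\<rho> a)\<^sup>2) ^ 3 * (S b b * (S c c * S d d - S c d * S c d) - S b c * (S b c * S d d - S c d * S b d)
      + S b d * (S b c * S c d - S c c * S b d))"
    unfolding m[OF mem(2) mem(2)] m[OF mem(2) mem(3)] m[OF mem(2) mem(4)] m[OF mem(3) mem(3)] m[OF mem(3) mem(4)] m[OF mem(4) mem(4)]
    by (simp add: power3_eq_cube algebra_simps)
  also have "\<dots> = ((\<rho> a)\<^sup>2) ^ 3 * (4 * pack_Q \<sigma> \<kappa> * E\<^sup>2)"
    unfolding S_def E_def \<sigma> det_schur[OF dist k] ..
  also have "\<dots> = (4 * pack_Q \<sigma> \<kappa> * (\<rho> a)\<^sup>2) * N\<^sup>2"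
    unfolding N by (simp add: power3_eq_cube power2_eq_square)
  also have "N + p a \<bullet> p a = 1" by (simp add: N_def)
  finally have "(det V)\<^sup>2 = (2 * sqrt (pack_Q \<sigma> \<kappa>) * \<rho> a)\<^sup>2"
    using Npos Q by (simp add: power_mult_distrib)
  then have "\<bar>det V\<bar> = \<bar>2 * sqrt (pack_Q \<sigma> \<kappa>) * \<rho> a\<bar>" by (simp only: power2_eq_iff abs_eq_iff)
  moreover have "matrix g = transpose V" unfolding g_eq by simp
  ultimately show ?thesis using Q \<rho>_pos by (simp add: det_transpose)
qed

lemma barycentric:
  "p a + g x = (\<Sum>i\<in>\<sigma>. (if i = a then 1 - x \<bullet> y else lab 0 x i / \<rho> i) *\<^sub>R p i)"
proof -
  have "(\<Sum>i\<in>\<sigma>. (if i = a then 1 - x \<bullet> y else lab 0 x i / \<rho> i) *\<^sub>R p i)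
    = (1 - x \<bullet> y) *\<^sub>R p a + (x $ 1 / \<rho> b) *\<^sub>R p b + (x $ 2 / \<rho> c) *\<^sub>R p c + (x $ 3 / \<rho> d) *\<^sub>R p d"
    unfolding \<sigma> using ne by (simp add: lab_simps add.assoc)
  then show ?thesis unfolding inner_y by (simp add: g_def edge_def algebra_simps)
qed

lemma barycentric_sum: "(\<Sum>i\<in>\<sigma>. if i = a then 1 - x \<bullet> y else lab 0 x i / \<rho> i) = 1"
  unfolding \<sigma> using ne by (simp add: lab_simps inner_y)

text \<open>Since the barycentric coordinates add up to 1, the inhomogeneous expression on the left
  is a quadratic form in them, and scaling them by \<open>\<rho>\<close> turns it into
  \<open>pack_form\<close>.\<close>

lemma one_minus_norm: "1 - (p a + g x) \<bullet> (p a + g x) = pack_form \<sigma> \<kappa> (lab (\<rho> a * (1 - x \<bullet> y)) x)"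
proof -
  let ?l = "\<lambda>i. if i = a then 1 - x \<bullet> y else lab 0 x i / \<rho> i"
  have l: "\<rho> i * ?l i = lab (\<rho> a * (1 - x \<bullet> y)) x i" if "i \<in> \<sigma>" for i
    using \<rho>[OF that] by (simp add: lab_def)
  have "1 - (p a + g x) \<bullet> (p a + g x) = (\<Sum>i\<in>\<sigma>. \<Sum>j\<in>\<sigma>. ?l i * ?l j * (1 - p i \<bullet> p j))"
    unfolding barycentric by (rule affine_combination_inner[OF fin barycentric_sum])
  also have "\<dots> = (\<Sum>i\<in>\<sigma>. \<Sum>j\<in>\<sigma>. (\<rho> i * ?l i) * (\<rho> j * ?l j) * pack_gram \<kappa> i j)"
    by (intro sum.cong refl) (simp only: gram mult_ac)
  also have "\<dots> = (\<Sum>i\<in>\<sigma>. \<Sum>j\<in>\<sigma>. lab (\<rho> a * (1 - x \<bullet> y)) x i * lab (\<rho> a * (1 - x \<bullet> y)) x j * pack_gram \<kappa> i j)"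
    by (intro sum.cong refl) (simp only: l)
  finally show ?thesis by (simp only: pack_form_gram[OF fin])
qed

lemma convex_\<Delta>: "convex \<Delta>"
proof -
  have "\<Delta> = {x. axis 1 1 \<bullet> x \<ge> 0} \<inter> {x. axis 2 1 \<bullet> x \<ge> 0} \<inter> {x. axis 3 1 \<bullet> x \<ge> 0} \<inter> {x. y \<bullet> x \<le> 1}"
    by (auto simp: \<Delta>_def inner_axis' inner_axis inner_commute)
  then show ?thesis by (simp only: convex_Int convex_halfspace_ge convex_halfspace_le)
qed

lemma compact_\<Delta>: "compact \<Delta>"
proof -
  have "\<Delta> \<subseteq> cbox 0 (vector [\<rho> b, \<rho> c, \<rho> d])"
  proof
    fix x assume x: "x \<in> \<Delta>"
    have nn: "0 \<le> x $ 1 / \<rho> b" "0 \<le> x $ 2 / \<rho> c" "0 \<le> x $ 3 / \<rho> d"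
      using x \<rho>_pos by (auto simp: \<Delta>_def)
    then have "x $ 1 / \<rho> b \<le> 1" "x $ 2 / \<rho> c \<le> 1" "x $ 3 / \<rho> d \<le> 1" using x by (auto simp: \<Delta>_def inner_y)
    then show "x \<in> cbox 0 (vector [\<rho> b, \<rho> c, \<rho> d])"
      using x \<rho>_pos by (simp add: mem_box_cart forall_3 \<Delta>_def)
  qed
  then have "bounded \<Delta>" using bounded_cbox bounded_subset by blast
  moreover have "closed \<Delta>"
    unfolding \<Delta>_def by (intro closed_Collect_conj closed_Collect_le continuous_intros)
  ultimately show ?thesis by (simp add: compact_eq_bounded_closed)
qed

lemma hull_eq: "convex hull (p ` \<sigma>) = (+) (p a) ` g ` \<Delta>"
proof
  have conv: "convex ((+) (p a) ` g ` \<Delta>)"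
    by (intro convex_translation convex_linear_image linear_g convex_\<Delta>)
  have pt: "p k = p a + g (\<rho> k *\<^sub>R axis j 1)" "\<rho> k *\<^sub>R axis j 1 \<in> \<Delta>" if "(k, j) \<in> {(b, 1), (c, 2), (d, 3)}" for k and j :: 3
    using that \<rho>_pos by (auto simp: g_def edge_def \<Delta>_def inner_y axis_def)
  have "0 \<in> \<Delta>" by (simp add: \<Delta>_def)
  moreover have "g 0 = 0" by (simp add: g_def)
  ultimately have "p a \<in> (+) (p a) ` g ` \<Delta>" by (metis add.right_neutral image_eqI)
  moreover have "p k \<in> (+) (p a) ` g ` \<Delta>" if "(k, j) \<in> {(b, 1), (c, 2), (d, 3)}" for k and j :: 3
    using pt[OF that] by blast
  ultimately have "p ` \<sigma> \<subseteq> (+) (p a) ` g ` \<Delta>" unfolding \<sigma> by blast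
  then show "convex hull (p ` \<sigma>) \<subseteq> (+) (p a) ` g ` \<Delta>" using conv by (rule hull_minimal)
  show "(+) (p a) ` g ` \<Delta> \<subseteq> convex hull (p ` \<sigma>)"
  proof clarify
    fix x assume x: "x \<in> \<Delta>"
    show "p a + g x \<in> convex hull (p ` \<sigma>)"
      unfolding barycentric
    proof (rule convex_sum[OF fin convex_convex_hull barycentric_sum])
      fix i assume i: "i \<in> \<sigma>"
      show "0 \<le> (if i = a then 1 - x \<bullet> y else lab 0 x i / \<rho> i)"
        using x \<rho>[OF i] by (auto simp: \<Delta>_def lab_def)
      show "p i \<in> convex hull (p ` \<sigma>)" using i by (simp add: hull_inc)
    qed
  qed
qed

end

section \<open>The orthant as a cone over the simplex\<close>

lemma nn_integral_lborel_swap: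
  fixes f :: "'a::euclidean_space \<Rightarrow> 'b::euclidean_space \<Rightarrow> ennreal"
  assumes "(\<lambda>z. f (fst z) (snd z)) \<in> borel_measurable borel"
  shows "(\<integral>\<^sup>+y. (\<integral>\<^sup>+x. f x y \<partial>lborel) \<partial>lborel) = (\<integral>\<^sup>+x. (\<integral>\<^sup>+y. f x y \<partial>lborel) \<partial>lborel)"
  using assms by (intro lborel_pair.Fubini') (simp add: lborel_prod case_prod_beta')

lemma borel_measurable_indicator_exp:
  fixes q :: "'a::topological_space \<Rightarrow> real"
  assumes "continuous_on UNIV q" "continuous_on UNIV h" "closed C"
  shows "(\<lambda>z. ennreal (h z * exp (- q z)) * indicator C z) \<in> borel_measurable borel"
  by (intro borel_measurable_times_ennreal measurable_compose[OF _ measurable_ennreal] borel_measurable_continuous_onI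
    borel_measurable_indicator borel_closed continuous_intros assms)

context gram_tetrahedron
begin

definition qf :: "real \<Rightarrow> real^3 \<Rightarrow> real" where
  "qf t x = (\<kappa> a * t + \<kappa> b * x $ 1 + \<kappa> c * x $ 2 + \<kappa> d * x $ 3)\<^sup>2 + (t + x $ 1 + x $ 2 + x $ 3)\<^sup>2
    - 2 * (t\<^sup>2 + (x $ 1)\<^sup>2 + (x $ 2)\<^sup>2 + (x $ 3)\<^sup>2)"

lemma qf_eq: "pack_form \<sigma> \<kappa> (lab t x) = qf t x"
  unfolding pack_form_def \<sigma> sum_distinct4[OF dist] lab_simps qf_def ..

lemma qf_scale: "qf (s * t) (s *\<^sub>R x) = s\<^sup>2 * qf t x"
  by (simp add: qf_def power2_eq_square algebra_simps)

definition orth :: "(real^3) set" where "orth = {x. 0 \<le> x $ 1 \<and> 0 \<le> x $ 2 \<and> 0 \<le> x $ 3}"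

lemma closed_orth: "closed orth"
  unfolding orth_def by (intro closed_Collect_conj closed_Collect_le continuous_intros)

lemma orth_scale: "s > 0 \<Longrightarrow> s *\<^sub>R x \<in> orth \<longleftrightarrow> x \<in> orth"
  by (simp add: orth_def zero_le_mult_iff)

lemma orth_y: "x \<in> orth \<Longrightarrow> 0 \<le> x \<bullet> y"
  using \<rho>_pos by (simp add: orth_def inner_y)

lemma \<Delta>_eq: "\<Delta> = {x \<in> orth. x \<bullet> y \<le> 1}" by (auto simp: \<Delta>_def orth_def)

text \<open>The Gaussian integral over the orthant with the coordinate of \<open>a\<close> singled
  out as \<open>t\<close>; this is the shape in which the integral over the simplex arrives.\<close>

definition J :: ennreal where
  "J = (\<integral>\<^sup>+x. (\<integral>\<^sup>+t. ennreal (exp (- qf t x)) * indicator ({0..} \<times> orth) (t, x) \<partial>lborel) \<partial>lborel)"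

lemma J_measurable:
  "(\<lambda>x. \<integral>\<^sup>+t. ennreal (exp (- qf t x)) * indicator ({0..} \<times> orth) (t, x) \<partial>lborel) \<in> borel_measurable borel"
proof -
  have "(\<lambda>z. ennreal (1 * exp (- qf (snd z) (fst z))) * indicator (orth \<times> {0..}) z) \<in> borel_measurable borel"
    unfolding qf_def by (intro borel_measurable_indicator_exp continuous_intros closed_Times closed_orth closed_atLeast)
  then have "(\<lambda>(x, t). ennreal (exp (- qf t x)) * indicator ({0..} \<times> orth) (t, x)) \<in> borel_measurable (lborel \<Otimes>\<^sub>M lborel)"
    by (simp add: lborel_prod case_prod_beta' indicator_def conj_commute mem_Times_iff)
  from lborel.borel_measurable_nn_integral[OF this] show ?thesis by simp
qed

lemma qf_pos:
  assumes "x \<in> \<Delta>" "p a + g x \<in> ball 0 1"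
  shows "0 < qf (\<rho> a * (1 - x \<bullet> y)) x"
  using assms(2) unfolding qf_eq[symmetric] one_minus_norm[symmetric]
  by (simp add: dot_square_norm power_less_one_iff abs_square_less_1)

text \<open>For positive \<open>s\<close> this is the substitution of \<open>s *\<^sub>R x\<close>
  for \<open>x\<close>: homogeneity absorbs \<open>s\<^sup>2\<close> into the form, the Jacobian
  absorbs \<open>s ^ 3\<close>, and the simplex becomes the slice of the cone at height
  \<open>s\<close>. For negative \<open>s\<close> both sides vanish.\<close>

lemma slice_eq:
  assumes s: "s \<noteq> 0"
  shows "(\<integral>\<^sup>+x. ennreal (2 * s ^ 3 * exp (- (s\<^sup>2 * qf (\<rho> a * (1 - x \<bullet> y)) x))) * indicator ({0..} \<times> \<Delta>) (s, x) \<partial>lborel)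
    = 2 * (\<integral>\<^sup>+x. ennreal (exp (- qf (\<rho> a * (s - x \<bullet> y)) x)) * indicator {z. snd z \<in> orth \<and> snd z \<bullet> y \<le> fst z} (s, x) \<partial>lborel)"
    (is "?L = 2 * (\<integral>\<^sup>+x. ?H x \<partial>lborel)")
proof (cases "s > 0")
  case True
  have "(\<lambda>x. ennreal (1 * exp (- qf (\<rho> a * (s - x \<bullet> y)) x)) * indicator {x \<in> orth. x \<bullet> y \<le> s} x) \<in> borel_measurable borel"
    unfolding qf_def Collect_conj_eq Collect_mem_eq
    by (intro borel_measurable_indicator_exp continuous_intros closed_Int closed_orth closed_Collect_le)
  also have "(\<lambda>x. ennreal (1 * exp (- qf (\<rho> a * (s - x \<bullet> y)) x)) * indicator {x \<in> orth. x \<bullet> y \<le> s} x) = ?H"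
    by (auto simp: indicator_def fun_eq_iff)
  finally have meas: "?H \<in> borel_measurable borel" .
  have arg: "\<rho> a * (s - (s *\<^sub>R x) \<bullet> y) = s * (\<rho> a * (1 - x \<bullet> y))" for x by (simp add: algebra_simps)
  have "ennreal (2 * s ^ 3 * exp (- (s\<^sup>2 * qf (\<rho> a * (1 - x \<bullet> y)) x))) * indicator ({0..} \<times> \<Delta>) (s, x)
    = ennreal (2 * s ^ 3) * ?H (s *\<^sub>R x)" for x
  proof -
    have "(s, s *\<^sub>R x) \<in> {z. snd z \<in> orth \<and> snd z \<bullet> y \<le> fst z} \<longleftrightarrow> (s, x) \<in> {0..} \<times> \<Delta>"
      using True by (auto simp: orth_scale \<Delta>_eq)
    then show ?thesis unfolding arg qf_scale using True
      by (simp add: indicator_def ennreal_mult)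
  qed
  then have "?L = ennreal (2 * s ^ 3) * (\<integral>\<^sup>+x. ?H (s *\<^sub>R x) \<partial>lborel)"
    using measurable_compose[OF borel_measurable_scaleR[OF borel_measurable_const[of s] measurable_ident_sets[OF refl]] meas]
    by (simp add: nn_integral_cmult)
  also have "\<dots> = 2 * (ennreal (\<bar>s\<bar> ^ DIM(real^3)) * (\<integral>\<^sup>+x. ?H (s *\<^sub>R x) \<partial>lborel))"
    using True by (simp add: ennreal_mult mult.assoc)
  also have "\<dots> = 2 * (\<integral>\<^sup>+x. ?H x \<partial>lborel)"
    by (simp only: nn_integral_lborel_scale[OF meas s, symmetric])
  finally show ?thesis .
next
  case False
  then have "s < 0" using s by simp
  then have "?H x = 0" for x using orth_y[of x] by (auto simp: indicator_def)
  moreover have "ennreal (2 * s ^ 3 * exp (- (s\<^sup>2 * qf (\<rho> a * (1 - x \<bullet> y)) x))) * indicator ({0..} \<times> \<Delta>) (s, x) = 0" for x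
    using \<open>s < 0\<close> by simp
  ultimately show ?thesis by (simp only:) simp
qed

text \<open>The substitution \<open>t = \<rho> a * (s - x \<bullet> y)\<close> replaces the height
  in the cone by the coordinate of \<open>a\<close>, with Jacobian \<open>1 / \<rho> a\<close>, and
  turns the cone condition into nonnegativity of \<open>t\<close>.\<close>

lemma fibre_eq:
  "(\<integral>\<^sup>+s. ennreal (exp (- qf (\<rho> a * (s - x \<bullet> y)) x)) * indicator {z. snd z \<in> orth \<and> snd z \<bullet> y \<le> fst z} (s, x) \<partial>lborel)
    = ennreal (1 / \<rho> a) * (\<integral>\<^sup>+t. ennreal (exp (- qf t x)) * indicator ({0..} \<times> orth) (t, x) \<partial>lborel)"
    (is "(\<integral>\<^sup>+s. ?H s \<partial>lborel) = _")
proof -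
  have "(\<lambda>s. ennreal (1 * exp (- qf (\<rho> a * (s - x \<bullet> y)) x)) * indicator {s. x \<in> orth \<and> x \<bullet> y \<le> s} s) \<in> borel_measurable borel"
    unfolding qf_def
    by (intro borel_measurable_indicator_exp continuous_intros closed_Collect_conj closed_Collect_le closed_Collect_const)
  also have "(\<lambda>s. ennreal (1 * exp (- qf (\<rho> a * (s - x \<bullet> y)) x)) * indicator {s. x \<in> orth \<and> x \<bullet> y \<le> s} s) = ?H"
    by (auto simp: indicator_def fun_eq_iff)
  finally have meas: "?H \<in> borel_measurable borel" .
  have "1 / \<rho> a \<noteq> 0" using \<rho>_pos by simp
  from nn_integral_real_affine[OF meas this, of "x \<bullet> y"]
  have "(\<integral>\<^sup>+s. ?H s \<partial>lborel) = ennreal (1 / \<rho> a) * (\<integral>\<^sup>+t. ?H (x \<bullet> y + 1 / \<rho> a * t) \<partial>lborel)"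
    using \<rho>_pos by simp
  moreover have "?H (x \<bullet> y + 1 / \<rho> a * t) = ennreal (exp (- qf t x)) * indicator ({0..} \<times> orth) (t, x)" for t
    using \<rho>_pos by (auto simp: indicator_def zero_le_divide_iff)
  ultimately show ?thesis by (simp only:)
qed

text \<open>Integrating over all dilations of the simplex fills a cone, which a linear shear
  identifies with the orthant. Fubini's theorem is applied twice: to slice by the height, and back
  to integrate along fibres.\<close>

lemma nn_integral_simplex:
  assumes ball: "\<And>x. x \<in> \<Delta> \<Longrightarrow> p a + g x \<in> ball 0 1"
  shows "(\<integral>\<^sup>+x. ennreal (1 / (1 - (p a + g x) \<bullet> (p a + g x))\<^sup>2) * indicator \<Delta> x \<partial>lborel) = ennreal (2 / \<rho> a) * J"
proof -
  let ?q = "\<lambda>x. qf (\<rho> a * (1 - x \<bullet> y)) x"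
  let ?C = "{z :: real \<times> (real^3). snd z \<in> orth \<and> snd z \<bullet> y \<le> fst z}"
  have closed_C: "closed ?C" unfolding orth_def mem_Collect_eq
    by (intro closed_Collect_conj closed_Collect_le continuous_intros)
  have "(\<integral>\<^sup>+x. ennreal (1 / (1 - (p a + g x) \<bullet> (p a + g x))\<^sup>2) * indicator \<Delta> x \<partial>lborel)
    = (\<integral>\<^sup>+x. (\<integral>\<^sup>+s. ennreal (2 * s ^ 3 * exp (- (s\<^sup>2 * ?q x))) * indicator ({0..} \<times> \<Delta>) (s, x) \<partial>lborel) \<partial>lborel)"
  proof (intro nn_integral_cong)
    fix x
    show "ennreal (1 / (1 - (p a + g x) \<bullet> (p a + g x))\<^sup>2) * indicator \<Delta> x
      = (\<integral>\<^sup>+s. ennreal (2 * s ^ 3 * exp (- (s\<^sup>2 * ?q x))) * indicator ({0..} \<times> \<Delta>) (s, x) \<partial>lborel)"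
    proof (cases "x \<in> \<Delta>")
      case True
      then have "(\<integral>\<^sup>+s. ennreal (2 * s ^ 3 * exp (- (s\<^sup>2 * ?q x))) * indicator ({0..} \<times> \<Delta>) (s, x) \<partial>lborel) = ennreal (1 / (?q x)\<^sup>2)"
        unfolding radial_integral[OF qf_pos[OF True ball[OF True]], symmetric]
        by (intro nn_integral_cong) (simp add: indicator_def)
      then show ?thesis using True by (simp add: one_minus_norm qf_eq)
    qed simp
  qed
  also have "\<dots> = (\<integral>\<^sup>+s. (\<integral>\<^sup>+x. ennreal (2 * s ^ 3 * exp (- (s\<^sup>2 * ?q x))) * indicator ({0..} \<times> \<Delta>) (s, x) \<partial>lborel) \<partial>lborel)"
  proof (rule nn_integral_lborel_swap)
    have "(\<lambda>z. ennreal ((2 * (fst z) ^ 3) * exp (- ((fst z)\<^sup>2 * ?q (snd z)))) * indicator ({0..} \<times> \<Delta>) z) \<in> borel_measurable borel"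
      unfolding qf_def
      by (intro borel_measurable_indicator_exp continuous_intros closed_Times closed_atLeast compact_imp_closed compact_\<Delta>)
    then show "(\<lambda>z. ennreal (2 * fst z ^ 3 * exp (- ((fst z)\<^sup>2 * ?q (snd z)))) * indicator ({0..} \<times> \<Delta>) (fst z, snd z)) \<in> borel_measurable borel"
      by simp
  qed
  also have "\<dots> = (\<integral>\<^sup>+s. 2 * (\<integral>\<^sup>+x. ennreal (exp (- qf (\<rho> a * (s - x \<bullet> y)) x)) * indicator ?C (s, x) \<partial>lborel) \<partial>lborel)"
    by (rule nn_integral_cong_AE, use AE_lborel_singleton[of "0 :: real"] in eventually_elim) (rule slice_eq)
  also have "\<dots> = 2 * (\<integral>\<^sup>+x. (\<integral>\<^sup>+s. ennreal (exp (- qf (\<rho> a * (s - x \<bullet> y)) x)) * indicator ?C (s, x) \<partial>lborel) \<partial>lborel)"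
  proof -
    have "(\<lambda>z. ennreal (1 * exp (- qf (\<rho> a * (fst z - snd z \<bullet> y)) (snd z))) * indicator ?C z) \<in> borel_measurable borel"
      unfolding qf_def by (intro borel_measurable_indicator_exp continuous_intros closed_C)
    then have meas: "(\<lambda>z. ennreal (exp (- qf (\<rho> a * (fst z - snd z \<bullet> y)) (snd z))) * indicator ?C (fst z, snd z)) \<in> borel_measurable borel"
      by simp
    then have "(\<lambda>(s, x). ennreal (exp (- qf (\<rho> a * (s - x \<bullet> y)) x)) * indicator ?C (s, x)) \<in> borel_measurable (lborel \<Otimes>\<^sub>M lborel)"
      by (simp add: lborel_prod case_prod_beta')
    from nn_integral_cmult[OF lborel.borel_measurable_nn_integral[OF this], of 2]
    show ?thesis by (simp only: nn_integral_lborel_swap[OF meas])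
  qed
  also have "(\<integral>\<^sup>+x. (\<integral>\<^sup>+s. ennreal (exp (- qf (\<rho> a * (s - x \<bullet> y)) x)) * indicator ?C (s, x) \<partial>lborel) \<partial>lborel)
    = ennreal (1 / \<rho> a) * J"
    unfolding fibre_eq J_def
    by (rule nn_integral_cmult) (use J_measurable in simp)
  also have "2 * (ennreal (1 / \<rho> a) * J) = ennreal (2 / \<rho> a) * J"
  proof -
    have "ennreal (2 / \<rho> a) = 2 * ennreal (1 / \<rho> a)" using \<rho>_pos ennreal_mult[of 2 "1 / \<rho> a"] by simp
    then show ?thesis by (simp add: mult.assoc)
  qed
  finally show ?thesis .
qed

text \<open>Only the measure changes: the coordinate of \<open>a\<close> is split off by Fubini's
  theorem and the three others are collected into a vector of \<open>real^3\<close>.\<close>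

lemma pack_integral_eq: "ennreal (pack_integral \<sigma> \<kappa>) = J"
proof -
  have \<sigma>': "\<sigma> = insert a {b, c, d}" "a \<notin> {b, c, d}" using ne by (auto simp: \<sigma>)
  define m where "m = Min ((\<lambda>i. (\<kappa> i)\<^sup>2 - 1) ` \<sigma>)"
  define K where "K = Max (\<kappa> ` \<sigma>)"
  have m: "m > 0" unfolding m_def using fin mem(1) gt by (subst Min_gr_iff) auto
  interpret pack_bounds \<sigma> \<kappa> m K
  proof
    fix i assume i: "i \<in> \<sigma>"
    show "0 \<le> \<kappa> i" using gt i by force
    have "m \<le> (\<kappa> i)\<^sup>2 - 1" unfolding m_def using fin i by (intro Min_le) auto
    then show "1 + m \<le> (\<kappa> i)\<^sup>2" by simp
    show "\<kappa> i \<le> K" unfolding K_def using fin i by simp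
  qed (use fin m in auto)
  have coord: "(\<lambda>u. u i) \<in> borel_measurable (PiM \<sigma> (\<lambda>_. lborel))" if "i \<in> \<sigma>" for i
    using that by measurable
  have meas: "(\<lambda>u. ennreal (exp (- pack_form \<sigma> \<kappa> u))) \<in> borel_measurable (PiM \<sigma> (\<lambda>_. lborel))"
    unfolding pack_form_def
    by (intro measurable_compose[OF _ measurable_ennreal] measurable_compose[OF _ borel_measurable_exp] borel_measurable_uminus borel_measurable_add borel_measurable_diff
      borel_measurable_times borel_measurable_power borel_measurable_const borel_measurable_sum coord)
  have meas': "(\<lambda>u. ennreal (exp (- pack_form \<sigma> \<kappa> u)) * (\<Prod>i\<in>\<sigma>. indicator {0..} (u i))) \<in> borel_measurable (PiM \<sigma> (\<lambda>_. lborel))"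
    by (intro borel_measurable_times_ennreal meas borel_measurable_prod_ennreal measurable_compose[OF coord] borel_measurable_indicator) auto
  let ?T = "\<lambda>u. vector [u b, u c, u d] :: real^3"
  have "?T = (\<lambda>u. u b *\<^sub>R axis 1 1 + u c *\<^sub>R axis 2 1 + u d *\<^sub>R axis 3 1)"
    by (simp add: fun_eq_iff vec_eq_iff forall_3 axis_def)
  moreover have "(\<lambda>u. u b *\<^sub>R axis 1 1 + u c *\<^sub>R axis 2 1 + u d *\<^sub>R axis 3 1 :: real^3) \<in> PiM {b, c, d} (\<lambda>_. lborel) \<rightarrow>\<^sub>M borel"
    by measurable
  ultimately have T: "?T \<in> PiM {b, c, d} (\<lambda>_. lborel) \<rightarrow>\<^sub>M borel" by simp
  have "ennreal (pack_integral \<sigma> \<kappa>) = (\<integral>\<^sup>+u. ennreal (exp (- pack_form \<sigma> \<kappa> u)) \<partial>PiM \<sigma> (\<lambda>_. halfline))"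
    unfolding pack_integral_def by (rule nn_integral_eq_integral[OF pack_integral_integrable, symmetric]) simp
  also have "\<dots> = (\<integral>\<^sup>+u. ennreal (exp (- pack_form \<sigma> \<kappa> u)) * (\<Prod>i\<in>\<sigma>. indicator {0..} (u i)) \<partial>PiM \<sigma> (\<lambda>_. lborel))"
    by (rule nn_integral_PiM_halfline[OF fin meas])
  also have "\<dots> = (\<integral>\<^sup>+u. (\<integral>\<^sup>+t. ennreal (exp (- pack_form \<sigma> \<kappa> (u(a := t)))) * (\<Prod>i\<in>\<sigma>. indicator {0..} ((u(a := t)) i)) \<partial>lborel)
      \<partial>PiM {b, c, d} (\<lambda>_. lborel))"
    using meas' unfolding \<sigma>'(1) by (intro lborel_product.product_nn_integral_insert) (use \<sigma>'(2) in auto)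
  also have "\<dots> = (\<integral>\<^sup>+u. (\<integral>\<^sup>+t. ennreal (exp (- qf t (?T u))) * indicator ({0..} \<times> orth) (t, ?T u) \<partial>lborel) \<partial>PiM {b, c, d} (\<lambda>_. lborel))"
  proof (intro nn_integral_cong)
    fix u t
    have "pack_form \<sigma> \<kappa> (u(a := t)) = qf t (?T u)"
      unfolding pack_form_def \<sigma> sum_distinct4[OF dist] qf_def using ne by simp
    moreover have "(\<Prod>i\<in>\<sigma>. indicator {0..} ((u(a := t)) i)) = (indicator ({0..} \<times> orth) (t, ?T u) :: ennreal)"
      unfolding \<sigma> using ne by (simp add: indicator_def orth_def)
    ultimately show "ennreal (exp (- pack_form \<sigma> \<kappa> (u(a := t)))) * (\<Prod>i\<in>\<sigma>. indicator {0..} ((u(a := t)) i))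
      = ennreal (exp (- qf t (?T u))) * indicator ({0..} \<times> orth) (t, ?T u)" by simp
  qed
  also have "\<dots> = J"
  proof -
    have "distinct [b, c, d]" using dist by simp
    then show ?thesis
      unfolding J_def by (subst lborel_vec3_eq_PiM, assumption, subst nn_integral_distr[OF T]) (simp_all only: measurable_distr_eq1 J_measurable)
  qed
  finally show ?thesis .
qed

text \<open>The determinant of the affine parametrisation contributes
  \<open>2 * sqrt (pack_Q \<sigma> \<kappa>) * \<rho> a\<close> and the simplex integral
  \<open>2 / \<rho> a\<close>, so \<open>\<rho> a\<close> cancels and the constant 4 of
  \<open>pack_vol\<close> appears.\<close>

lemma hyp_volume_hull:
  assumes ball: "p ` \<sigma> \<subseteq> ball 0 1"
  shows "hyp_volume (convex hull (p ` \<sigma>)) = pack_vol \<sigma> \<kappa>"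
proof -
  let ?f = "\<lambda>x :: real^3. 1 / (1 - x \<bullet> x)\<^sup>2"
  let ?A = "(+) (p a) ` g ` \<Delta>"
  have sub: "?A \<subseteq> ball 0 1"
    unfolding hull_eq[symmetric] using ball by (rule hull_minimal) (rule convex_ball)
  then have inb: "p a + g x \<in> ball 0 1" if "x \<in> \<Delta>" for x using that by blast
  have ne1: "1 - x \<bullet> x \<noteq> 0" if "x \<in> ball 0 1" for x :: "real^3"
    proof -
    have "(norm x)\<^sup>2 < 1\<^sup>2" using that by (intro power_strict_mono) auto
    then show ?thesis by (simp add: dot_square_norm)
  qed
  have nz: "(p a + g x) \<bullet> (p a + g x) \<noteq> 1" if "x \<in> \<Delta>" for x using ne1[OF inb[OF that]] by simp
  have compact_g: "compact (g ` \<Delta>)"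
    by (intro compact_continuous_image linear_continuous_on_compose[OF continuous_on_id] linear_g compact_\<Delta>)
  then have compact_A: "compact ?A" by (rule compact_translation)
  have cont_A: "continuous_on ?A ?f" by (intro continuous_intros) (use nz in auto)
  have cont_g: "continuous_on (g ` \<Delta>) (\<lambda>x. ?f (p a + x))" by (intro continuous_intros) (use nz in auto)
  have cont_\<Delta>: "continuous_on \<Delta> (\<lambda>x. ?f (p a + g x))"
    by (intro continuous_intros linear_continuous_on_compose[OF continuous_on_id linear_g]) (use nz in auto)
  have f_nonneg: "0 \<le> ?f x" for x by simp
  have f_meas: "(\<lambda>x. ennreal (?f x) * indicator ?A x) \<in> borel_measurable borel"
    using compact_A by (intro borel_measurable_times_ennreal borel_measurable_indicator borel_compact)
      (auto intro!: measurable_compose[OF _ measurable_ennreal] borel_measurable_divide borel_measurable_power borel_measurable_diff borel_measurable_inner)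
  have "ennreal (hyp_volume (convex hull (p ` \<sigma>))) = (\<integral>\<^sup>+x. ennreal (?f x) * indicator ?A x \<partial>lborel)"
    unfolding hyp_volume_def hull_eq by (rule compact_nn_integral(2)[OF compact_A cont_A f_nonneg, symmetric])
  also have "\<dots> = (\<integral>\<^sup>+x. ennreal (?f (p a + x)) * indicator ?A (p a + x) \<partial>lborel)"
    by (rule nn_integral_lborel_plus[OF f_meas])
  also have "\<dots> = (\<integral>\<^sup>+x. ennreal (?f (p a + x)) * indicator (g ` \<Delta>) x \<partial>lborel)"
    by (intro nn_integral_cong) (auto simp: indicator_def)
  also have "\<dots> = ennreal (integral (g ` \<Delta>) (\<lambda>x. ?f (p a + x)))"
    by (rule compact_nn_integral(2)[OF compact_g cont_g f_nonneg])
  also have "integral (g ` \<Delta>) (\<lambda>x. ?f (p a + x)) = \<bar>det (matrix g)\<bar> * integral \<Delta> (\<lambda>x. ?f (p a + g x))"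
    by (rule integral_linear_image[OF linear_g compact_nn_integral(1)[OF compact_g cont_g f_nonneg]])
  also have "ennreal \<dots> = ennreal \<bar>det (matrix g)\<bar> * ennreal (integral \<Delta> (\<lambda>x. ?f (p a + g x)))"
    by (rule ennreal_mult') simp
  also have "ennreal (integral \<Delta> (\<lambda>x. ?f (p a + g x))) = ennreal (2 / \<rho> a) * J"
    unfolding compact_nn_integral(2)[OF compact_\<Delta> cont_\<Delta> f_nonneg, symmetric]
    by (rule nn_integral_simplex[OF inb])
  also have "ennreal \<bar>det (matrix g)\<bar> * \<dots> = ennreal (pack_vol \<sigma> \<kappa>)"
    unfolding pack_integral_eq[symmetric] det_g pack_vol_def using \<rho>_pos Q pack_integral_nonneg[of \<sigma> \<kappa>]
    by (simp add: ennreal_mult[symmetric] mult.assoc[symmetric])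
  finally have "ennreal (hyp_volume (convex hull (p ` \<sigma>))) = ennreal (pack_vol \<sigma> \<kappa>)" .
  moreover have "0 \<le> hyp_volume (convex hull (p ` \<sigma>))"
    unfolding hyp_volume_def hull_eq
    by (rule Henstock_Kurzweil_Integration.integral_nonneg[OF set_lebesgue_integral_eq_integral(1)[OF
      compact_nn_integral(1)[OF compact_A cont_A f_nonneg]] f_nonneg])
  moreover have "0 \<le> pack_vol \<sigma> \<kappa>" using Q pack_integral_nonneg[of \<sigma> \<kappa>] by (simp add: pack_vol_def)
  ultimately show ?thesis by (simp only: ennreal_inj)
qed

end

section \<open>The curvature functional\<close>

text \<open>The inequality used in both directions traps \<open>f u - f x\<close> between the linear
  functions of \<open>u - x\<close> given by \<open>G x\<close> and \<open>G u\<close>. Continuity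
  of \<open>G\<close> makes their difference negligible.\<close>

lemma has_derivative_between_tangents:
  fixes f :: "'a::real_inner \<Rightarrow> real"
  assumes X: "open X" "x \<in> X" and G: "isCont G x"
    and le: "\<And>u v. u \<in> X \<Longrightarrow> v \<in> X \<Longrightarrow> f v + G v \<bullet> (u - v) \<le> f u"
  shows "(f has_derivative (\<lambda>h. G x \<bullet> h)) (at x)"
  unfolding has_derivative_at_alt
proof (intro conjI allI impI)
  show "bounded_linear ((\<bullet>) (G x))" by (rule bounded_linear_inner_right)
  fix e :: real assume e: "0 < e"
  obtain d1 where d1: "d1 > 0" "\<And>u. dist u x < d1 \<Longrightarrow> dist (G u) (G x) < e"
  using G e unfolding continuous_at_eps_delta by blast
  obtain d2 where d2: "d2 > 0" "ball x d2 \<subseteq> X" using X open_contains_ball by blast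
  show "\<exists>d>0. \<forall>u. norm (u - x) < d \<longrightarrow> norm (f u - f x - G x \<bullet> (u - x)) \<le> e * norm (u - x)"
  proof (intro exI[of _ "min d1 d2"] conjI allI impI)
    fix u assume u: "norm (u - x) < min d1 d2"
    then have "u \<in> X" using d2(2) by (auto simp: dist_norm norm_minus_commute subset_iff)
    have "f u - f x - G x \<bullet> (u - x) \<le> (G u - G x) \<bullet> (u - x)"
      using le[OF X(2) \<open>u \<in> X\<close>] by (simp add: inner_diff_left inner_diff_right)
    also have "\<dots> \<le> norm (G u - G x) * norm (u - x)" by (rule norm_cauchy_schwarz)
    also have "\<dots> \<le> e * norm (u - x)"
      using d1(2)[of u] u by (intro mult_right_mono) (auto simp: dist_norm)
    finally show "norm (f u - f x - G x \<bullet> (u - x)) \<le> e * norm (u - x)"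
      using le[OF \<open>u \<in> X\<close> X(2)] by simp
  qed (use d1 d2 in auto)
qed

abbreviation coths :: "real^'n::finite \<Rightarrow> 'n \<Rightarrow> real" where
  "coths r \<equiv> \<lambda>i. coth (r $ i)"

lemma Q_form_pack: "Q_form r \<sigma> = pack_Q \<sigma> (coths r)"
  by (simp add: Q_form_def pack_Q_def)

lemma tet_volume_pack:
  fixes r :: "real^'n::finite"
  assumes card: "card \<sigma> = 4" and r: "\<And>i. i \<in> \<sigma> \<Longrightarrow> 0 < r $ i" and Q: "Q_form r \<sigma> > 0"
  shows "tet_volume r \<sigma> = pack_vol \<sigma> (coths r)"
proof -
  obtain a b c d where \<sigma>: "\<sigma> = {a, b, c, d}" and dist: "distinct [a, b, c, d]" using card_4_obtain[OF card] .
  have p: "packing_tetrahedron r \<sigma> (tetrahedron r \<sigma>)"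
    unfolding tetrahedron_def by (rule someI_ex[OF packing_tetrahedron_exists[OF card r Q]])
  obtain \<rho> where \<rho>: "\<And>i. i \<in> \<sigma> \<Longrightarrow> 0 < \<rho> i"
    and gram: "\<And>i j. i \<in> \<sigma> \<Longrightarrow> j \<in> \<sigma> \<Longrightarrow>
      1 - tetrahedron r \<sigma> i \<bullet> tetrahedron r \<sigma> j = \<rho> i * \<rho> j * pack_gram (coths r) i j"
    using packing_tetrahedron_gram[OF r p] by blast
  interpret gram_tetrahedron \<sigma> a b c d "coths r" \<rho> "tetrahedron r \<sigma>"
    by unfold_locales (use \<sigma> dist \<rho> gram Q coth_gt_1 r in \<open>auto simp: Q_form_pack\<close>)
  show ?thesis
    unfolding tet_volume_def
    by (rule hyp_volume_hull) (use p in \<open>simp add: packing_tetrahedron_def hyp_space_def\<close>)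
qed

lemma card_simplices_3: "\<sigma> \<in> simplices 3 T \<Longrightarrow> card \<sigma> = 4"
  by (simp add: simplices_def)

lemma real_packingsD:
  assumes "r \<in> real_packings T"
  shows "0 < r $ i" "1 < coth (r $ i)" "\<sigma> \<in> simplices 3 T \<Longrightarrow> 0 < Q_form r \<sigma>"
    and "\<sigma> \<in> simplices 3 T \<Longrightarrow> 0 < pack_Q \<sigma> (coths r)"
  using assms coth_gt_1 by (auto simp: real_packings_def Q_form_pack)

lemma solid_angle_real_packing:
  assumes "r \<in> real_packings T" "\<sigma> \<in> simplices 3 T" "i \<in> \<sigma>"
  shows "solid_angle r \<sigma> i = pack_solid \<sigma> (coths r) i"
  using assms by (intro solid_angle_pack card_simplices_3) (auto dest: real_packingsD)

lemma tet_volume_real_packing: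
  assumes "r \<in> real_packings T" "\<sigma> \<in> simplices 3 T"
  shows "tet_volume r \<sigma> = pack_vol \<sigma> (coths r)"
  using assms by (intro tet_volume_pack card_simplices_3) (auto dest: real_packingsD)

lemma continuous_on_coth_nth:
  "continuous_on {r :: real^'n::finite. \<forall>i. 0 < r $ i} (\<lambda>r. coth (r $ i))"
  unfolding coth_def by (intro continuous_intros) (auto simp: less_imp_neq[symmetric] dest: spec[of _ i])

lemma open_real_packings:
  fixes T :: "'n::finite set set"
  shows "open (real_packings T)"
proof -
  let ?P = "{r :: real^'n::finite. \<forall>i. 0 < r $ i}"
  have "open (\<Inter>i. {r :: real^'n. 0 < r $ i})" by (intro open_INT finite ballI open_Collect_less continuous_intros)
  moreover have "(\<Inter>i. {r :: real^'n. 0 < r $ i}) = ?P" by auto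
  ultimately have P: "open ?P" by (simp only:)
  have "continuous_on ?P (\<lambda>r. Q_form r \<sigma>)" for \<sigma>
    unfolding Q_form_def by (intro continuous_intros continuous_on_coth_nth)
  then have "open (?P \<inter> (\<lambda>r. Q_form r \<sigma>) -` {0<..})" for \<sigma>
    using P by (simp add: continuous_on_open_vimage Int_commute)
  then have "open (?P \<inter> (\<Inter>\<sigma>\<in>simplices 3 T. ?P \<inter> (\<lambda>r. Q_form r \<sigma>) -` {0<..}))"
    using P by (intro open_Int open_INT) auto
  also have "\<dots> = real_packings T" by (auto simp: real_packings_def)
  finally show ?thesis .
qed

text \<open>The chosen tetrahedra need not vary continuously, but the explicit formula for the solid
  angles does.\<close>

lemma continuous_on_curvature: "continuous_on (real_packings T) (curvature T)"
proof -
  have coth: "continuous_on (real_packings T) (\<lambda>r. coth (r $ i))" for i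
    by (rule continuous_on_subset[OF continuous_on_coth_nth]) (auto simp: real_packings_def)
  have "continuous_on (real_packings T) (\<lambda>r. \<chi> i. 4 * pi - (\<Sum>\<sigma> | \<sigma> \<in> simplices 3 T \<and> i \<in> \<sigma>. pack_solid \<sigma> (coths r) i))"
    unfolding pack_solid_def pack_angle_def pack_w_def pack_Q_def
    by (intro continuous_on_vec_lambda continuous_intros coth)
      (auto dest: real_packingsD(4) simp: pack_Q_def)
  also have "?this \<longleftrightarrow> continuous_on (real_packings T) (curvature T)"
    by (intro continuous_on_cong refl) (auto simp: curvature_def solid_angle_real_packing intro!: sum.cong)
  finally show ?thesis .
qed

text \<open>The radii \<open>x\<close> are kept separate from the packing \<open>r\<close> that
  determines angles and volumes, so the formula covers both \<open>S_functional\<close> and its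
  tangents. It holds by exchanging the sums over vertices and tetrahedra.\<close>

lemma S_functional_eq:
  fixes r :: "real^'n::finite" and T :: "'n set set"
  shows "(\<Sum>i\<in>UNIV. curvature T r $ i * x $ i) - 2 * packing_volume T r
    = 4 * pi * (\<Sum>i\<in>UNIV. x $ i) - (\<Sum>\<sigma>\<in>simplices 3 T. (\<Sum>i\<in>\<sigma>. x $ i * solid_angle r \<sigma> i) + 2 * tet_volume r \<sigma>)"
proof -
  have "(\<Sum>i\<in>UNIV. \<Sum>\<sigma> | \<sigma> \<in> simplices 3 T \<and> i \<in> \<sigma>. x $ i * solid_angle r \<sigma> i)
    = (\<Sum>\<sigma>\<in>simplices 3 T. \<Sum>i | i \<in> UNIV \<and> i \<in> \<sigma>. x $ i * solid_angle r \<sigma> i)"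
    by (rule sum.swap_restrict) (simp_all add: simplices_def)
  then show ?thesis
    by (simp add: curvature_def packing_volume_def right_diff_distrib sum_subtractf sum_distrib_left
      sum.distrib mult.commute[of _ "x $ _"])
qed

text \<open>Evaluated at \<open>u\<close>, the tangent at \<open>v\<close> is the expression of
  \<open>S_functional_eq\<close> with the radii of \<open>u\<close> and the angles of
  \<open>v\<close>. On each tetrahedron the claim is the tangent inequality of the volume based at
  \<open>u\<close> and evaluated at \<open>v\<close>; the sum enters with a minus sign.\<close>

lemma S_functional_above_tangent:
  assumes u: "u \<in> real_packings T" and v: "v \<in> real_packings T"
  shows "S_functional T v + curvature T v \<bullet> (u - v) \<le> S_functional T u"
proof -
  have "(\<Sum>i\<in>\<sigma>. u $ i * solid_angle u \<sigma> i) + 2 * tet_volume u \<sigma>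
    \<le> (\<Sum>i\<in>\<sigma>. u $ i * solid_angle v \<sigma> i) + 2 * tet_volume v \<sigma>" if \<sigma>: "\<sigma> \<in> simplices 3 T" for \<sigma>
    using pack_vol_above_tangent[of \<sigma> "coths u" "coths v"] card_simplices_3[OF \<sigma>] \<sigma>
    by (simp add: real_packingsD[OF u] real_packingsD[OF v] solid_angle_real_packing[OF u] solid_angle_real_packing[OF v]
      tet_volume_real_packing[OF u] tet_volume_real_packing[OF v] arcoth_coth)
  then have "(\<Sum>i\<in>UNIV. curvature T v $ i * u $ i) - 2 * packing_volume T v \<le> (\<Sum>i\<in>UNIV. curvature T u $ i * u $ i) - 2 * packing_volume T u"
    unfolding S_functional_eq by (intro diff_left_mono sum_mono)
  then show ?thesis
    by (simp add: S_functional_def inner_vec_def right_diff_distrib sum_subtractf)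
qed

lemma S_functional_has_derivative:
  assumes "r \<in> real_packings T"
  shows "(S_functional T has_derivative (\<lambda>h. curvature T r \<bullet> h)) (at r)"
  using open_real_packings assms
proof (rule has_derivative_between_tangents)
  show "isCont (curvature T) r"
    using continuous_on_curvature[of T] assms by (simp add: continuous_on_eq_continuous_at[OF open_real_packings])
qed (rule S_functional_above_tangent)

theorem theorem1p2:
  fixes M :: "'a topology" and T :: "'n::finite set set"
  assumes "closed_3_manifold M" and "triangulates T M"
  shows "((\<exists>r \<in> real_packings T. curvature T r = 0) \<longleftrightarrow>
          (\<exists>r \<in> real_packings T. (S_functional T has_derivative (\<lambda>_. 0)) (at r))) \<and>
         ((\<exists>r \<in> real_packings T. (S_functional T has_derivative (\<lambda>_. 0)) (at r)) \<longleftrightarrow>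
          (\<exists>r \<in> real_packings T. ereal (S_functional T r) = Y_invariant T))"
proof -
  have critical: "(S_functional T has_derivative (\<lambda>_. 0)) (at r) \<longleftrightarrow> curvature T r = 0" if r: "r \<in> real_packings T" for r
  proof
    assume "(S_functional T has_derivative (\<lambda>_. 0)) (at r)"
    then have "(\<lambda>h. curvature T r \<bullet> h) = (\<lambda>_. 0)"
      by (rule has_derivative_unique[OF S_functional_has_derivative[OF r]])
    then have "curvature T r \<bullet> curvature T r = 0" by meson
    then show "curvature T r = 0" by simp
  qed (use S_functional_has_derivative[OF r] in simp)
  have minimum: "ereal (S_functional T r) = Y_invariant T \<longleftrightarrow> curvature T r = 0" if r: "r \<in> real_packings T" for r
  proof
    assume min: "ereal (S_functional T r) = Y_invariant T"
    have "S_functional T r \<le> S_functional T u" if "u \<in> real_packings T" for u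
      using INF_lower[OF that, of "\<lambda>r. ereal (S_functional T r)"]
      unfolding Y_invariant_def[symmetric] min[symmetric] by simp
    then have "(\<lambda>h. curvature T r \<bullet> h) = (\<lambda>_. 0)"
      by (intro differential_zero_maxmin[OF r open_real_packings S_functional_has_derivative[OF r]]) blast
    then have "curvature T r \<bullet> curvature T r = 0" by meson
    then show "curvature T r = 0" by simp
  next
    assume "curvature T r = 0"
    \<comment> \<open>The tangent at \<open>r\<close> is horizontal, so its value bounds the
      functional from below on all real packings.\<close>
    then have "ereal (S_functional T r) \<le> Y_invariant T"
      unfolding Y_invariant_def using S_functional_above_tangent[OF _ r] by (intro INF_greatest) simp
    moreover have "Y_invariant T \<le> ereal (S_functional T r)"
      unfolding Y_invariant_def by (rule INF_lower[OF r])
    ultimately show "ereal (S_functional T r) = Y_invariant T" by (rule antisym)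
  qed
  show ?thesis using critical minimum by blast
qed

end
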